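(* Let $\Omega\subset\mathbb{R}^2$ be a bounded, open, connected set containing the origin $O$. Consider a singular stress field $\boldsymbol{\sigma}\in\mathcal{A}(\Omega,\mathrm{Sym})$ and a body force field $\boldsymbol{B}\in\mathcal{E}(\Omega,\mathbb{R}^2)$ with the representation $\boldsymbol{B}=\sum_{\alpha\in\mathbb{N}^2,\,|\alpha|\le\deg(\boldsymbol{B})}\boldsymbol{b}^\alpha\partial^\alpha\delta_O$, where $\boldsymbol{b}^\alpha\in\mathbb{R}^2$. Then: (a) The equilibrium condition $\operatorname{Div}\boldsymbol{\sigma}+\boldsymbol{B}=\boldsymbol{0}$ (in the sense of distributions on $\Omega$) implies the three conditions (i) $\operatorname{div}(\boldsymbol{\sigma}|_{\Omega-O})=\boldsymbol{0}$ on $\Omega-O$; (ii) $\int_{\partial B_\epsilon}(\boldsymbol{\sigma}|_{\Omega-O})\boldsymbol{n}\,dl=-\boldsymbol{b}^{(0,0)}$; (iii) $\deg(\boldsymbol{B})\le\deg(\boldsymbol{\sigma})+1$. Here $B_\epsilon$ is any open disc of radius $\epsilon>0$ centred at $O$ with $\overline{B_\epsilon}\subset\Omega$, and $\boldsymbol{n}$ is the outward unit normal to $\partial B_\epsilon$. (b) If $\deg(\boldsymbol{\sigma})<0$, then the equilibrium condition $\operatorname{Div}\boldsymbol{\sigma}+\boldsymbol{B}=\boldsymbol{0}$ is equivalent to conditions (i), (ii) and (iii) together.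
   Context: $\Omega-O$ means $\Omega\setminus\{O\}$; $\mathrm{Sym}$ is the space of symmetric linear maps $\mathbb{R}^2\to\mathbb{R}^2$; $\mathbb{N}$ includes $0$. For a finite-dimensional space $V$, $\mathcal{D}'(\Omega,V)$ is the space of $V$-valued distributions, acting on compactly supported smooth $V$-valued test functions by $\boldsymbol{T}(\boldsymbol{\phi})=T_i(\phi_i)$ or $T_{ij}(\phi_{ij})$ (summation convention). $\mathcal{A}(\Omega,V)$ is the set of $\boldsymbol{T}\in\mathcal{D}'(\Omega,V)$ with singular support contained in $\{O\}$; then $\boldsymbol{T}|_{\Omega-O}$ is given by a smooth function on $\Omega-O$ and is identified with it. $\mathcal{E}(\Omega,V)$ is the set of $\boldsymbol{T}\in\mathcal{D}'(\Omega,V)$ with support contained in $\{O\}$. $\delta_O$ is the Dirac measure at $O$. Every element of $\mathcal{E}(\Omega,V)$ has a unique representation $\sum_{|\alpha|\le\deg}\boldsymbol{b}^\alpha\partial^\alpha\delta_O$ with $\boldsymbol{b}^\alpha\in V$; $\boldsymbol{b}^{(0,0)}$ is the coefficient of $\delta_O$ (zero if absent). Distributional divergence: $\operatorname{Div}\boldsymbol{\sigma}(\boldsymbol{\psi})=-\boldsymbol{\sigma}(\nabla\boldsymbol{\psi})$, i.e. $(\operatorname{Div}\boldsymbol{\sigma})_i=\partial_j\sigma_{ij}$; $\operatorname{div}$ is the corresponding classical operator. Degree of divergence (with respect to $O$): choose an open ball $B_r\subset\Omega$ centred at $O$. For a test function $\phi$ on $B_r$ and $0<\lambda<1$ put $\phi_\lambda(\boldsymbol{x})=\lambda^{-2}\phi(\boldsymbol{x}/\lambda)$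 and $(T|_{B_r})_\lambda(\phi)=T(\phi_\lambda)$. The scaling degree is $\operatorname{sd}(T)=\inf\{k\in\mathbb{R}:\lim_{\lambda\to0}\lambda^k(T|_{B_r})_\lambda=0 \text{ in the sense of distributions}\}$ and $\deg(T)=\operatorname{sd}(T)-2$ (with value $-\infty$ if the infimum is over all of $\mathbb{R}$). For vector/tensor valued distributions the same definition is used with vector/tensor valued test functions (equivalently, the maximum over components). *)

theory Defs
  imports "HOL-Analysis.Analysis"
begin

section \<open>Smooth functions on the plane\<close>

type_synonym plane = "real^2"

definition partial :: "2 \<Rightarrow> (plane \<Rightarrow> 'v::real_normed_vector) \<Rightarrow> plane \<Rightarrow> 'v" where
  "partial i f x = frechet_derivative f (at x) (axis i 1)"

text \<open>\<open>mpartial \<alpha>\<close> is \<open>\<partial>\<^sup>\<alpha>\<close> for a multi-index \<open>\<alpha>\<close>, and \<open>mdeg \<alpha>\<close> is \<open>|\<alpha>|\<close>.\<close>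

definition mpartial :: "nat \<times> nat \<Rightarrow> (plane \<Rightarrow> 'v::real_normed_vector) \<Rightarrow> plane \<Rightarrow> 'v" where
  "mpartial \<alpha> f = (partial 1 ^^ fst \<alpha>) ((partial 2 ^^ snd \<alpha>) f)"

definition mdeg :: "nat \<times> nat \<Rightarrow> nat" where
  "mdeg \<alpha> = fst \<alpha> + snd \<alpha>"

text \<open>Used only for open \<open>U\<close>: all iterated partial derivatives, in any order, exist and are
  differentiable (hence continuous) on \<open>U\<close>, i.e. \<open>f\<close> is \<open>C\<^sup>\<infinity>\<close> on \<open>U\<close>.\<close>

definition smooth_on :: "plane set \<Rightarrow> (plane \<Rightarrow> 'v::real_normed_vector) \<Rightarrow> bool" where
  "smooth_on U f \<longleftrightarrow> (\<forall>is. foldr partial is f differentiable_on U)"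

definition test_funs :: "plane set \<Rightarrow> (plane \<Rightarrow> 'v::euclidean_space) set" where
  "test_funs U = {\<phi>. smooth_on UNIV \<phi> \<and>
     compact (closure {x. \<phi> x \<noteq> 0}) \<and> closure {x. \<phi> x \<noteq> 0} \<subseteq> U}"

section \<open>Distributions\<close>

text \<open>A distribution with values in the Euclidean space \<open>'v\<close> is a functional on \<open>'v\<close>-valued test
  functions; its values on other functions are irrelevant, so two distributions on \<open>\<Omega>\<close> are equal
  when they agree on \<^term>\<open>test_funs \<Omega>\<close>.  Continuity is expressed by the usual seminorm estimates
  on compact sets.\<close>

type_synonym 'v functional = "(plane \<Rightarrow> 'v) \<Rightarrow> real"

definition is_distribution :: "plane set \<Rightarrow> 'v::euclidean_space functional \<Rightarrow> bool" where
  "is_distribution \<Omega> T \<longleftrightarrow>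
     (\<forall>\<phi>\<in>test_funs \<Omega>. \<forall>\<psi>\<in>test_funs \<Omega>. T (\<lambda>x. \<phi> x + \<psi> x) = T \<phi> + T \<psi>) \<and>
     (\<forall>c. \<forall>\<phi>\<in>test_funs \<Omega>. T (\<lambda>x. c *\<^sub>R \<phi> x) = c * T \<phi>) \<and>
     (\<forall>K. compact K \<and> K \<subseteq> \<Omega> \<longrightarrow>
        (\<exists>C N. \<forall>\<phi>\<in>test_funs \<Omega>. closure {x. \<phi> x \<noteq> 0} \<subseteq> K \<longrightarrow>
           \<bar>T \<phi>\<bar> \<le> C * (\<Sum>\<alpha> | mdeg \<alpha> \<le> N. SUP x. norm (mpartial \<alpha> \<phi> x))))"

text \<open>\<open>\<D>'(\<Omega>,V)\<close> for a linear subspace \<open>V\<close> of \<open>'v\<close>: the distribution takes its values in \<open>V\<close>, i.e.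
  it annihilates test functions with values in the orthogonal complement of \<open>V\<close>.  For
  \<open>V = Sym\<close> (whose complement consists of the skew matrices) this says \<open>T\<^sub>i\<^sub>j = T\<^sub>j\<^sub>i\<close>; such a
  \<open>T\<close> is determined by its action on \<open>V\<close>-valued test functions, but
  can be applied to any matrix field, as is needed for \<open>\<sigma>(\<nabla>\<psi>) = \<sigma>\<^sub>i\<^sub>j(\<partial>\<^sub>j\<psi>\<^sub>i)\<close>.\<close>

definition distributions :: "plane set \<Rightarrow> 'v::euclidean_space set \<Rightarrow> 'v functional set" where
  "distributions \<Omega> V = {T. is_distribution \<Omega> T \<and>
     (\<forall>\<phi>\<in>test_funs \<Omega>. (\<forall>x. \<forall>v\<in>V. \<phi> x \<bullet> v = 0) \<longrightarrow> T \<phi> = 0)}"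

definition Sym :: "(real^2^2) set" where
  "Sym = {A. transpose A = A}"

definition dist_support :: "plane set \<Rightarrow> 'v::euclidean_space functional \<Rightarrow> plane set" where
  "dist_support \<Omega> T =
     {x\<in>\<Omega>. \<not> (\<exists>U. open U \<and> x \<in> U \<and> U \<subseteq> \<Omega> \<and> (\<forall>\<phi>\<in>test_funs U. T \<phi> = 0))}"

text \<open>On the open set \<open>U\<close>, the distribution \<open>T\<close> is given by the smooth function \<open>f\<close>.\<close>

definition given_by :: "plane set \<Rightarrow> 'v::euclidean_space functional \<Rightarrow> (plane \<Rightarrow> 'v) \<Rightarrow> bool" where
  "given_by U T f \<longleftrightarrow> smooth_on U f \<and>
     (\<forall>\<phi>\<in>test_funs U. T \<phi> = integral U (\<lambda>x. f x \<bullet> \<phi> x))"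

definition sing_support :: "plane set \<Rightarrow> 'v::euclidean_space functional \<Rightarrow> plane set" where
  "sing_support \<Omega> T =
     {x\<in>\<Omega>. \<not> (\<exists>U. open U \<and> x \<in> U \<and> U \<subseteq> \<Omega> \<and> (\<exists>f. given_by U T f))}"

definition \<A> :: "plane set \<Rightarrow> 'v::euclidean_space set \<Rightarrow> 'v functional set" where
  "\<A> \<Omega> V = {T \<in> distributions \<Omega> V. sing_support \<Omega> T \<subseteq> {0}}"

definition \<E> :: "plane set \<Rightarrow> 'v::euclidean_space set \<Rightarrow> 'v functional set" where
  "\<E> \<Omega> V = {T \<in> distributions \<Omega> V. dist_support \<Omega> T \<subseteq> {0}}"

text \<open>The smooth function with which \<open>T|\<^sub>U\<close> is identified when \<open>T\<close> is smooth on \<open>U\<close>.  It is unique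
  on \<open>U\<close>; its values outside \<open>U\<close> are arbitrary.\<close>

definition restr_fun :: "plane set \<Rightarrow> 'v::euclidean_space functional \<Rightarrow> plane \<Rightarrow> 'v" where
  "restr_fun U T = (SOME f. given_by U T f)"

definition dirac :: "real functional" where
  "dirac \<phi> = \<phi> 0"

definition dist_mpartial :: "nat \<times> nat \<Rightarrow> real functional \<Rightarrow> real functional" where
  "dist_mpartial \<alpha> T \<phi> = (-1) ^ mdeg \<alpha> * T (mpartial \<alpha> \<phi>)"

text \<open>The product \<open>b T\<close> of a vector and a scalar distribution:
  \<open>(b T)(\<phi>) = b\<^sub>i T(\<phi>\<^sub>i) = T(b\<^sub>i \<phi>\<^sub>i)\<close>.\<close>

definition vec_dist :: "'v::euclidean_space \<Rightarrow> real functional \<Rightarrow> 'v functional" where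
  "vec_dist b T \<phi> = T (\<lambda>x. b \<bullet> \<phi> x)"

section \<open>Degree of divergence\<close>

definition scaled :: "real \<Rightarrow> (plane \<Rightarrow> 'v::euclidean_space) \<Rightarrow> plane \<Rightarrow> 'v" where
  "scaled l \<phi> x = (1 / l\<^sup>2) *\<^sub>R \<phi> (x /\<^sub>R l)"

text \<open>The parameter \<open>r\<close> is the radius of the chosen ball \<open>B\<^sub>r \<subseteq> \<Omega>\<close>.  The infimum is taken in the
  extended reals, so it is \<open>-\<infinity>\<close> if every real \<open>k\<close> is admissible.\<close>

definition scaling_degree :: "real \<Rightarrow> 'v::euclidean_space functional \<Rightarrow> ereal" where
  "scaling_degree r T = Inf {ereal k | k.
     \<forall>\<phi>\<in>test_funs (ball 0 r). ((\<lambda>l. l powr k * T (scaled l \<phi>)) \<longlongrightarrow> 0) (at_right 0)}"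

definition degree_div :: "real \<Rightarrow> 'v::euclidean_space functional \<Rightarrow> ereal" where
  "degree_div r T = scaling_degree r T - 2"

text \<open>\<open>T = \<Sum>\<^bsub>|\<alpha>| \<le> deg T\<^esub> b\<^sup>\<alpha> \<partial>\<^sup>\<alpha> \<delta>\<^sub>O\<close> on \<open>\<Omega>\<close>, with the convention that the coefficients which are absent
  from the sum are zero.\<close>

definition dirac_repr ::
  "plane set \<Rightarrow> real \<Rightarrow> 'v::euclidean_space functional \<Rightarrow> (nat \<times> nat \<Rightarrow> 'v) \<Rightarrow> bool" where
  "dirac_repr \<Omega> r T b \<longleftrightarrow>
     (\<forall>\<phi>\<in>test_funs \<Omega>.
        T \<phi> = (\<Sum>\<alpha> | ereal (real (mdeg \<alpha>)) \<le> degree_div r T.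
                  vec_dist (b \<alpha>) (dist_mpartial \<alpha> dirac) \<phi>)) \<and>
     (\<forall>\<alpha>. \<not> ereal (real (mdeg \<alpha>)) \<le> degree_div r T \<longrightarrow> b \<alpha> = 0)"

section \<open>Divergence and flux\<close>

definition grad :: "(plane \<Rightarrow> real^2) \<Rightarrow> plane \<Rightarrow> real^2^2" where
  "grad \<psi> x = (\<chi> i j. partial j (\<lambda>y. \<psi> y $ i) x)"

definition Div :: "(real^2^2) functional \<Rightarrow> (real^2) functional" where
  "Div \<sigma> \<psi> = - \<sigma> (grad \<psi>)"

definition classical_div :: "(plane \<Rightarrow> real^2^2) \<Rightarrow> plane \<Rightarrow> real^2" where
  "classical_div s x = (\<chi> i. \<Sum>j\<in>UNIV. partial j (\<lambda>y. s y $ i $ j) x)"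

definition equilibrium :: "plane set \<Rightarrow> (real^2^2) functional \<Rightarrow> (real^2) functional \<Rightarrow> bool" where
  "equilibrium \<Omega> \<sigma> B \<longleftrightarrow> (\<forall>\<psi>\<in>test_funs \<Omega>. Div \<sigma> \<psi> + B \<psi> = 0)"

text \<open>\<open>\<integral>\<^bsub>\<partial>B\<^sub>\<epsilon>\<^esub> g dl\<close>, with the circle parametrised by the angle, so that \<open>dl = \<epsilon> dt\<close>.\<close>

definition circle_integral :: "real \<Rightarrow> (plane \<Rightarrow> real^2) \<Rightarrow> real^2" where
  "circle_integral \<epsilon> g = integral {0..2*pi} (\<lambda>t. \<epsilon> *\<^sub>R g (vector [\<epsilon> * cos t, \<epsilon> * sin t]))"

text \<open>Outward unit normal at \<open>x\<close> to the circle through \<open>x\<close> centred at the origin.\<close>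

definition outward_normal :: "plane \<Rightarrow> real^2" where
  "outward_normal x = x /\<^sub>R norm x"

end

theory Submission
  imports Defs "HOL-Computational_Algebra.Polynomial"
begin

text \<open>
  Write \<open>s\<close> for the smooth field that represents \<open>\<sigma>\<close> off the origin and \<open>F\<close> for its flux through a small
  circle. The functional \<open>D = Div \<sigma> + B\<close> is probed with three kinds of test fields.

  A test field \<open>\<psi>\<close> that vanishes near the origin does not see \<open>B\<close>, and it sees \<open>\<sigma>\<close> only through \<open>s\<close>, so
  integration by parts gives \<open>D \<psi> = \<integral> div s \<bullet> \<psi>\<close>. Hence \<open>D\<close> vanishes on all these fields exactly when
  \<open>div s = 0\<close>, by the fundamental lemma of the calculus of variations (\<open>fundamental_lemma\<close>).

  A field \<open>\<eta> v\<close> with a radial cutoff \<open>\<eta>\<close> that is \<open>1\<close> near the origin, and a constant vector \<open>v\<close>, measures the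
  flux: its gradient lives on an annulus, where \<open>\<sigma>\<close> is \<open>s\<close>, and integrating over the circles of this annulus
  gives \<open>Div \<sigma> (\<eta> v) = F \<bullet> v\<close> as soon as \<open>div s = 0\<close> (\<open>flux_identity\<close>). All derivatives of \<open>\<eta> v\<close> of
  positive order vanish at the origin, so \<open>B (\<eta> v) = b (0, 0) \<bullet> v\<close>. Given \<open>div s = 0\<close>, therefore, \<open>D\<close>
  vanishes on these fields exactly when \<open>F = - b (0, 0)\<close>.

  Rescaled fields \<open>\<phi>\<^sub>l\<close> give the statement about degrees: \<open>grad \<phi>\<^sub>l = l\<^sup>-\<^sup>1 (grad \<phi>)\<^sub>l\<close>, so the divergence
  raises the scaling degree by at most one (\<open>admissible_Div\<close>).

  This proves that equilibrium implies the three conditions. Conversely, if \<open>deg \<sigma> < 0\<close> and the three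
  conditions hold, then \<open>D\<close> is supported at the origin, has degree less than one, and kills every \<open>\<eta> v\<close>. A
  distribution supported at a point is a combination of derivatives of \<open>\<delta>\<close>, and a derivative of order
  \<open>m\<close> has degree \<open>m\<close>; so \<open>D\<close> is a multiple of \<open>\<delta>\<close>, and the multiple is zero because \<open>D (\<eta> v) = 0\<close>. The
  lemma \<open>point_supported_vanishes\<close> carries out this argument on the test fields. By Hadamard's lemma a
  test field is, near the origin, the sum of its value there, of homogeneous polynomials of degree
  \<open>m \<ge> 1\<close> with vector coefficients, and of products of a monomial of high degree with a smooth field. A
  homogeneous part is its own rescaling up to a power of \<open>l\<close>, so that the degree of \<open>D\<close> forces \<open>D\<close> to
  kill it; the products can be multiplied by ever smaller cutoffs, and the high degree of the monomial
  then outweighs the finite order of \<open>D\<close>.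
\<close>

section \<open>Partial derivatives and smooth functions\<close>

lemma partial_eq:
  assumes "(f has_derivative f') (at x)"
  shows "partial i f x = f' (axis i 1)"
  using frechet_derivative_at[OF assms] by (simp add: partial_def)

lemma has_derivative_partials:
  fixes f :: "plane \<Rightarrow> 'v::real_normed_vector"
  assumes "f differentiable at x"
  shows "(f has_derivative (\<lambda>h. \<Sum>i\<in>UNIV. (h $ i) *\<^sub>R partial i f x)) (at x)"
proof -
  let ?D = "frechet_derivative f (at x)"
  have D: "(f has_derivative ?D) (at x)"
    using assms frechet_derivative_works by blast
  then have lin: "linear ?D" by (rule has_derivative_linear)
  have "?D h = (\<Sum>i\<in>UNIV. (h $ i) *\<^sub>R partial i f x)" for h
  proof -
    have "?D h = ?D (\<Sum>i\<in>UNIV. (h $ i) *\<^sub>R axis i 1)"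
      using basis_expansion[of h] by (simp add: scalar_mult_eq_scaleR)
    also have "\<dots> = (\<Sum>i\<in>UNIV. (h $ i) *\<^sub>R partial i f x)"
      by (simp add: linear_sum[OF lin] linear_scale[OF lin] partial_def)
    finally show ?thesis .
  qed
  then have "?D = (\<lambda>h. \<Sum>i\<in>UNIV. (h $ i) *\<^sub>R partial i f x)" by blast
  with D show ?thesis by simp
qed

lemma partial_cong_open:
  assumes "open U" "x \<in> U" "\<And>y. y \<in> U \<Longrightarrow> f y = g y"
  shows "partial i f x = partial i g x"
proof -
  have "(f has_derivative f') (at x) \<longleftrightarrow> (g has_derivative f') (at x)" for f'
    using has_derivative_transform_within_open[of f f' x UNIV U g]
      has_derivative_transform_within_open[of g f' x UNIV U f] assms by auto
  then show ?thesis by (simp add: partial_def frechet_derivative_def)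
qed

lemma differentiable_on_cong_open:
  assumes "open U" "\<And>y. y \<in> U \<Longrightarrow> f y = g y" "f differentiable_on U"
  shows "g differentiable_on U"
  unfolding differentiable_on_def
proof
  fix x assume x: "x \<in> U"
  then obtain f' where "(f has_derivative f') (at x within U)"
    using assms(3) by (auto simp: differentiable_on_def differentiable_def)
  then have "(g has_derivative f') (at x within U)"
    using has_derivative_transform[OF x, of g f f'] assms(2) by auto
  then show "g differentiable at x within U"
    by (auto simp: differentiable_def)
qed

lemma foldr_partial_cong_open:
  assumes "open U" "x \<in> U" "\<And>y. y \<in> U \<Longrightarrow> f y = g y"
  shows "foldr partial is f x = foldr partial is g x"
  using assms(2)
proof (induction "is" arbitrary: x)
  case (Cons i "is")
  then show ?case
    using partial_cong_open[OF assms(1), of x "foldr partial is f" "foldr partial is g" i] by simp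
qed (use assms in auto)

text \<open>Smoothness of finite order makes closure properties provable by induction: a partial
  derivative of a product or of a composite is again built from products and composites, but with one
  order of differentiability less to establish.\<close>

definition smooth_upto :: "nat \<Rightarrow> plane set \<Rightarrow> (plane \<Rightarrow> 'v::real_normed_vector) \<Rightarrow> bool" where
  "smooth_upto n U f \<longleftrightarrow> (\<forall>is. length is \<le> n \<longrightarrow> foldr partial is f differentiable_on U)"

lemma smooth_on_iff_upto: "smooth_on U f \<longleftrightarrow> (\<forall>n. smooth_upto n U f)"
  by (auto simp: smooth_on_def smooth_upto_def)

lemma smooth_upto_0: "smooth_upto 0 U f \<longleftrightarrow> f differentiable_on U"
  by (simp add: smooth_upto_def)

lemma smooth_upto_Suc:
  "smooth_upto (Suc n) U f \<longleftrightarrow> f differentiable_on U \<and> (\<forall>i. smooth_upto n U (partial i f))"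
proof
  assume L: "smooth_upto (Suc n) U f"
  have "foldr partial is (partial i f) differentiable_on U" if "length is \<le> n" for "is" i
    using L[unfolded smooth_upto_def, rule_format, of "is @ [i]"] that by simp
  moreover have "f differentiable_on U"
    using L[unfolded smooth_upto_def, rule_format, of "[]"] by simp
  ultimately show "f differentiable_on U \<and> (\<forall>i. smooth_upto n U (partial i f))"
    by (auto simp: smooth_upto_def)
next
  assume R: "f differentiable_on U \<and> (\<forall>i. smooth_upto n U (partial i f))"
  have "foldr partial is f differentiable_on U" if "length is \<le> Suc n" for "is"
    using that R by (cases "is" rule: rev_cases) (auto simp: smooth_upto_def)
  then show "smooth_upto (Suc n) U f" by (simp add: smooth_upto_def)
qed

lemma smooth_upto_mono: "smooth_upto n U f \<Longrightarrow> m \<le> n \<Longrightarrow> smooth_upto m U f"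
  by (auto simp: smooth_upto_def)

lemma smooth_upto_cong:
  assumes "open U" "smooth_upto n U f" "\<And>x. x \<in> U \<Longrightarrow> f x = g x"
  shows "smooth_upto n U g"
  unfolding smooth_upto_def
proof (intro allI impI)
  fix "is" :: "2 list" assume "length is \<le> n"
  then have "foldr partial is f differentiable_on U"
    using assms(2) by (auto simp: smooth_upto_def)
  then show "foldr partial is g differentiable_on U"
    by (rule differentiable_on_cong_open[OF assms(1), rotated])
      (rule foldr_partial_cong_open[OF assms(1) _ assms(3)])
qed

lemma smooth_on_cong:
  assumes "open U" "smooth_on U f" "\<And>x. x \<in> U \<Longrightarrow> f x = g x"
  shows "smooth_on U g"
  using assms smooth_upto_cong unfolding smooth_on_iff_upto by blast

lemma smooth_on_subset: "smooth_on U f \<Longrightarrow> V \<subseteq> U \<Longrightarrow> smooth_on V f"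
  by (auto simp: smooth_on_def intro: differentiable_on_subset)

lemma smooth_on_differentiable_at:
  "smooth_on U f \<Longrightarrow> open U \<Longrightarrow> x \<in> U \<Longrightarrow> f differentiable at x"
  unfolding smooth_on_def
  by (drule spec[of _ "[]"]) (simp add: differentiable_on_eq_differentiable_at)

lemma smooth_on_foldr: "smooth_on U f \<Longrightarrow> smooth_on U (foldr partial is f)"
  unfolding smooth_on_def
proof
  fix js assume "\<forall>is. foldr partial is f differentiable_on U"
  from this[rule_format, of "js @ is"] show "foldr partial js (foldr partial is f) differentiable_on U"
    by simp
qed

lemma smooth_on_partial: "smooth_on U f \<Longrightarrow> smooth_on U (partial i f)"
  using smooth_on_foldr[of U f "[i]"] by simp

lemma smooth_on_continuous: "smooth_on U f \<Longrightarrow> continuous_on U f"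
  unfolding smooth_on_def
  by (drule spec[of _ "[]"]) (simp add: differentiable_imp_continuous_on)

lemma smooth_on_local:
  assumes "\<And>x. x \<in> U \<Longrightarrow> \<exists>V g. open V \<and> x \<in> V \<and> smooth_on V g \<and> (\<forall>y\<in>V. f y = g y)"
  shows "smooth_on U f"
  unfolding smooth_on_def differentiable_on_def
proof (intro allI ballI)
  fix "is" x assume "x \<in> U"
  then obtain V g where V: "open V" "x \<in> V" "smooth_on V g" "\<forall>y\<in>V. f y = g y"
    using assms by blast
  then have "smooth_on V f"
    using smooth_on_cong[of V g f] by auto
  then show "foldr partial is f differentiable at x within U"
    using smooth_on_differentiable_at[OF smooth_on_foldr V(1,2)] differentiable_at_withinI by blast
qed

lemma differentiable_on_atD: "f differentiable_on U \<Longrightarrow> open U \<Longrightarrow> x \<in> U \<Longrightarrow> f differentiable at x"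
  using differentiable_on_eq_differentiable_at by blast

lemma partial_linear:
  assumes "bounded_linear L" "f differentiable at x"
  shows "partial i (\<lambda>x. L (f x)) x = L (partial i f x)"
proof -
  have "(f has_derivative frechet_derivative f (at x)) (at x)"
    using assms frechet_derivative_works by blast
  from bounded_linear.has_derivative[OF assms(1) this]
  show ?thesis by (subst partial_eq, assumption) (simp add: partial_def)
qed

lemma partial_bilinear:
  assumes "bounded_bilinear bop" "f differentiable at x" "g differentiable at x"
  shows "partial i (\<lambda>x. bop (f x) (g x)) x = bop (f x) (partial i g x) + bop (partial i f x) (g x)"
proof -
  have "(f has_derivative frechet_derivative f (at x)) (at x)"
    "(g has_derivative frechet_derivative g (at x)) (at x)"
    using assms frechet_derivative_works by blast+
  from bounded_bilinear.FDERIV[OF assms(1) this]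
  show ?thesis by (subst partial_eq, assumption) (simp add: partial_def)
qed

lemma partial_add:
  assumes "f differentiable at x" "g differentiable at x"
  shows "partial i (\<lambda>x. f x + g x) x = partial i f x + partial i g x"
proof -
  have "(f has_derivative frechet_derivative f (at x)) (at x)"
    "(g has_derivative frechet_derivative g (at x)) (at x)"
    using assms frechet_derivative_works by blast+
  from has_derivative_add[OF this]
  show ?thesis by (subst partial_eq, assumption) (simp add: partial_def)
qed

lemma partial_const: "partial i (\<lambda>x. c) = (\<lambda>x. 0)"
  by (intro ext partial_eq[OF has_derivative_const, THEN trans]) simp

lemma differentiable_on_bilinear:
  assumes "bounded_bilinear bop" "f differentiable_on U" "g differentiable_on U"
  shows "(\<lambda>x. bop (f x) (g x)) differentiable_on U"
  using assms bounded_bilinear.FDERIV[OF assms(1)]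
  unfolding differentiable_on_def differentiable_def by blast

lemma differentiable_on_linear:
  assumes "bounded_linear L" "f differentiable_on U"
  shows "(\<lambda>x. L (f x)) differentiable_on U"
  using assms bounded_linear.has_derivative[OF assms(1)]
  unfolding differentiable_on_def differentiable_def by blast

lemma smooth_upto_linear:
  assumes "open U" "bounded_linear L" "smooth_upto n U f"
  shows "smooth_upto n U (\<lambda>x. L (f x))"
  using assms(3)
proof (induction n arbitrary: f)
  case 0
  then show ?case using differentiable_on_linear[OF assms(2)] by (auto simp: smooth_upto_0)
next
  case (Suc n)
  then have f: "f differentiable_on U" "\<And>i. smooth_upto n U (partial i f)"
    by (auto simp: smooth_upto_Suc)
  have "smooth_upto n U (partial i (\<lambda>x. L (f x)))" for i
    by (rule smooth_upto_cong[OF assms(1) Suc.IH[OF f(2)[of i]]])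
      (use partial_linear[OF assms(2)] differentiable_on_atD[OF f(1) assms(1)] in simp)
  then show ?case
    using differentiable_on_linear[OF assms(2) f(1)] by (auto simp: smooth_upto_Suc)
qed

lemma smooth_upto_add:
  assumes "open U" "smooth_upto n U f" "smooth_upto n U g"
  shows "smooth_upto n U (\<lambda>x. f x + g x)"
  using assms(2,3)
proof (induction n arbitrary: f g)
  case 0
  then show ?case by (auto simp: smooth_upto_0)
next
  case (Suc n)
  then have f: "f differentiable_on U" "\<And>i. smooth_upto n U (partial i f)"
    and g: "g differentiable_on U" "\<And>i. smooth_upto n U (partial i g)"
    by (auto simp: smooth_upto_Suc)
  have "smooth_upto n U (partial i (\<lambda>x. f x + g x))" for i
    by (rule smooth_upto_cong[OF assms(1) Suc.IH[OF f(2)[of i] g(2)[of i]]])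
      (rule partial_add[symmetric] differentiable_on_atD[OF f(1) assms(1)]
         differentiable_on_atD[OF g(1) assms(1)] | assumption)+
  then show ?case
    using f g by (auto simp: smooth_upto_Suc)
qed

lemma smooth_upto_bilinear:
  assumes "open U" "bounded_bilinear bop" "smooth_upto n U f" "smooth_upto n U g"
  shows "smooth_upto n U (\<lambda>x. bop (f x) (g x))"
  using assms(3,4)
proof (induction n arbitrary: f g)
  case 0
  then show ?case using differentiable_on_bilinear[OF assms(2)] by (auto simp: smooth_upto_0)
next
  case (Suc n)
  then have f: "f differentiable_on U" "\<And>i. smooth_upto n U (partial i f)"
    and g: "g differentiable_on U" "\<And>i. smooth_upto n U (partial i g)"
    by (auto simp: smooth_upto_Suc)
  have fg: "smooth_upto n U f" "smooth_upto n U g"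
    using Suc.prems smooth_upto_mono by (meson le_SucI order_refl)+
  have "smooth_upto n U (partial i (\<lambda>x. bop (f x) (g x)))" for i
    by (rule smooth_upto_cong[OF assms(1) smooth_upto_add[OF assms(1)
          Suc.IH[OF fg(1) g(2)[of i]] Suc.IH[OF f(2)[of i] fg(2)]]])
      (rule partial_bilinear[OF assms(2), symmetric] differentiable_on_atD[OF f(1) assms(1)]
         differentiable_on_atD[OF g(1) assms(1)] | assumption)+
  then show ?case
    using differentiable_on_bilinear[OF assms(2) f(1) g(1)] by (auto simp: smooth_upto_Suc)
qed

lemma smooth_on_linear:
  "open U \<Longrightarrow> bounded_linear L \<Longrightarrow> smooth_on U f \<Longrightarrow> smooth_on U (\<lambda>x. L (f x))"
  using smooth_upto_linear unfolding smooth_on_iff_upto by blast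

lemma smooth_on_add:
  "open U \<Longrightarrow> smooth_on U f \<Longrightarrow> smooth_on U g \<Longrightarrow> smooth_on U (\<lambda>x. f x + g x)"
  using smooth_upto_add unfolding smooth_on_iff_upto by blast

lemma smooth_on_bilinear:
  "open U \<Longrightarrow> bounded_bilinear bop \<Longrightarrow> smooth_on U f \<Longrightarrow> smooth_on U g \<Longrightarrow>
    smooth_on U (\<lambda>x. bop (f x) (g x))"
  using smooth_upto_bilinear unfolding smooth_on_iff_upto by blast

lemmas smooth_on_scaleR = smooth_on_bilinear[OF _ bounded_bilinear_scaleR]
lemmas smooth_on_mult = smooth_on_bilinear[OF _ bounded_bilinear_mult]
lemmas smooth_on_inner = smooth_on_bilinear[OF _ bounded_bilinear_inner]

lemma smooth_on_const: "smooth_on U (\<lambda>x. c)"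
proof -
  have const: "\<exists>d. foldr partial is (\<lambda>x. c) = (\<lambda>x. d)" for "is"
    by (induction "is") (auto simp: partial_const)
  show ?thesis
    unfolding smooth_on_def
  proof
    fix "is" :: "2 list"
    obtain d where "foldr partial is (\<lambda>x. c) = (\<lambda>x. d)"
      using const by blast
    then show "foldr partial is (\<lambda>x. c) differentiable_on U" by simp
  qed
qed

lemma smooth_on_bounded_linear:
  assumes "bounded_linear L"
  shows "smooth_on U L"
proof -
  have "partial i L = (\<lambda>x. L (axis i 1))" for i :: 2
    using partial_eq[OF bounded_linear_imp_has_derivative[OF assms]] by blast
  then have "smooth_upto n UNIV L" for n
    using smooth_on_const[of UNIV "L (axis _ 1)"]
      bounded_linear_imp_differentiable_on[OF assms]
    by (cases n) (auto simp: smooth_upto_0 smooth_upto_Suc smooth_on_iff_upto)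
  then show ?thesis using smooth_on_subset[of UNIV L U] by (auto simp: smooth_on_iff_upto)
qed

lemma smooth_on_diff:
  assumes "open U" "smooth_on U f" "smooth_on U g"
  shows "smooth_on U (\<lambda>x. f x - g x)"
  using smooth_on_add[OF assms(1,2) smooth_on_linear[OF assms(1) bounded_linear_minus[OF bounded_linear_ident] assms(3)]]
  by simp

lemma partial_compose_real:
  assumes "(h has_real_derivative d) (at (q x))" "q differentiable at x"
  shows "partial i (\<lambda>x. h (q x)) x = d * partial i q x"
proof -
  have q: "(q has_derivative frechet_derivative q (at x)) (at x)"
    using assms frechet_derivative_works by blast
  have h: "(h has_derivative (*) d) (at (q x))"
    using assms(1) has_field_derivative_def by blast
  show ?thesis
    by (subst partial_eq[OF has_derivative_compose[OF q h]]) (simp add: partial_def)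
qed

text \<open>The outer function is given together with all its derivatives \<open>h 1\<close>, \<open>h 2\<close>, \<dots>, because the
  chain rule replaces \<open>h n\<close> by \<open>h (Suc n)\<close>; the induction runs over all \<open>n\<close> at once.\<close>

lemma smooth_on_compose_real:
  assumes "open U" "\<And>n t. (h n has_real_derivative h (Suc n) t) (at t)" "smooth_on U q"
  shows "smooth_on U (\<lambda>x. h 0 (q x))"
proof -
  have q: "q differentiable at x" if "x \<in> U" for x
    using smooth_on_differentiable_at assms that by blast
  have d: "(\<lambda>x. h n (q x)) differentiable_on U" for n
    unfolding differentiable_on_def
  proof
    fix x assume "x \<in> U"
    have "h n differentiable at (q x)"
      using assms(2) real_differentiable_def by blast
    then show "(\<lambda>x. h n (q x)) differentiable at x within U"
      using differentiable_compose[OF _ q[OF \<open>x \<in> U\<close>], of "h n"] differentiable_at_withinI by blast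
  qed
  have "smooth_upto k U (\<lambda>x. h n (q x))" for k n
  proof (induction k arbitrary: n)
    case 0
    then show ?case using d by (simp add: smooth_upto_0)
  next
    case (Suc k)
    have pq: "smooth_upto k U (partial i q)" for i
      using smooth_on_partial[OF assms(3)] by (auto simp: smooth_on_iff_upto)
    have "smooth_upto k U (partial i (\<lambda>x. h n (q x)))" for i
      by (rule smooth_upto_cong[OF assms(1)
            smooth_upto_bilinear[OF assms(1) bounded_bilinear_mult Suc.IH[of "Suc n"] pq[of i]]])
        (use partial_compose_real[OF assms(2) q] in simp)
    then show ?case using d by (auto simp: smooth_upto_Suc)
  qed
  then show ?thesis by (simp add: smooth_on_iff_upto)
qed

lemma foldr_partial_linear:
  assumes "open U" "bounded_linear L" "smooth_on U f" "x \<in> U"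
  shows "foldr partial is (\<lambda>x. L (f x)) x = L (foldr partial is f x)"
  using assms(4)
proof (induction "is" arbitrary: x)
  case (Cons i "is")
  have "partial i (foldr partial is (\<lambda>x. L (f x))) x = partial i (\<lambda>x. L (foldr partial is f x)) x"
    by (rule partial_cong_open[OF assms(1) Cons.prems Cons.IH])
  also have "\<dots> = L (partial i (foldr partial is f) x)"
    using partial_linear[OF assms(2)] smooth_on_differentiable_at[OF smooth_on_foldr[OF assms(3)] assms(1) Cons.prems]
    by blast
  finally show ?case by simp
qed simp

lemma foldr_partial_add:
  assumes "open U" "smooth_on U f" "smooth_on U g" "x \<in> U"
  shows "foldr partial is (\<lambda>x. f x + g x) x = foldr partial is f x + foldr partial is g x"
  using assms(4)
proof (induction "is" arbitrary: x)
  case (Cons i "is")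
  have "partial i (foldr partial is (\<lambda>x. f x + g x)) x = partial i (\<lambda>x. foldr partial is f x + foldr partial is g x) x"
    by (rule partial_cong_open[OF assms(1) Cons.prems Cons.IH])
  also have "\<dots> = partial i (foldr partial is f) x + partial i (foldr partial is g) x"
    using partial_add smooth_on_differentiable_at[OF smooth_on_foldr[OF assms(2)] assms(1) Cons.prems]
      smooth_on_differentiable_at[OF smooth_on_foldr[OF assms(3)] assms(1) Cons.prems]
    by blast
  finally show ?case by simp
qed simp

lemma foldr_partial_dilate:
  fixes f :: "plane \<Rightarrow> 'v::real_normed_vector"
  assumes "smooth_on UNIV f"
  shows "foldr partial is (\<lambda>x. f (c *\<^sub>R x)) = (\<lambda>x. c ^ length is *\<^sub>R foldr partial is f (c *\<^sub>R x))"
proof (induction "is")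
  case (Cons i "is")
  show ?case
  proof
    fix x
    let ?g = "foldr partial is f"
    have "?g differentiable at (c *\<^sub>R x)"
      using smooth_on_differentiable_at[OF smooth_on_foldr[OF assms]] by auto
    then have g: "(?g has_derivative frechet_derivative ?g (at (c *\<^sub>R x))) (at (c *\<^sub>R x))"
      using frechet_derivative_works by blast
    have lin: "linear (frechet_derivative ?g (at (c *\<^sub>R x)))"
      using g has_derivative_linear by blast
    have c: "((\<lambda>x. c *\<^sub>R x) has_derivative (\<lambda>x. c *\<^sub>R x)) (at x)"
      by (auto intro!: derivative_eq_intros)
    have "((\<lambda>x. c ^ length is *\<^sub>R ?g (c *\<^sub>R x)) has_derivative
        (\<lambda>h. c ^ length is *\<^sub>R frechet_derivative ?g (at (c *\<^sub>R x)) (c *\<^sub>R h))) (at x)"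
      by (intro has_derivative_scaleR_right has_derivative_compose[OF c g])
    then have "partial i (\<lambda>x. c ^ length is *\<^sub>R ?g (c *\<^sub>R x)) x =
        c ^ length (i # is) *\<^sub>R partial i ?g (c *\<^sub>R x)"
      by (subst partial_eq, assumption) (simp add: partial_def linear_scale[OF lin])
    then show "foldr partial (i # is) (\<lambda>x. f (c *\<^sub>R x)) x =
        c ^ length (i # is) *\<^sub>R foldr partial (i # is) f (c *\<^sub>R x)"
      by (simp add: Cons)
  qed
qed simp

lemma smooth_on_dilate:
  fixes f :: "plane \<Rightarrow> 'v::real_normed_vector"
  assumes "smooth_on UNIV f"
  shows "smooth_on UNIV (\<lambda>x. f (c *\<^sub>R x))"
  unfolding smooth_on_def
proof
  fix "is"
  have 1: "foldr partial is f differentiable at y" for y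
    using smooth_on_differentiable_at[OF smooth_on_foldr[OF assms]] by auto
  have "(\<lambda>x. foldr partial is f (c *\<^sub>R x)) differentiable at x" for x
    by (rule differentiable_compose[OF 1]) auto
  then show "foldr partial is (\<lambda>x. f (c *\<^sub>R x)) differentiable_on UNIV"
    by (auto simp: foldr_partial_dilate[OF assms] differentiable_on_def)
qed

section \<open>Smooth cutoff functions\<close>

lemma poly_times_exp_neg_tendsto_0:
  "((\<lambda>y::real. poly p y * exp (- y)) \<longlongrightarrow> 0) at_top"
proof -
  have "((\<lambda>y::real. coeff p i * (y ^ i / exp y)) \<longlongrightarrow> coeff p i * 0) at_top" for i
    by (intro tendsto_mult tendsto_const tendsto_power_div_exp_0)
  then have "((\<lambda>y::real. \<Sum>i\<le>degree p. coeff p i * (y ^ i / exp y)) \<longlongrightarrow> (\<Sum>i\<le>degree p. coeff p i * 0)) at_top"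
    by (intro tendsto_sum)
  then show ?thesis
    by (simp add: poly_altdef sum_distrib_right exp_minus divide_inverse mult.assoc)
qed

text \<open>The functions \<open>p (1 / t) exp (- 1 / t)\<close> on the positive half-line, continued by \<open>0\<close>. With all
  polynomials \<open>p\<close> admitted this family is closed under differentiation, which is what makes
  \<open>exp (- 1 / t)\<close> smooth at \<open>0\<close>.\<close>

definition flat_poly :: "real poly \<Rightarrow> real \<Rightarrow> real" where
  "flat_poly p t = (if t \<le> 0 then 0 else poly p (1 / t) * exp (- (1 / t)))"

text \<open>At \<open>0\<close> the difference quotient from the right is \<open>y p(y) exp (- y)\<close> with \<open>y = 1 / t\<close>, and the
  exponential wins.\<close>

lemma flat_poly_deriv:
  "(flat_poly p has_real_derivative flat_poly (monom 1 2 * (p - pderiv p)) t) (at t)"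
proof -
  consider "t < 0" | "t = 0" | "t > 0" by linarith
  then show ?thesis
  proof cases
    case 1
    have "((\<lambda>t. 0) has_real_derivative 0) (at t)" by simp
    then have "(flat_poly p has_real_derivative 0) (at t)"
      by (rule has_field_derivative_transform_within_open[where S = "{..<0}"])
        (use 1 in \<open>auto simp: flat_poly_def\<close>)
    then show ?thesis using 1 by (simp add: flat_poly_def)
  next
    case 3
    have "((\<lambda>t. poly p (1 / t) * exp (- (1 / t))) has_real_derivative
        poly (pderiv p) (1 / t) * (- 1 / t\<^sup>2) * exp (- (1 / t)) + poly p (1/t) * (exp (- (1 / t)) * (1 / t\<^sup>2))) (at t)"
      using 3 by (auto intro!: derivative_eq_intros simp: power2_eq_square field_simps)
    then have "((\<lambda>t. poly p (1 / t) * exp (- (1 / t))) has_real_derivative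
        flat_poly (monom 1 2 * (p - pderiv p)) t) (at t)"
      using 3 by (simp add: flat_poly_def poly_monom field_simps)
    then show ?thesis
      by (rule has_field_derivative_transform_within_open[where S = "{0<..}"])
        (use 3 in \<open>auto simp: flat_poly_def\<close>)
  next
    case 2
    have "((\<lambda>y. flat_poly p y / y) \<longlongrightarrow> 0) (at_left 0)"
      by (rule tendsto_eventually)
        (auto simp: flat_poly_def eventually_at_filter)
    moreover have "((\<lambda>y. flat_poly p y / y) \<longlongrightarrow> 0) (at_right 0)"
    proof -
      have "((\<lambda>y::real. poly (monom 1 1 * p) (inverse y) * exp (- inverse y)) \<longlongrightarrow> 0) (at_right 0)"
        by (rule filterlim_compose[OF poly_times_exp_neg_tendsto_0 filterlim_inverse_at_top_right])
      then show ?thesis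
        by (rule Lim_transform_eventually)
          (auto simp: flat_poly_def eventually_at_filter poly_monom field_simps)
    qed
    ultimately have "((\<lambda>y. flat_poly p y / y) \<longlongrightarrow> 0) (at 0)"
      by (simp add: filterlim_split_at)
    then show ?thesis using 2
      by (simp add: has_field_derivative_iff flat_poly_def)
  qed
qed

definition flat :: "real \<Rightarrow> real" where
  "flat = flat_poly 1"

lemma smooth_on_flat:
  assumes "open U" "smooth_on U q"
  shows "smooth_on U (\<lambda>x. flat (q x))"
proof -
  define h where "h n = flat_poly (((\<lambda>p. monom 1 2 * (p - pderiv p)) ^^ n) 1)" for n
  have "(h n has_real_derivative h (Suc n) t) (at t)" for n t
    using flat_poly_deriv by (simp add: h_def)
  from smooth_on_compose_real[of U h, OF assms(1) this assms(2)]
  show ?thesis by (simp add: h_def flat_def)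
qed

lemma flat_nonneg: "flat t \<ge> 0" and flat_pos: "t > 0 \<Longrightarrow> flat t > 0"
  and flat_zero: "t \<le> 0 \<Longrightarrow> flat t = 0"
  by (auto simp: flat_def flat_poly_def)

lemma flat_ge: "t \<ge> 1 \<Longrightarrow> flat 1 \<le> flat t"
  by (auto simp: flat_def flat_poly_def)

text \<open>A smooth step from \<open>1\<close> on the left of \<open>a\<close> to \<open>0\<close> on the right of \<open>b\<close>. For \<open>a = 0\<close>, \<open>b = 1\<close> it is \<open>flat\<close> of
  \<open>flat 1 - flat u\<close>, normalised: \<open>flat u\<close> is \<open>0\<close> for \<open>u \<le> 0\<close>, and for \<open>u \<ge> 1\<close> the inner argument is not
  positive. In this form only compositions of smooth functions occur.\<close>

definition step :: "real \<Rightarrow> real \<Rightarrow> real \<Rightarrow> real" where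
  "step a b u = flat (flat 1 - flat ((u - a) / (b - a))) / flat (flat 1)"

lemma step_left: "a < b \<Longrightarrow> u \<le> a \<Longrightarrow> step a b u = 1"
  using flat_pos[of "flat 1"] flat_pos[of 1] by (simp add: step_def flat_zero divide_nonpos_pos)

lemma step_right: "a < b \<Longrightarrow> b \<le> u \<Longrightarrow> step a b u = 0"
  using flat_ge[of "(u - a) / (b - a)"] by (simp add: step_def flat_zero)

lemma step_nonneg: "0 \<le> step a b u"
  by (simp add: step_def flat_nonneg)

lemma smooth_on_step:
  assumes "open U" "smooth_on U q"
  shows "smooth_on U (\<lambda>x. step a b (q x))"
proof -
  have 1: "smooth_on U (\<lambda>x. (q x - a) / (b - a))"
    using smooth_on_linear[OF assms(1) bounded_linear_divide[of "b - a"] smooth_on_diff[OF assms smooth_on_const[of U a]]] .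
  show ?thesis
    unfolding step_def
    by (intro smooth_on_linear[OF assms(1) bounded_linear_divide] smooth_on_flat smooth_on_diff assms(1)
        smooth_on_const 1)
qed

lemma smooth_on_sq_dist: "smooth_on U (\<lambda>x. (x - a) \<bullet> (x - a))"
  by (rule smooth_on_subset[of UNIV])
    (intro smooth_on_inner smooth_on_diff smooth_on_const smooth_on_bounded_linear bounded_linear_ident open_UNIV subset_UNIV)+

definition cutoff :: "plane \<Rightarrow> real \<Rightarrow> real \<Rightarrow> plane \<Rightarrow> real" where
  "cutoff a r R x = step (r\<^sup>2) (R\<^sup>2) ((x - a) \<bullet> (x - a))"

lemma smooth_on_cutoff: "smooth_on U (cutoff a r R)"
  unfolding cutoff_def[abs_def]
  by (rule smooth_on_subset[of UNIV]) (intro smooth_on_step smooth_on_sq_dist open_UNIV subset_UNIV)+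

lemma cutoff_inside:
  assumes "0 \<le> r" "r < R" "dist a x \<le> r"
  shows "cutoff a r R x = 1"
proof -
  have "(x - a) \<bullet> (x - a) \<le> r\<^sup>2"
    using assms power_mono[of "norm (x - a)" r 2]
    by (simp add: dist_norm norm_minus_commute flip: power2_norm_eq_inner)
  then show ?thesis
    using assms by (simp add: cutoff_def step_left power_strict_mono)
qed

lemma cutoff_outside:
  assumes "0 \<le> r" "r < R" "dist a x \<ge> R"
  shows "cutoff a r R x = 0"
proof -
  have "(x - a) \<bullet> (x - a) \<ge> R\<^sup>2"
    using assms power_mono[of R "norm (x - a)" 2]
    by (simp add: dist_norm norm_minus_commute flip: power2_norm_eq_inner)
  then show ?thesis
    using assms by (simp add: cutoff_def step_right power_strict_mono)
qed

lemma cutoff_nonneg: "cutoff a r R x \<ge> 0"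
  by (simp add: cutoff_def step_nonneg)

section \<open>Test functions\<close>

definition supp :: "(plane \<Rightarrow> 'v::zero) \<Rightarrow> plane set" where
  "supp \<phi> = closure {x. \<phi> x \<noteq> 0}"

lemma closed_supp [simp]: "closed (supp \<phi>)"
  by (simp add: supp_def)

lemma test_funs_iff:
  "\<phi> \<in> test_funs U \<longleftrightarrow> smooth_on UNIV \<phi> \<and> compact (supp \<phi>) \<and> supp \<phi> \<subseteq> U"
  by (simp add: test_funs_def supp_def)

lemma not_in_supp: "x \<notin> supp \<phi> \<Longrightarrow> \<phi> x = 0"
  using closure_subset[of "{x. \<phi> x \<noteq> 0}"] by (auto simp: supp_def)

lemma supp_subsetI: "closed K \<Longrightarrow> (\<And>x. x \<notin> K \<Longrightarrow> \<phi> x = 0) \<Longrightarrow> supp \<phi> \<subseteq> K"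
  unfolding supp_def by (rule closure_minimal) auto

lemma test_funsI:
  assumes "smooth_on UNIV \<phi>" "compact K" "K \<subseteq> U" "\<And>x. x \<notin> K \<Longrightarrow> \<phi> x = 0"
  shows "\<phi> \<in> test_funs U"
proof -
  have "supp \<phi> \<subseteq> K"
    using supp_subsetI compact_imp_closed assms by blast
  then show ?thesis
    using assms compact_Int_closed[OF assms(2) closed_supp, of \<phi>]
    by (auto simp: test_funs_iff Int_absorb1)
qed

lemma test_funsD:
  assumes "\<phi> \<in> test_funs U"
  shows "smooth_on UNIV \<phi>" "compact (supp \<phi>)" "supp \<phi> \<subseteq> U"
  using assms by (simp_all add: test_funs_iff)

lemma test_funs_zero_outside: "\<phi> \<in> test_funs U \<Longrightarrow> x \<notin> U \<Longrightarrow> \<phi> x = 0"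
  using test_funsD(3)[of \<phi> U] not_in_supp[of x \<phi>] by blast

lemma test_funs_mono: "\<phi> \<in> test_funs U \<Longrightarrow> U \<subseteq> V \<Longrightarrow> \<phi> \<in> test_funs V"
  unfolding test_funs_iff by blast

lemma test_funs_supp_subset:
  assumes "\<phi> \<in> test_funs U" "supp \<phi> \<subseteq> V"
  shows "\<phi> \<in> test_funs V"
  using assms by (simp add: test_funs_iff)

lemma partial_zero_off_supp:
  assumes "x \<notin> supp \<phi>"
  shows "partial i \<phi> x = 0"
proof -
  have "partial i \<phi> x = partial i (\<lambda>x. 0) x"
    by (rule partial_cong_open[of "- supp \<phi>"]) (use assms in \<open>simp_all add: not_in_supp[of _ \<phi>] open_Compl\<close>)
  then show ?thesis by (simp add: partial_const)
qed

lemma test_funs_partial: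
  assumes "\<phi> \<in> test_funs U"
  shows "partial i \<phi> \<in> test_funs U"
  by (rule test_funsI[OF smooth_on_partial[OF test_funsD(1)[OF assms]] test_funsD(2,3)[OF assms]
        partial_zero_off_supp])

lemma test_funs_foldr: "\<phi> \<in> test_funs U \<Longrightarrow> foldr partial is \<phi> \<in> test_funs U"
  by (induction "is") (auto simp: test_funs_partial)

lemma test_funs_linear:
  assumes "bounded_linear L" "\<phi> \<in> test_funs U"
  shows "(\<lambda>x. L (\<phi> x)) \<in> test_funs U"
  by (rule test_funsI[OF smooth_on_linear[OF open_UNIV assms(1) test_funsD(1)[OF assms(2)]]
        test_funsD(2,3)[OF assms(2)]])
    (simp add: not_in_supp[of _ \<phi>] linear_simps(3)[OF assms(1)])

lemma test_funs_add:
  assumes "\<phi> \<in> test_funs U" "\<psi> \<in> test_funs U"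
  shows "(\<lambda>x. \<phi> x + \<psi> x) \<in> test_funs U"
  by (rule test_funsI[OF smooth_on_add[OF open_UNIV test_funsD(1)[OF assms(1)] test_funsD(1)[OF assms(2)]]
        compact_Un[OF test_funsD(2)[OF assms(1)] test_funsD(2)[OF assms(2)]]])
    (use test_funsD(3)[OF assms(1)] test_funsD(3)[OF assms(2)] in \<open>auto simp: not_in_supp[of _ \<phi>] not_in_supp[of _ \<psi>]\<close>)

lemma test_funs_scale:
  "\<phi> \<in> test_funs U \<Longrightarrow> (\<lambda>x. c *\<^sub>R \<phi> x) \<in> test_funs U"
  by (rule test_funs_linear[OF bounded_linear_scaleR_right])

lemma test_funs_diff:
  assumes "\<phi> \<in> test_funs U" "\<psi> \<in> test_funs U"
  shows "(\<lambda>x. \<phi> x - \<psi> x) \<in> test_funs U"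
  using test_funs_add[OF assms(1) test_funs_scale[OF assms(2), of "-1"]] by simp

text \<open>The factor \<open>f\<close> may be arbitrary outside \<open>U\<close>, since the product vanishes on a neighbourhood of
  every point there.\<close>

lemma test_funs_bilinear:
  assumes "open U" "bounded_bilinear bop" "smooth_on U f" "\<phi> \<in> test_funs U"
  shows "(\<lambda>x. bop (f x) (\<phi> x)) \<in> test_funs U"
proof (rule test_funsI[of _ "supp \<phi>"])
  interpret bounded_bilinear bop by fact
  note \<phi> = test_funsD[OF assms(4)]
  show "smooth_on UNIV (\<lambda>x. bop (f x) (\<phi> x))"
  proof (rule smooth_on_local)
    fix x :: plane
    show "\<exists>V g. open V \<and> x \<in> V \<and> smooth_on V g \<and> (\<forall>y\<in>V. bop (f y) (\<phi> y) = g y)"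
    proof (cases "x \<in> U")
      case True
      have "smooth_on U (\<lambda>x. bop (f x) (\<phi> x))"
        by (rule smooth_on_bilinear[OF assms(1,2,3) smooth_on_subset[OF \<phi>(1)]]) auto
      then show ?thesis using True assms(1) by blast
    next
      case False
      then have "x \<in> - supp \<phi>" "open (- supp \<phi>)" using \<phi>(3) by auto
      moreover have "\<forall>y\<in>- supp \<phi>. bop (f y) (\<phi> y) = 0"
        using not_in_supp[of _ \<phi>] zero_right by auto
      ultimately show ?thesis using smooth_on_const by blast
    qed
  qed
  show "bop (f x) (\<phi> x) = 0" if "x \<notin> supp \<phi>" for x
    using not_in_supp[OF that] zero_right by simp
qed (use test_funsD[OF assms(4)] in auto)

lemmas test_funs_scaleR = test_funs_bilinear[OF _ bounded_bilinear_scaleR]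
lemmas test_funs_inner = test_funs_bilinear[OF _ bounded_bilinear_inner]

lemma cutoff_test_fun:
  assumes "0 \<le> r" "r < R" "cball a R \<subseteq> U"
  shows "(\<lambda>x. cutoff a r R x *\<^sub>R v) \<in> test_funs U"
  by (rule test_funsI[of _ "cball a R"])
    (use assms cutoff_outside[OF assms(1,2)] smooth_on_linear[OF open_UNIV bounded_linear_scaleR_left smooth_on_cutoff] in auto)

lemma test_funs_continuous: "\<phi> \<in> test_funs U \<Longrightarrow> continuous_on S \<phi>"
  using smooth_on_continuous[OF test_funsD(1)] continuous_on_subset by blast

lemma test_funs_bounded:
  assumes "\<phi> \<in> test_funs U"
  obtains C where "\<And>x. norm (\<phi> x) \<le> C"
proof -
  have "compact (\<phi> ` supp \<phi>)"
    using compact_continuous_image[OF test_funs_continuous[OF assms]] test_funsD[OF assms] by blast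
  then obtain C where C: "\<And>x. x \<in> supp \<phi> \<Longrightarrow> norm (\<phi> x) \<le> C"
    using compact_imp_bounded bounded_iff by (metis imageI)
  have "norm (\<phi> x) \<le> max C 0" for x
    by (cases "x \<in> supp \<phi>") (use C not_in_supp[of x \<phi>] in force)+
  then show ?thesis using that by blast
qed

lemma test_fun_has_integral_box:
  fixes \<phi> :: "plane \<Rightarrow> 'v::euclidean_space"
  assumes "\<phi> \<in> test_funs U"
  obtains a where "supp \<phi> \<subseteq> cbox (-a) a" "\<phi> integrable_on cbox (-a) a"
    "(\<phi> has_integral integral (cbox (-a) a) \<phi>) UNIV"
proof -
  obtain a where a: "supp \<phi> \<subseteq> cbox (-a) a"
    using bounded_subset_cbox_symmetric[OF compact_imp_bounded[OF test_funsD(2)[OF assms]]] by blast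
  have i: "\<phi> integrable_on cbox (-a) a"
    by (rule integrable_continuous[OF test_funs_continuous[OF assms]])
  have "(\<phi> has_integral integral (cbox (-a) a) \<phi>) UNIV"
    by (rule has_integral_on_superset[OF integrable_integral[OF i]])
      (use a not_in_supp[of _ \<phi>] in auto)
  with a i that show ?thesis by blast
qed

lemma test_funs_integrable:
  fixes \<phi> :: "plane \<Rightarrow> 'v::euclidean_space"
  assumes "\<phi> \<in> test_funs U"
  shows "\<phi> integrable_on UNIV"
  using test_fun_has_integral_box[OF assms] by blast

lemma integral_zero_outside:
  fixes \<phi> :: "plane \<Rightarrow> 'v::euclidean_space"
  assumes "\<And>x. x \<notin> U \<Longrightarrow> \<phi> x = 0"
  shows "integral U \<phi> = integral UNIV \<phi>"
proof -
  have "\<phi> = (\<lambda>x. if x \<in> U then \<phi> x else 0)" using assms by auto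
  then show ?thesis by (metis integral_restrict_UNIV)
qed

section \<open>Distributions that are locally smooth functions\<close>

lemma given_by_eval:
  assumes "given_by U T f" "\<phi> \<in> test_funs U"
  shows "T \<phi> = integral UNIV (\<lambda>x. f x \<bullet> \<phi> x)"
proof -
  have "integral U (\<lambda>x. f x \<bullet> \<phi> x) = integral UNIV (\<lambda>x. f x \<bullet> \<phi> x)"
    by (rule integral_zero_outside) (use test_funs_zero_outside[OF assms(2)] in auto)
  then show ?thesis using assms by (auto simp: given_by_def)
qed

text \<open>If \<open>h x\<close> is not zero, then \<open>h y \<bullet> h x\<close> is positive for \<open>y\<close> near \<open>x\<close>, and testing with a cutoff times
  the constant vector \<open>h x\<close> gives a continuous non-negative integrand that is positive at \<open>x\<close>.\<close>

lemma fundamental_lemma: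
  fixes h :: "plane \<Rightarrow> 'v::euclidean_space"
  assumes W: "open W" "smooth_on W h" "x \<in> W"
    and 0: "\<And>\<phi>. \<phi> \<in> test_funs W \<Longrightarrow> integral UNIV (\<lambda>x. h x \<bullet> \<phi> x) = 0"
  shows "h x = 0"
proof (rule ccontr)
  assume nz: "h x \<noteq> 0"
  have "continuous_on W (\<lambda>y. h y \<bullet> h x)"
    by (intro continuous_intros smooth_on_continuous W)
  then have "open (W \<inter> (\<lambda>y. h y \<bullet> h x) -` {0<..})"
    using W(1) by (intro continuous_open_preimage) auto
  moreover have "x \<in> W \<inter> (\<lambda>y. h y \<bullet> h x) -` {0<..}"
    using nz W by auto
  ultimately obtain R where R: "R > 0" "cball x R \<subseteq> W \<inter> (\<lambda>y. h y \<bullet> h x) -` {0<..}"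
    using open_contains_cball by blast
  define p where "p y = h y \<bullet> (cutoff x (R/2) R y *\<^sub>R h x)" for y
  have t: "(\<lambda>y. cutoff x (R/2) R y *\<^sub>R h x) \<in> test_funs W"
    using R by (intro cutoff_test_fun) auto
  have p: "p \<in> test_funs W"
    unfolding p_def[abs_def] by (rule test_funs_inner[OF W(1,2) t])
  have nonneg: "p y \<ge> 0" for y
  proof (cases "y \<in> cball x R")
    case True
    then show ?thesis using R cutoff_nonneg[of x "R/2" R y] by (auto simp: p_def intro!: mult_nonneg_nonneg less_imp_le[of 0 "h y \<bullet> h x"])
  next
    case False
    then show ?thesis using cutoff_outside[of "R/2" R x y] R by (auto simp: p_def)
  qed
  obtain a where a: "supp p \<subseteq> cbox (-a) a" "p integrable_on cbox (-a) a"
    "(p has_integral integral (cbox (-a) a) p) UNIV"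
    using test_fun_has_integral_box[OF p] .
  have "integral UNIV p = 0"
    using 0[OF t] by (simp add: p_def[abs_def])
  then have i0: "(p has_integral 0) (cbox (-a) a)"
    using a(2,3) integrable_integral integral_unique by metis
  have px: "p x > 0"
    using nz R cutoff_inside[of "R/2" R x x] by (simp add: p_def)
  have open_p: "open {y. p y \<noteq> 0}"
    using continuous_open_preimage[OF test_funs_continuous[OF p, of UNIV] open_UNIV, of "- {0}"]
    by (auto simp: vimage_def)
  then have "{y. p y \<noteq> 0} \<subseteq> interior (cbox (-a) a)"
    by (intro interior_maximal subset_trans[OF closure_subset a(1)[unfolded supp_def]])
  then have xb: "x \<in> box (-a) a" using px by (auto simp: interior_cbox)
  then have "box (-a) a \<noteq> {}" "x \<in> cbox (-a) a"
    using box_subset_cbox[of "-a" a] by blast+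
  then have "p x = 0"
    using has_integral_0_cbox_imp_0[OF test_funs_continuous[OF p] nonneg i0] by blast
  then show False using px by simp
qed

lemma given_by_unique:
  fixes T :: "'v::euclidean_space functional"
  assumes "open U" "open V" "given_by U T f" "given_by V T g" "x \<in> U" "x \<in> V"
  shows "f x = g x"
proof -
  let ?W = "U \<inter> V"
  have sf: "smooth_on ?W f" and sg: "smooth_on ?W g"
    using assms smooth_on_subset unfolding given_by_def by blast+
  have "integral UNIV (\<lambda>x. (f x - g x) \<bullet> \<phi> x) = 0" if \<phi>: "\<phi> \<in> test_funs ?W" for \<phi>
  proof -
    have "(\<lambda>x. f x \<bullet> \<phi> x) \<in> test_funs ?W" "(\<lambda>x. g x \<bullet> \<phi> x) \<in> test_funs ?W"
      using test_funs_inner sf sg \<phi> assms by blast+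
    then have "integral UNIV (\<lambda>x. f x \<bullet> \<phi> x - g x \<bullet> \<phi> x) =
        integral UNIV (\<lambda>x. f x \<bullet> \<phi> x) - integral UNIV (\<lambda>x. g x \<bullet> \<phi> x)"
      by (intro Henstock_Kurzweil_Integration.integral_diff test_funs_integrable)
    also have "\<dots> = T \<phi> - T \<phi>"
      by (simp add: given_by_eval[OF assms(3) test_funs_mono[OF \<phi> Int_lower1], symmetric]
          given_by_eval[OF assms(4) test_funs_mono[OF \<phi> Int_lower2], symmetric])
    finally show ?thesis by (simp add: inner_diff_left)
  qed
  then have "f x - g x = 0"
    using assms by (intro fundamental_lemma[of ?W "\<lambda>x. f x - g x"] smooth_on_diff sf sg) auto
  then show ?thesis by simp
qed

text \<open>The local representatives agree where they overlap, so they define one smooth function. That it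
  represents \<open>T\<close> on a test function \<open>\<phi>\<close> follows by covering the support of \<open>\<phi>\<close> with finitely many balls
  and splitting \<open>\<phi>\<close> accordingly.\<close>

lemma given_by_glue:
  fixes T :: "'v::euclidean_space functional"
  assumes U: "open U"
    and add: "\<And>\<phi> \<psi>. \<phi> \<in> test_funs U \<Longrightarrow> \<psi> \<in> test_funs U \<Longrightarrow> T (\<lambda>x. \<phi> x + \<psi> x) = T \<phi> + T \<psi>"
    and loc: "\<And>x. x \<in> U \<Longrightarrow> \<exists>V f. open V \<and> x \<in> V \<and> given_by V T f"
  shows "\<exists>f. given_by U T f"
proof -
  obtain V G where VG: "\<And>x. x \<in> U \<Longrightarrow> open (V x) \<and> x \<in> V x \<and> given_by (V x) T (G x)"
    using loc by metis
  define f where "f x = G x x" for x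
  have fG: "f y = G x y" if "x \<in> U" "y \<in> U" "y \<in> V x" for x y
    using given_by_unique[of "V x" "V y" T "G x" "G y" y] VG that by (simp add: f_def)
  have sm: "smooth_on U f"
  proof (rule smooth_on_local)
    fix x assume x: "x \<in> U"
    have "smooth_on (V x \<inter> U) (G x)"
      using VG[OF x] smooth_on_subset unfolding given_by_def by blast
    then show "\<exists>V g. open V \<and> x \<in> V \<and> smooth_on V g \<and> (\<forall>y\<in>V. f y = g y)"
      using VG[OF x] x U fG by (intro exI[of _ "V x \<inter> U"] exI[of _ "G x"]) auto
  qed
  have "\<exists>R>0. cball x R \<subseteq> V x \<inter> U" if "x \<in> U" for x
    using VG[OF that] U that open_contains_cball[of "V x \<inter> U"] by auto
  then obtain R where R: "\<And>x. x \<in> U \<Longrightarrow> R x > 0 \<and> cball x (R x) \<subseteq> V x \<inter> U" by metis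
  \<comment> \<open>A partition of unity is built one ball at a time: the cutoff \<open>c\<close> removes one ball
    from the cover.\<close>
  have main: "T \<phi> = integral UNIV (\<lambda>x. f x \<bullet> \<phi> x)"
    if "finite X" "X \<subseteq> U" "\<phi> \<in> test_funs U" "supp \<phi> \<subseteq> (\<Union>x\<in>X. ball x (R x / 2))" for X \<phi>
    using that
  proof (induction X arbitrary: \<phi> rule: finite_induct)
    case empty
    then have z: "\<phi> = (\<lambda>x. 0)" using not_in_supp[of _ \<phi>] by blast
    have "T (\<lambda>x. \<phi> x + \<phi> x) = T \<phi> + T \<phi>" using add empty by blast
    then show ?case by (simp add: z)
  next
    case (insert a X)
    have a: "R a > 0" "cball a (R a) \<subseteq> V a \<inter> U" "open (V a)" "given_by (V a) T (G a)" "a \<in> U"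
      using R VG insert.prems by auto
    define c where "c = cutoff a (R a / 2) (R a)"
    define \<phi>1 where "\<phi>1 x = c x *\<^sub>R \<phi> x" for x
    define \<phi>2 where "\<phi>2 x = (1 - c x) *\<^sub>R \<phi> x" for x
    have sc: "smooth_on U c" "smooth_on U (\<lambda>x. 1 - c x)"
      unfolding c_def by (intro smooth_on_diff smooth_on_cutoff smooth_on_const U)+
    have t: "\<phi>1 \<in> test_funs U" "\<phi>2 \<in> test_funs U"
      unfolding \<phi>1_def[abs_def] \<phi>2_def[abs_def]
      using test_funs_scaleR[OF U] sc insert.prems by blast+
    have split: "\<phi> = (\<lambda>x. \<phi>1 x + \<phi>2 x)"
      by (simp add: \<phi>1_def \<phi>2_def algebra_simps)
    have "supp \<phi>1 \<subseteq> cball a (R a)"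
      by (rule supp_subsetI) (use cutoff_outside[of "R a / 2" "R a" a] a in \<open>auto simp: \<phi>1_def c_def\<close>)
    then have t1: "\<phi>1 \<in> test_funs (V a \<inter> U)"
      using test_funs_supp_subset[OF t(1)] a(2) by blast
    have "T \<phi>1 = integral UNIV (\<lambda>x. G a x \<bullet> \<phi>1 x)"
      using given_by_eval[OF a(4)] test_funs_mono[OF t1] by blast
    also have "\<dots> = integral UNIV (\<lambda>x. f x \<bullet> \<phi>1 x)"
    proof (rule integral_cong)
      fix x show "G a x \<bullet> \<phi>1 x = f x \<bullet> \<phi>1 x"
        using fG[OF a(5), of x] test_funs_zero_outside[OF t1, of x] by (cases "x \<in> V a \<inter> U") auto
    qed
    finally have T1: "T \<phi>1 = integral UNIV (\<lambda>x. f x \<bullet> \<phi>1 x)" .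
    have "supp \<phi>2 \<subseteq> supp \<phi> - ball a (R a / 2)"
    proof (rule supp_subsetI)
      show "closed (supp \<phi> - ball a (R a / 2))" by (simp add: closed_Diff)
      show "\<phi>2 x = 0" if "x \<notin> supp \<phi> - ball a (R a / 2)" for x
        using that a not_in_supp[of x \<phi>] cutoff_inside[of "R a / 2" "R a" a x]
        by (auto simp: \<phi>2_def c_def)
    qed
    then have "supp \<phi>2 \<subseteq> (\<Union>x\<in>X. ball x (R x / 2))"
      using insert.prems by auto
    then have T2: "T \<phi>2 = integral UNIV (\<lambda>x. f x \<bullet> \<phi>2 x)"
      using insert.IH insert.prems t by blast
    have "T \<phi> = T \<phi>1 + T \<phi>2"
      using add[OF t] split by simp
    also have "\<dots> = integral UNIV (\<lambda>x. f x \<bullet> \<phi>1 x + f x \<bullet> \<phi>2 x)"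
      unfolding T1 T2 using test_funs_inner[OF U sm] t
      by (intro Henstock_Kurzweil_Integration.integral_add[symmetric] test_funs_integrable) blast+
    also have "\<dots> = integral UNIV (\<lambda>x. f x \<bullet> \<phi> x)"
      by (subst split) (simp add: inner_add_right)
    finally show ?case .
  qed
  have "T \<phi> = integral U (\<lambda>x. f x \<bullet> \<phi> x)" if \<phi>: "\<phi> \<in> test_funs U" for \<phi>
  proof -
    have cov: "supp \<phi> \<subseteq> (\<Union>x\<in>supp \<phi>. ball x (R x / 2))"
    proof
      fix x assume "x \<in> supp \<phi>"
      moreover from this have "x \<in> ball x (R x / 2)"
        using R[of x] test_funsD(3)[OF \<phi>] by auto
      ultimately show "x \<in> (\<Union>x\<in>supp \<phi>. ball x (R x / 2))" by blast
    qed
    obtain X where "X \<subseteq> supp \<phi>" "finite X" "supp \<phi> \<subseteq> (\<Union>x\<in>X. ball x (R x / 2))"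
      by (rule compactE_image[OF test_funsD(2)[OF \<phi>] _ cov]) auto
    then have "T \<phi> = integral UNIV (\<lambda>x. f x \<bullet> \<phi> x)"
      using main[of X \<phi>] \<phi> test_funsD(3)[OF \<phi>] by blast
    also have "\<dots> = integral U (\<lambda>x. f x \<bullet> \<phi> x)"
      by (rule integral_zero_outside[symmetric]) (use test_funs_zero_outside[OF \<phi>] in auto)
    finally show ?thesis .
  qed
  then show ?thesis using sm unfolding given_by_def by blast
qed

text \<open>Gluing the local representatives provides the existence on which the choice in \<open>restr_fun\<close> relies.\<close>

lemma singular_at_0_given_by:
  fixes T :: "'v::euclidean_space functional"
  assumes "open \<Omega>" "T \<in> \<A> \<Omega> V"
  shows "given_by (\<Omega> - {0}) T (restr_fun (\<Omega> - {0}) T)"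
proof -
  have "\<exists>f. given_by (\<Omega> - {0}) T f"
  proof (rule given_by_glue)
    show "open (\<Omega> - {0})" using assms by auto
    show "T (\<lambda>x. \<phi> x + \<psi> x) = T \<phi> + T \<psi>"
      if "\<phi> \<in> test_funs (\<Omega> - {0})" "\<psi> \<in> test_funs (\<Omega> - {0})" for \<phi> \<psi>
    proof -
      have "\<phi> \<in> test_funs \<Omega>" "\<psi> \<in> test_funs \<Omega>"
        using that test_funs_mono by blast+
      then show ?thesis
        using assms(2) by (simp add: \<A>_def distributions_def is_distribution_def)
    qed
    show "\<exists>V f. open V \<and> x \<in> V \<and> given_by V T f" if "x \<in> \<Omega> - {0}" for x
      using that assms(2) by (auto simp: \<A>_def sing_support_def)
  qed
  then show ?thesis unfolding restr_fun_def by (rule someI_ex)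
qed

section \<open>Integration by parts\<close>

lemma has_real_derivative_along_axis:
  fixes g :: "plane \<Rightarrow> real"
  assumes "g differentiable at (x + t *\<^sub>R axis i 1)"
  shows "((\<lambda>t. g (x + t *\<^sub>R axis i 1)) has_real_derivative partial i g (x + t *\<^sub>R axis i 1)) (at t)"
proof -
  let ?D = "frechet_derivative g (at (x + t *\<^sub>R axis i 1))"
  have D: "(g has_derivative ?D) (at (x + t *\<^sub>R axis i 1))"
    using assms frechet_derivative_works by blast
  have "((\<lambda>t. x + t *\<^sub>R axis i 1) has_derivative (\<lambda>h. h *\<^sub>R axis i 1)) (at t)"
    by (auto intro!: derivative_eq_intros)
  from has_derivative_compose[OF this D]
  have "((\<lambda>t. g (x + t *\<^sub>R axis i 1)) has_derivative (\<lambda>h. h *\<^sub>R ?D (axis i 1))) (at t)"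
    by (simp add: linear_scale[OF has_derivative_linear[OF D]])
  then show ?thesis
    by (simp add: has_field_derivative_def partial_def mult.commute[of _ "?D (axis i 1)"])
qed

lemma has_integral_translate:
  fixes \<phi> :: "plane \<Rightarrow> 'v::euclidean_space"
  assumes "\<phi> \<in> test_funs U"
  shows "((\<lambda>x. \<phi> (x + c)) has_integral integral UNIV \<phi>) UNIV"
proof -
  obtain a where a: "supp \<phi> \<subseteq> cbox (-a) a" "\<phi> integrable_on cbox (-a) a"
    "(\<phi> has_integral integral (cbox (-a) a) \<phi>) UNIV"
    using test_fun_has_integral_box[OF assms] .
  have "((\<lambda>x. \<phi> (x + c)) has_integral integral (cbox (-a) a) \<phi>) (cbox (-a - c) (a - c))"
    by (rule has_integral_shift_cbox[OF integrable_integral[OF a(2)]])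
  then have "((\<lambda>x. \<phi> (x + c)) has_integral integral (cbox (-a) a) \<phi>) UNIV"
  proof (rule has_integral_on_superset)
    fix x assume "x \<notin> cbox (-a - c) (a - c)"
    then have "x + c \<notin> cbox (-a) a"
      by (auto simp: mem_box inner_diff_left inner_add_left algebra_simps)
    then show "\<phi> (x + c) = 0" using a(1) not_in_supp[of "x + c" \<phi>] by blast
  qed simp
  then show ?thesis using integral_unique[OF a(3)] by simp
qed

text \<open>By translation invariance the difference quotients of \<open>g\<close> have integral zero; they converge to
  the partial derivative, and they are bounded by its maximum on one fixed box.\<close>

lemma integral_partial_zero:
  fixes g :: "plane \<Rightarrow> real"
  assumes g: "g \<in> test_funs U"
  shows "integral UNIV (partial i g) = 0"
proof -
  define e :: plane where "e = axis i 1"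
  define h where "h n = inverse (real (Suc n))" for n
  define q where "q n x = (g (x + h n *\<^sub>R e) - g x) / h n" for n x
  have h: "0 < h n" "h n \<le> 1" for n by (auto simp: h_def field_simps)
  have diff: "g differentiable at x" for x
    using smooth_on_differentiable_at[OF test_funsD(1)[OF g]] by auto
  have der: "((\<lambda>t. g (x + t *\<^sub>R e)) has_real_derivative partial i g (x + t *\<^sub>R e)) (at t)" for x t
    unfolding e_def by (rule has_real_derivative_along_axis[OF diff])
  obtain M where M: "\<And>x. norm (partial i g x) \<le> M"
    using test_funs_bounded[OF test_funs_partial[OF g]] by blast
  have qM: "\<bar>q n x\<bar> \<le> M" for n x
  proof -
    obtain z where "g (x + h n *\<^sub>R e) - g (x + 0 *\<^sub>R e) = (h n - 0) * partial i g (x + z *\<^sub>R e)"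
      using MVT2[OF h(1)[of n], of "\<lambda>t. g (x + t *\<^sub>R e)" "\<lambda>t. partial i g (x + t *\<^sub>R e)"] der by blast
    then have "q n x = partial i g (x + z *\<^sub>R e)"
      using h(1)[of n] by (simp add: q_def)
    then show ?thesis using M by simp
  qed
  obtain R where R: "\<And>x. x \<in> supp g \<Longrightarrow> norm x \<le> R"
    using compact_imp_bounded[OF test_funsD(2)[OF g]] bounded_iff by blast
  obtain b where b: "cball (0::plane) (R + 1) \<subseteq> cbox (-b) b"
    using bounded_subset_cbox_symmetric[OF bounded_cball] by blast
  have q0: "q n x = 0" if "x \<notin> cbox (-b) b" for n x
  proof -
    have x: "norm x > R + 1" using that b by force
    have "norm (h n *\<^sub>R e) \<le> 1" using h[of n] by (simp add: e_def)
    then have "norm (x + h n *\<^sub>R e) > R"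
      using x norm_triangle_ineq2[of x "- (h n *\<^sub>R e)"] by simp
    then have "x + h n *\<^sub>R e \<notin> supp g" "x \<notin> supp g"
      using R[of "x + h n *\<^sub>R e"] R[of x] x by auto
    then show ?thesis by (simp add: q_def not_in_supp[of _ g])
  qed
  have int: "(q n has_integral 0) UNIV" for n
  proof -
    have "((\<lambda>x. g (x + h n *\<^sub>R e)) has_integral integral UNIV g) UNIV"
      by (rule has_integral_translate[OF g])
    from has_integral_divide[OF has_integral_diff[OF this integrable_integral[OF test_funs_integrable[OF g]]], of "h n"]
    show ?thesis by (simp add: q_def[abs_def])
  qed
  have lim: "(\<lambda>n. q n x) \<longlonglongrightarrow> partial i g x" for x
  proof -
    have "((\<lambda>t. (g (x + t *\<^sub>R e) - g x) / t) \<longlongrightarrow> partial i g x) (at 0)"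
      using der[of x 0] by (simp add: has_field_derivative_iff)
    moreover have "filterlim h (at 0) sequentially"
      unfolding filterlim_at using LIMSEQ_inverse_real_of_nat h(1)
      by (auto simp: h_def[abs_def] eventually_sequentially)
    ultimately show ?thesis
      unfolding q_def by (rule filterlim_compose)
  qed
  have dom: "(\<lambda>x. if x \<in> cbox (-b) b then M else 0) integrable_on UNIV"
    by (rule Henstock_Kurzweil_Integration.integrable_restrict_UNIV[THEN iffD2, OF integrable_const])
  have "(\<lambda>n. integral UNIV (q n)) \<longlonglongrightarrow> integral UNIV (partial i g)"
  proof (rule dominated_convergence(2)[OF has_integral_integrable[OF int] dom _ lim])
    show "norm (q n x) \<le> (if x \<in> cbox (-b) b then M else 0)" for n x
      using qM[of n x] q0[of x n] by simp
  qed
  then show ?thesis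
    using integral_unique[OF int] by (simp add: LIMSEQ_const_iff)
qed

text \<open>Through \<open>grad_col\<close> and \<open>div_col\<close> the operators \<open>grad\<close> and \<open>classical_div\<close> become sums of linear images of
  partial derivatives, so that they inherit the closure properties of these.\<close>

definition grad_col :: "2 \<Rightarrow> real^2 \<Rightarrow> real^2^2" where
  "grad_col j v = (\<chi> i k. if k = j then v $ i else 0)"

definition div_col :: "2 \<Rightarrow> real^2^2 \<Rightarrow> real^2" where
  "div_col j A = (\<chi> i. A $ i $ j)"

lemma bounded_linear_grad_col: "bounded_linear (grad_col j)"
  unfolding linear_conv_bounded_linear[symmetric]
  by (rule linearI) (auto simp: grad_col_def vec_eq_iff)

lemma bounded_linear_div_col: "bounded_linear (div_col j)"
  unfolding linear_conv_bounded_linear[symmetric]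
  by (rule linearI) (auto simp: div_col_def vec_eq_iff)

lemma grad_eq:
  assumes "\<psi> differentiable at x"
  shows "grad \<psi> x = grad_col 1 (partial 1 \<psi> x) + grad_col 2 (partial 2 \<psi> x)"
  using partial_linear[OF bounded_linear_vec_nth assms]
  by (simp add: grad_def grad_col_def vec_eq_iff forall_2)

lemma classical_div_eq:
  assumes "s differentiable at x"
  shows "classical_div s x = div_col 1 (partial 1 s x) + div_col 2 (partial 2 s x)"
proof -
  have "bounded_linear (\<lambda>A::real^2^2. A $ i $ j)" for i j
    using bounded_linear_compose[OF bounded_linear_vec_nth bounded_linear_vec_nth] .
  from partial_linear[OF this assms]
  show ?thesis
    by (simp add: classical_div_def div_col_def vec_eq_iff forall_2 sum_2)
qed

lemma grad_test_funs:
  assumes "\<psi> \<in> test_funs U"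
  shows "grad \<psi> \<in> test_funs U"
proof -
  have "grad \<psi> = (\<lambda>x. grad_col 1 (partial 1 \<psi> x) + grad_col 2 (partial 2 \<psi> x))"
    using grad_eq smooth_on_differentiable_at[OF test_funsD(1)[OF assms]] by blast
  then show ?thesis
    using test_funs_add[OF test_funs_linear[OF bounded_linear_grad_col test_funs_partial[OF assms]]
        test_funs_linear[OF bounded_linear_grad_col test_funs_partial[OF assms]]] by simp
qed

lemma smooth_on_classical_div:
  assumes "open U" "smooth_on U s"
  shows "smooth_on U (classical_div s)"
proof (rule smooth_on_cong[OF assms(1)])
  show "smooth_on U (\<lambda>x. div_col 1 (partial 1 s x) + div_col 2 (partial 2 s x))"
    by (intro smooth_on_add smooth_on_linear[OF _ bounded_linear_div_col] smooth_on_partial assms)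
qed (use classical_div_eq smooth_on_differentiable_at assms in metis)

text \<open>Every product \<open>s\<^sub>i\<^sub>j \<psi>\<^sub>i\<close> is a test function, so its derivative in direction \<open>j\<close> has integral zero. The field \<open>s\<close> may be singular at the boundary of \<open>U\<close>, where \<open>\<psi>\<close> vanishes.\<close>

lemma integration_by_parts:
  assumes U: "open U" and s: "smooth_on U s" and \<psi>: "\<psi> \<in> test_funs U"
  shows "integral UNIV (\<lambda>x. s x \<bullet> grad \<psi> x) = - integral UNIV (\<lambda>x. classical_div s x \<bullet> \<psi> x)"
proof -
  define w where "w i j x = s x $ i $ j * \<psi> x $ i" for i j x
  have lin: "bounded_linear (\<lambda>A::real^2^2. A $ i $ j)" for i j
    using bounded_linear_compose[OF bounded_linear_vec_nth bounded_linear_vec_nth] .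
  have w: "w i j \<in> test_funs U" for i j
    unfolding w_def[abs_def]
    by (intro test_funs_bilinear[OF U bounded_bilinear_mult] smooth_on_linear[OF U lin s]
        test_funs_linear[OF bounded_linear_vec_nth \<psi>])
  have dw: "partial j (w i j) x = s x $ i $ j * partial j (\<lambda>y. \<psi> y $ i) x + partial j (\<lambda>y. s y $ i $ j) x * \<psi> x $ i"
    for i j x
  proof (cases "x \<in> U")
    case True
    show ?thesis
      unfolding w_def[abs_def]
      by (rule partial_bilinear[OF bounded_bilinear_mult])
        (use smooth_on_differentiable_at[OF smooth_on_linear[OF U lin s] U True]
           smooth_on_differentiable_at[OF test_funsD(1)[OF test_funs_linear[OF bounded_linear_vec_nth \<psi>]]] in auto)
  next
    case False
    have "partial j (w i j) x = 0" "partial j (\<lambda>y. \<psi> y $ i) x = 0" "\<psi> x = 0"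
      using test_funs_zero_outside[OF test_funs_partial[OF w] False] test_funs_zero_outside[OF \<psi> False]
        test_funs_zero_outside[OF test_funs_partial[OF test_funs_linear[OF bounded_linear_vec_nth \<psi>]] False]
      by auto
    then show ?thesis by simp
  qed
  have eq: "(\<Sum>i\<in>UNIV. \<Sum>j\<in>UNIV. partial j (w i j) x) = s x \<bullet> grad \<psi> x + classical_div s x \<bullet> \<psi> x" for x
    by (simp add: dw inner_vec_def grad_def classical_div_def sum.distrib sum_distrib_right)
  have "((\<lambda>x. \<Sum>i\<in>UNIV. \<Sum>j\<in>UNIV. partial j (w i j) x) has_integral (\<Sum>i\<in>(UNIV::2 set). \<Sum>j\<in>(UNIV::2 set). 0)) UNIV"
    by (intro has_integral_sum finite)
      (use test_funs_integrable[OF test_funs_partial[OF w]] integral_partial_zero[OF w] integrable_integral in metis)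
  then have 0: "integral UNIV (\<lambda>x. s x \<bullet> grad \<psi> x + classical_div s x \<bullet> \<psi> x) = 0"
    by (simp add: eq integral_unique)
  have "(\<lambda>x. s x \<bullet> grad \<psi> x) integrable_on UNIV"
    by (rule test_funs_integrable[OF test_funs_inner[OF U s grad_test_funs[OF \<psi>]]])
  moreover have "(\<lambda>x. classical_div s x \<bullet> \<psi> x) integrable_on UNIV"
    by (rule test_funs_integrable[OF test_funs_inner[OF U smooth_on_classical_div[OF U s] \<psi>]])
  ultimately show ?thesis
    using 0 by (simp add: Henstock_Kurzweil_Integration.integral_add)
qed

section \<open>Plane integrals by circles\<close>

lemma continuous_on_compact_integrable_on:
  fixes f :: "'a::euclidean_space \<Rightarrow> 'b::euclidean_space"
  assumes "compact S" "continuous_on S f"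
  shows "f integrable_on S"
proof -
  have "set_integrable lborel S f"
    unfolding set_integrable_def using borel_integrable_compact[OF assms] .
  then show ?thesis by (rule set_borel_integral_eq_integral(1))
qed

lemma measure_cball_plane: "0 \<le> r \<Longrightarrow> measure lebesgue (cball (0::plane) r) = pi * r\<^sup>2"
  using content_cball[of r "0::plane"] by (simp add: unit_ball_vol_2 measure_completion)

text \<open>Both sides have the same derivative in \<open>M\<close>: the annulus between the radii \<open>sqrt u\<close> and \<open>sqrt v\<close>
  has area \<open>pi (v - u)\<close>, and the integrand is nearly \<open>\<theta>' u\<close> on it if \<open>v\<close> is close to \<open>u\<close>.\<close>

lemma integral_cball_radial:
  fixes \<theta> \<theta>' :: "real \<Rightarrow> real"
  assumes deriv: "\<And>u. (\<theta> has_real_derivative \<theta>' u) (at u)"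
    and cont: "continuous_on UNIV \<theta>'" and "0 \<le> M"
  shows "integral (cball (0::plane) (sqrt M)) (\<lambda>x. \<theta>' (x \<bullet> x)) = pi * (\<theta> M - \<theta> 0)"
proof -
  define G :: "plane \<Rightarrow> real" where "G x = \<theta>' (x \<bullet> x)" for x
  define J where "J v = integral (cball (0::plane) (sqrt v)) G" for v
  have contG: "continuous_on S G" for S
    unfolding G_def by (intro continuous_on_compose2[OF cont] continuous_intros) auto
  have intG: "G integrable_on cball 0 \<rho>" for \<rho>
    by (rule continuous_on_compact_integrable_on[OF compact_cball contG])
  have J_diff: "\<bar>J v - J u - (v - u) * (pi * c)\<bar> \<le> e * (pi * (v - u))"
    if "0 \<le> u" "u \<le> v" and e: "\<And>t. u \<le> t \<Longrightarrow> t \<le> v \<Longrightarrow> \<bar>\<theta>' t - c\<bar> \<le> e" for u v c e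
  proof -
    let ?A = "cball (0::plane) (sqrt v) - cball 0 (sqrt u)"
    have sub: "cball (0::plane) (sqrt u) \<subseteq> cball 0 (sqrt v)" using order_trans[OF _ real_sqrt_le_mono[OF that(2)]] by auto
    have lm: "?A \<in> lmeasurable" by (intro fmeasurable.Diff lmeasurable_cball)
    have mA: "measure lebesgue ?A = pi * (v - u)"
    proof -
      have "measure lebesgue ?A = measure lebesgue (cball (0::plane) (sqrt v)) - measure lebesgue (cball (0::plane) (sqrt u))"
        by (rule measurable_measure_Diff) (use sub in \<open>simp_all add: lmeasurable_cball fmeasurableD\<close>)
      also have "\<dots> = pi * (sqrt v)\<^sup>2 - pi * (sqrt u)\<^sup>2"
        using that by (subst (1 2) measure_cball_plane) auto
      finally show ?thesis using that by (simp add: algebra_simps)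
    qed
    have iA: "(G has_integral J v - J u) ?A"
      unfolding J_def
      by (rule has_integral_setdiff[OF integrable_integral[OF intG] integrable_integral[OF intG]])
        (simp only: Diff_eq_empty_iff[THEN iffD2, OF sub] negligible_empty)
    have c1: "((\<lambda>x. k) has_integral k * (pi * (v - u))) ?A" for k :: real
      using has_integral_mult_right[OF integrable_integral[OF integrable_on_const[OF lm, of 1]], of k]
        lmeasure_integral[OF lm] mA by simp
    have "norm (integral ?A (\<lambda>x. G x - c)) \<le> integral ?A (\<lambda>x. e)"
    proof (rule integral_norm_bound_integral)
      show "(\<lambda>x. G x - c) integrable_on ?A" "(\<lambda>x. e) integrable_on ?A"
        using has_integral_diff[OF iA c1] c1 by blast+
      fix x assume x: "x \<in> ?A"
      then have "sqrt u \<le> norm x" "norm x \<le> sqrt v" by auto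
      then have "u \<le> (norm x)\<^sup>2" "(norm x)\<^sup>2 \<le> v"
        using that by (auto intro: sqrt_le_D real_le_rsqrt simp: power_mono dest: power_mono[of "sqrt u" "norm x" 2] power_mono[of "norm x" "sqrt v" 2])
      then show "norm (G x - c) \<le> e"
        using e by (simp add: G_def dot_square_norm)
    qed
    then show ?thesis
      using integral_unique[OF has_integral_diff[OF iA c1]] integral_unique[OF c1[of e]]
      by (simp add: algebra_simps)
  qed
  have derJ: "(J has_real_derivative pi * \<theta>' u) (at u within {0..M})" if u: "u \<in> {0..M}" for u
    unfolding has_field_derivative_def has_derivative_within_alt
  proof (intro conjI allI impI)
    show "bounded_linear ((*) (pi * \<theta>' u))" by (rule bounded_linear_mult_right)
    fix e :: real assume "0 < e"
    then have "e / pi > 0" by simp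
    then obtain d where d: "d > 0" "\<And>t. \<bar>t - u\<bar> < d \<Longrightarrow> \<bar>\<theta>' t - \<theta>' u\<bar> < e / pi"
      using cont unfolding continuous_on_iff dist_real_def by blast
    show "\<exists>d>0. \<forall>y\<in>{0..M}. norm (y - u) < d \<longrightarrow>
        norm (J y - J u - pi * \<theta>' u * (y - u)) \<le> e * norm (y - u)"
    proof (intro exI conjI ballI impI)
      fix y assume y: "y \<in> {0..M}" "norm (y - u) < d"
      show "norm (J y - J u - pi * \<theta>' u * (y - u)) \<le> e * norm (y - u)"
      proof (cases "u \<le> y")
        case True
        have "\<bar>J y - J u - (y - u) * (pi * \<theta>' u)\<bar> \<le> e / pi * (pi * (y - u))"
          using u y True d(2) by (intro J_diff less_imp_le[OF d(2)]) auto
        then show ?thesis using True by (simp add: algebra_simps)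
      next
        case False
        have "\<bar>J u - J y - (u - y) * (pi * \<theta>' u)\<bar> \<le> e / pi * (pi * (u - y))"
          using u y False d(2) by (intro J_diff less_imp_le[OF d(2)]) auto
        then show ?thesis using False by (simp add: algebra_simps abs_if split: if_splits)
      qed
    qed (rule d(1))
  qed
  have "\<exists>k. \<forall>u\<in>{0..M}. (\<lambda>u. J u - pi * \<theta> u) u = k"
  proof (rule has_field_derivative_zero_constant)
    fix u assume "u \<in> {0..M}"
    then have "((\<lambda>u. J u - pi * \<theta> u) has_real_derivative pi * \<theta>' u - pi * \<theta>' u) (at u within {0..M})"
      by (rule DERIV_diff[OF derJ DERIV_cmult[OF has_field_derivative_at_within[OF deriv]]])
    then show "((\<lambda>u. J u - pi * \<theta> u) has_real_derivative 0) (at u within {0..M})" by simp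
  qed auto
  then obtain k where "\<forall>u\<in>{0..M}. J u - pi * \<theta> u = k" by blast
  then have "J M - pi * \<theta> M = k" "J 0 - pi * \<theta> 0 = k" using assms(3) by simp_all
  then have "J M - pi * \<theta> M = J 0 - pi * \<theta> 0" by simp
  moreover have "J 0 = 0" by (simp add: J_def)
  ultimately show ?thesis unfolding J_def G_def[abs_def] by (simp add: algebra_simps)
qed

definition circ :: "real \<Rightarrow> plane" where
  "circ t = vector [cos t, sin t]"

definition rot :: "real \<Rightarrow> plane \<Rightarrow> plane" where
  "rot t x = vector [cos t * x $ 1 - sin t * x $ 2, sin t * x $ 1 + cos t * x $ 2]"

lemma circ_nth [simp]: "circ t $ 1 = cos t" "circ t $ 2 = sin t"
  by (simp_all add: circ_def)

lemma rot_nth [simp]: "rot t x $ 1 = cos t * x $ 1 - sin t * x $ 2"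
  "rot t x $ 2 = sin t * x $ 1 + cos t * x $ 2"
  by (simp_all add: rot_def)

lemma norm_circ [simp]: "norm (circ t) = 1"
  by (simp add: norm_vec_def L2_set_def sum_2)

lemma norm_rot [simp]: "norm (rot t x) = norm x"
proof -
  have "(cos t * x $ 1 - sin t * x $ 2)\<^sup>2 + (sin t * x $ 1 + cos t * x $ 2)\<^sup>2 =
      ((sin t)\<^sup>2 + (cos t)\<^sup>2) * ((x $ 1)\<^sup>2 + (x $ 2)\<^sup>2)"
    by (simp only: power2_eq_square) algebra
  then show ?thesis by (simp add: norm_vec_def L2_set_def sum_2)
qed

lemma polar_form:
  obtains a where "0 \<le> a" "a < 2 * pi" "x = norm x *\<^sub>R circ a"
proof (cases "x = 0")
  case True
  then show ?thesis using that[of 0] by auto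
next
  case False
  have "(x $ 1)\<^sup>2 + (x $ 2)\<^sup>2 = (norm x)\<^sup>2"
    by (simp add: norm_vec_def L2_set_def sum_2)
  then have "(x $ 1 / norm x)\<^sup>2 + (x $ 2 / norm x)\<^sup>2 = 1"
    using False by (simp add: power_divide add_divide_distrib[symmetric])
  then obtain a where "0 \<le> a" "a < 2 * pi" "x $ 1 / norm x = cos a" "x $ 2 / norm x = sin a"
    using sincos_total_2pi by metis
  moreover have "x $ 1 = norm x * (x $ 1 / norm x)" "x $ 2 = norm x * (x $ 2 / norm x)"
    using False by simp_all
  ultimately have "x = norm x *\<^sub>R circ a"
    by (simp only: vec_eq_iff forall_2 vector_scaleR_component circ_nth real_scaleR_def)
  moreover note \<open>0 \<le> a\<close> \<open>a < 2 * pi\<close>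
  ultimately show ?thesis using that by blast
qed

lemma rot_circ: "rot t (r *\<^sub>R circ a) = r *\<^sub>R circ (t + a)"
  by (simp add: vec_eq_iff forall_2 cos_add sin_add algebra_simps)

lemma continuous_on_circ: "continuous_on S circ"
proof -
  have eq: "circ = (\<lambda>t. cos t *\<^sub>R axis 1 1 + sin t *\<^sub>R axis 2 1)"
    by (auto simp: fun_eq_iff vec_eq_iff forall_2 axis_def)
  show ?thesis by (subst eq) (intro continuous_intros)
qed

lemma linear_rot: "linear (rot t)"
  by (rule linearI) (auto simp: vec_eq_iff forall_2 algebra_simps)

lemma det_rot: "det (matrix (rot t)) = 1"
proof -
  have "cos t * cos t + sin t * sin t = 1"
    using sin_cos_squared_add3[of t] by simp
  then show ?thesis by (simp add: det_2 matrix_def axis_def)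
qed

lemma rot_rot_minus: "rot t (rot (- t) x) = x"
proof -
  have "cos t * cos t + sin t * sin t = 1"
    using sin_cos_squared_add3[of t] by simp
  then have *: "(cos t * cos t + sin t * sin t) * y = y" for y by simp
  show ?thesis
    using *[of "x $ 1", unfolded distrib_right mult.assoc] *[of "x $ 2", unfolded distrib_right mult.assoc]
    by (simp add: vec_eq_iff forall_2 algebra_simps)
qed

lemma surj_rot: "rot t ` UNIV = UNIV"
  by (metis rot_rot_minus surjI)

lemma continuous_on_compact_support_integrable:
  fixes f :: "plane \<Rightarrow> 'v::euclidean_space"
  assumes "continuous_on UNIV f" "\<And>x. x \<notin> cbox a b \<Longrightarrow> f x = 0"
  shows "f integrable_on UNIV"
  by (rule integrable_on_superset[OF integrable_continuous[OF continuous_on_subset[OF assms(1)]]])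
    (use assms(2) in auto)

text \<open>A rotation has determinant one. The change of variables formula concerns functions with values in
  a space of column vectors, whence the embedding \<open>L\<close> of the real line in the proof.\<close>

lemma integral_rot:
  fixes \<phi> :: "plane \<Rightarrow> real"
  assumes "\<phi> \<in> test_funs U"
  shows "integral UNIV (\<lambda>x. \<phi> (rot t x)) = integral UNIV \<phi>"
proof -
  define L :: "real \<Rightarrow> real^2" where "L r = r *\<^sub>R axis 1 1" for r
  have L: "bounded_linear L"
    unfolding L_def by (rule bounded_linear_scaleR_left)
  let ?F = "\<lambda>x. L (\<phi> x)"
  obtain a where a: "supp \<phi> \<subseteq> cbox (-a) a" "\<phi> integrable_on cbox (-a) a"
    "(\<phi> has_integral integral (cbox (-a) a) \<phi>) UNIV"
    using test_fun_has_integral_box[OF assms] .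
  have z: "\<phi> x = 0" if "x \<notin> cbox (-a) a" for x
    using not_in_supp[of x \<phi>] that a(1) by blast
  have c: "continuous_on UNIV \<phi>" by (rule test_funs_continuous[OF assms])
  have "?F absolutely_integrable_on UNIV"
    unfolding absolutely_integrable_on_def
    by (intro conjI continuous_on_compact_support_integrable[of _ "-a" a] continuous_intros
        continuous_on_compose2[OF linear_continuous_on[OF L] c])
      (auto simp: z L_def)
  then have "integral (rot t ` UNIV) ?F = \<bar>det (matrix (rot t))\<bar> *\<^sub>R integral UNIV (?F \<circ> rot t)"
    by (intro integral_change_of_variables_linear[OF linear_rot]) (simp add: surj_rot)
  then have "integral UNIV (\<lambda>x. L (\<phi> (rot t x))) = integral UNIV ?F"
    by (simp add: surj_rot det_rot o_def)
  moreover have "integral UNIV ?F = L (integral UNIV \<phi>)"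
    using integral_linear[OF test_funs_integrable[OF assms] L] by (simp add: o_def)
  moreover have "integral UNIV (\<lambda>x. L (\<phi> (rot t x))) = L (integral UNIV (\<lambda>x. \<phi> (rot t x)))"
  proof -
    obtain R where R: "\<And>x. x \<in> cbox (-a) a \<Longrightarrow> norm x \<le> R"
      using bounded_cbox[of "-a" a] unfolding bounded_iff by blast
    obtain b where b: "cball 0 R \<subseteq> cbox (-b) (b::plane)"
      using bounded_subset_cbox_symmetric[OF bounded_cball] by blast
    have rc: "continuous_on UNIV (rot t)"
      using linear_rot linear_continuous_on linear_conv_bounded_linear by blast
    have "(\<lambda>x. \<phi> (rot t x)) integrable_on UNIV"
    proof (rule continuous_on_compact_support_integrable[of _ "-b" b])
      show "continuous_on UNIV (\<lambda>x. \<phi> (rot t x))"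
        by (rule continuous_on_compose2[OF c rc]) auto
      fix x assume "x \<notin> cbox (-b) b"
      then have "norm x > R" using b by force
      then show "\<phi> (rot t x) = 0" using R[of "rot t x"] z[of "rot t x"] by force
    qed
    then show ?thesis
      using integral_linear[OF _ L, of "\<lambda>x. \<phi> (rot t x)" UNIV] by (simp add: o_def)
  qed
  ultimately show ?thesis by (simp add: L_def)
qed

lemma integral_period_shift:
  fixes f :: "real \<Rightarrow> real"
  assumes cont: "continuous_on UNIV f" and per: "\<And>t. f (t + 2 * pi) = f t"
    and a: "0 \<le> a" "a \<le> 2 * pi"
  shows "integral {0..2 * pi} (\<lambda>t. f (t + a)) = integral {0..2 * pi} f"
proof -
  have c: "continuous_on S f" for S using cont continuous_on_subset by blast
  have i: "f integrable_on {u..v}" for u v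
    by (rule integrable_continuous_real[OF c])
  have "integral {0..2 * pi} (\<lambda>t. f (t + a)) = integral {a..2 * pi + a} f"
    using integral_shift[OF c, of 0 "2 * pi" a] by (simp add: o_def)
  also have "\<dots> = integral {a..2 * pi} f + integral {2 * pi..2 * pi + a} f"
    by (rule Henstock_Kurzweil_Integration.integral_combine[symmetric]) (use a i in auto)
  also have "integral {2 * pi..2 * pi + a} f = integral {0..a} f"
    using integral_shift[OF c, of 0 a "2 * pi"] per by (simp add: o_def add.commute)
  also have "integral {a..2 * pi} f + integral {0..a} f = integral {0..2 * pi} f"
    using Henstock_Kurzweil_Integration.integral_combine[OF a i] by (simp add: add.commute)
  finally show ?thesis .
qed

text \<open>The rotated copies of \<open>x\<close> run once through its circle; the starting angle is irrelevant by
  periodicity.\<close>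

lemma angular_average:
  fixes \<phi> :: "plane \<Rightarrow> real"
  assumes "continuous_on UNIV \<phi>"
  shows "integral {0..2 * pi} (\<lambda>t. \<phi> (rot t x)) = integral {0..2 * pi} (\<lambda>t. \<phi> (norm x *\<^sub>R circ t))"
proof -
  obtain a where a: "0 \<le> a" "a < 2 * pi" "x = norm x *\<^sub>R circ a"
    using polar_form .
  have "rot t x = norm x *\<^sub>R circ (t + a)" for t
    using a(3) rot_circ by metis
  then have "integral {0..2 * pi} (\<lambda>t. \<phi> (rot t x)) = integral {0..2 * pi} (\<lambda>t. \<phi> (norm x *\<^sub>R circ (t + a)))"
    by simp
  also have "\<dots> = integral {0..2 * pi} (\<lambda>t. \<phi> (norm x *\<^sub>R circ t))"
  proof (rule integral_period_shift)
    show "continuous_on UNIV (\<lambda>t. \<phi> (norm x *\<^sub>R circ t))"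
      by (rule continuous_on_compose2[OF assms]) (auto intro!: continuous_intros continuous_on_circ)
    show "\<phi> (norm x *\<^sub>R circ (t + 2 * pi)) = \<phi> (norm x *\<^sub>R circ t)" for t
      by (simp add: circ_def)
  qed (use a in auto)
  finally show ?thesis .
qed

text \<open>Integration in polar coordinates without coordinates: the integral of \<open>\<phi>\<close> equals that of each
  rotated copy, and averaging over all rotations under the integral sign leaves a function of the
  radius.\<close>

lemma integral_angular:
  fixes \<phi> :: "plane \<Rightarrow> real"
  assumes \<phi>: "\<phi> \<in> test_funs U" and R: "\<And>x. R < norm x \<Longrightarrow> \<phi> x = 0"
    and H: "\<And>\<rho>. 0 \<le> \<rho> \<Longrightarrow> integral {0..2 * pi} (\<lambda>t. \<phi> (\<rho> *\<^sub>R circ t)) = H \<rho>"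
  shows "2 * pi * integral UNIV \<phi> = integral (cball (0::plane) R) (\<lambda>x. H (norm x))"
proof -
  have c: "continuous_on UNIV \<phi>" by (rule test_funs_continuous[OF \<phi>])
  obtain a where a: "cball 0 R \<subseteq> cbox (-a) (a::plane)"
    using bounded_subset_cbox_symmetric[OF bounded_cball] by blast
  have z: "\<phi> (rot t x) = 0" if "x \<notin> cbox (-a) a" for x t
  proof -
    have "norm x > R" using a that by force
    then show ?thesis using R by simp
  qed
  have cr: "continuous_on S (\<lambda>(x, t). \<phi> (rot t x))" for S
  proof -
    have "(\<lambda>(x, t). rot t x) = (\<lambda>p. (cos (snd p) * fst p $ 1 - sin (snd p) * fst p $ 2) *\<^sub>R axis 1 1
        + (sin (snd p) * fst p $ 1 + cos (snd p) * fst p $ 2) *\<^sub>R (axis 2 1 :: plane))"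
      by (auto simp: fun_eq_iff vec_eq_iff forall_2 axis_def)
    moreover have "continuous_on S (\<lambda>p. (cos (snd p) * fst p $ 1 - sin (snd p) * fst p $ 2) *\<^sub>R axis 1 1
        + (sin (snd p) * fst p $ 1 + cos (snd p) * fst p $ 2) *\<^sub>R (axis 2 1 :: plane))"
      by (intro continuous_intros)
    ultimately have "continuous_on S (\<lambda>(x, t). rot t x)" by simp
    from continuous_on_compose2[OF c this] show ?thesis by (simp add: case_prod_unfold)
  qed
  have swap: "integral (cbox (-a) a) (\<lambda>x. integral (cbox 0 (2 * pi)) (\<lambda>t. \<phi> (rot t x))) =
      integral (cbox 0 (2 * pi)) (\<lambda>t. integral (cbox (-a) a) (\<lambda>x. \<phi> (rot t x)))"
    by (rule integral_swap_continuous[OF cr])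
  have "integral (cbox (-a) a) (\<lambda>x. \<phi> (rot t x)) = integral UNIV \<phi>" for t
    using integral_zero_outside[of "cbox (-a) a" "\<lambda>x. \<phi> (rot t x)"] z integral_rot[OF \<phi>, of t] by simp
  then have "2 * pi * integral UNIV \<phi> = integral (cbox (-a) a) (\<lambda>x. integral {0..2 * pi} (\<lambda>t. \<phi> (rot t x)))"
    using swap by simp
  also have "\<dots> = integral (cbox (-a) a) (\<lambda>x. H (norm x))"
    using H by (simp add: angular_average[OF c])
  also have "\<dots> = integral (cball (0::plane) R) (\<lambda>x. H (norm x))"
  proof (rule Henstock_Kurzweil_Integration.integral_spike_set)
    have "H (norm x) = 0" if "x \<notin> cball 0 R" for x :: plane
      using H[of "norm x"] R[of "norm x *\<^sub>R circ _"] that by force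
    then have 0: "{x \<in> cbox (- a) a - cball 0 R. H (norm x) \<noteq> 0} = {}" by blast
    show "negligible {x \<in> cbox (- a) a - cball 0 R. H (norm x) \<noteq> 0}"
      unfolding 0 by (rule negligible_empty)
    show "negligible {x \<in> cball 0 R - cbox (- a) a. H (norm x) \<noteq> 0}"
      using a by (simp add: Diff_eq_empty_iff[THEN iffD2])
  qed
  finally show ?thesis .
qed

section \<open>The flux through circles\<close>

text \<open>With the unit normal \<open>n\<close> and the unit tangent \<open>\<tau>\<close> of the circle, a field without divergence satisfies
  \<open>\<partial>\<^sub>\<rho> (\<rho> w \<bullet> n) = - \<partial>\<^sub>t (w \<bullet> \<tau>)\<close>, because the trace of the derivative of \<open>w\<close> can be computed in the basis
  \<open>n\<close>, \<open>\<tau>\<close>. The right-hand side integrates to zero around the circle, so differentiating under the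
  integral sign shows that the flux does not depend on the radius. Only circles of positive radius enter, so \<open>w\<close> may
  be singular at the origin.\<close>

lemma flux_constant:
  fixes w :: "plane \<Rightarrow> real^2"
  assumes U: "open U" "smooth_on U w" and div: "\<And>x. x \<in> U \<Longrightarrow> partial 1 w x $ 1 + partial 2 w x $ 2 = 0"
    and sub: "\<And>\<rho> t. 0 < \<rho> \<Longrightarrow> \<rho> \<le> R \<Longrightarrow> \<rho> *\<^sub>R circ t \<in> U"
    and \<rho>: "0 < \<rho>" "\<rho> \<le> R"
  shows "integral {0..2 * pi} (\<lambda>t. \<rho> * (w (\<rho> *\<^sub>R circ t) \<bullet> circ t)) =
         integral {0..2 * pi} (\<lambda>t. R * (w (R *\<^sub>R circ t) \<bullet> circ t))"
proof -
  define \<tau> :: "real \<Rightarrow> plane" where "\<tau> t = vector [- sin t, cos t]" for t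
  have \<tau>_nth [simp]: "\<tau> t $ 1 = - sin t" "\<tau> t $ 2 = cos t" for t
    by (simp_all add: \<tau>_def)
  define Dw where "Dw x h = (h $ 1) *\<^sub>R partial 1 w x + (h $ 2) *\<^sub>R partial 2 w x" for x h :: plane
  have Dw: "(w has_derivative Dw x) (at x)" if "x \<in> U" for x
    using has_derivative_partials[OF smooth_on_differentiable_at[OF U(2,1) that]]
    by (simp add: Dw_def[abs_def] sum_2)
  have trace: "Dw x (circ t) \<bullet> circ t + Dw x (\<tau> t) \<bullet> \<tau> t = 0" if "x \<in> U" for x t
  proof -
    have "Dw x (circ t) \<bullet> circ t + Dw x (\<tau> t) \<bullet> \<tau> t =
        ((sin t)\<^sup>2 + (cos t)\<^sup>2) * (partial 1 w x $ 1 + partial 2 w x $ 2)"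
      by (simp only: Dw_def inner_vec_def sum_2 vector_add_component vector_scaleR_component
          circ_nth \<tau>_nth inner_real_def real_scaleR_def power2_eq_square) algebra
    then show ?thesis using div[OF that] by simp
  qed
  have circ_deriv: "(circ has_vector_derivative \<tau> t) (at t within S)" for t S
  proof -
    have 1: "circ = (\<lambda>t. cos t *\<^sub>R axis 1 1 + sin t *\<^sub>R axis 2 1)"
      by (auto simp: fun_eq_iff vec_eq_iff forall_2 axis_def)
    have 2: "\<tau> t = (- sin t) *\<^sub>R axis 1 1 + cos t *\<^sub>R axis 2 1"
      by (auto simp: vec_eq_iff forall_2 axis_def)
    show ?thesis unfolding 1 2
      by (auto intro!: derivative_eq_intros simp: has_real_derivative_iff_has_vector_derivative[symmetric])
  qed
  have \<tau>_deriv: "(\<tau> has_vector_derivative - circ t) (at t within S)" for t S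
  proof -
    have 1: "\<tau> = (\<lambda>t. (- sin t) *\<^sub>R axis 1 1 + cos t *\<^sub>R axis 2 1)"
      by (auto simp: fun_eq_iff vec_eq_iff forall_2 axis_def)
    have 2: "- circ t = (- cos t) *\<^sub>R axis 1 1 + (- sin t) *\<^sub>R axis 2 1"
      by (auto simp: vec_eq_iff forall_2 axis_def)
    show ?thesis unfolding 1 2
      by (auto intro!: derivative_eq_intros simp: has_real_derivative_iff_has_vector_derivative[symmetric])
  qed
  define P where "P \<rho> t = \<rho> * (w (\<rho> *\<^sub>R circ t) \<bullet> circ t)" for \<rho> t
  define P' where "P' \<rho> t = w (\<rho> *\<^sub>R circ t) \<bullet> circ t + \<rho> * (Dw (\<rho> *\<^sub>R circ t) (circ t) \<bullet> circ t)" for \<rho> t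
  have DwS: "Dw x (c *\<^sub>R h) = c *\<^sub>R Dw x h" for x c h
    by (simp add: Dw_def algebra_simps)
  have derP: "((\<lambda>\<rho>. P \<rho> t) has_field_derivative P' \<rho> t) (at \<rho> within S)" if "0 < \<rho>" "\<rho> \<le> R" for \<rho> t S
  proof -
    have "((\<lambda>\<rho>. \<rho> *\<^sub>R circ t) has_derivative (\<lambda>h. h *\<^sub>R circ t)) (at \<rho> within S)"
      by (auto intro!: derivative_eq_intros)
    from has_derivative_compose[OF this Dw[OF sub[OF that]]]
    have "((\<lambda>\<rho>. w (\<rho> *\<^sub>R circ t)) has_derivative (\<lambda>h. h *\<^sub>R Dw (\<rho> *\<^sub>R circ t) (circ t))) (at \<rho> within S)"
      by (simp add: DwS)
    then have "((\<lambda>\<rho>. w (\<rho> *\<^sub>R circ t) \<bullet> circ t) has_derivative (\<lambda>h. h *\<^sub>R Dw (\<rho> *\<^sub>R circ t) (circ t) \<bullet> circ t)) (at \<rho> within S)"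
      by (rule has_derivative_inner_left)
    then have "((\<lambda>\<rho>. w (\<rho> *\<^sub>R circ t) \<bullet> circ t) has_field_derivative Dw (\<rho> *\<^sub>R circ t) (circ t) \<bullet> circ t) (at \<rho> within S)"
      by (simp add: has_field_derivative_def mult.commute[of _ "Dw (\<rho> *\<^sub>R circ t) (circ t) \<bullet> circ t"])
    then show ?thesis
      unfolding P_def P'_def by (auto intro!: derivative_eq_intros)
  qed
  have derQ: "((\<lambda>t. w (\<rho> *\<^sub>R circ t) \<bullet> \<tau> t) has_vector_derivative - P' \<rho> t) (at t within S)"
    if "0 < \<rho>" "\<rho> \<le> R" for \<rho> t S
  proof -
    have "((\<lambda>t. \<rho> *\<^sub>R circ t) has_derivative (\<lambda>h. \<rho> *\<^sub>R (h *\<^sub>R \<tau> t))) (at t within S)"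
      using circ_deriv unfolding has_vector_derivative_def by (intro has_derivative_scaleR_right)
    from has_derivative_compose[OF this Dw[OF sub[OF that]]]
    have 1: "((\<lambda>t. w (\<rho> *\<^sub>R circ t)) has_derivative (\<lambda>h. \<rho> *\<^sub>R h *\<^sub>R Dw (\<rho> *\<^sub>R circ t) (\<tau> t))) (at t within S)"
      by (simp only: DwS)
    have 2: "(\<tau> has_derivative (\<lambda>h. h *\<^sub>R - circ t)) (at t within S)"
      using \<tau>_deriv unfolding has_vector_derivative_def .
    have "- P' \<rho> t = w (\<rho> *\<^sub>R circ t) \<bullet> (- circ t) + \<rho> *\<^sub>R Dw (\<rho> *\<^sub>R circ t) (\<tau> t) \<bullet> \<tau> t"
    proof -
      have "Dw (\<rho> *\<^sub>R circ t) (\<tau> t) \<bullet> \<tau> t = - (Dw (\<rho> *\<^sub>R circ t) (circ t) \<bullet> circ t)"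
        using trace[OF sub[OF that], of t t] by linarith
      then show ?thesis by (simp add: P'_def)
    qed
    then show ?thesis
      using has_derivative_inner[OF 1 2]
      by (simp add: has_vector_derivative_def algebra_simps)
  qed
  have contw: "continuous_on ({0<..R} \<times> {0..2 * pi}) (\<lambda>p. f (fst p *\<^sub>R circ (snd p)))"
    if "continuous_on U f" for f :: "plane \<Rightarrow> real^2"
    by (rule continuous_on_compose2[OF that])
      (use sub in \<open>auto intro!: continuous_intros continuous_on_compose2[OF continuous_on_circ[of UNIV]]\<close>)
  have contP': "continuous_on ({0<..R} \<times> {0..2 * pi}) (\<lambda>(\<rho>, t). P' \<rho> t)"
    unfolding P'_def Dw_def case_prod_unfold
    by (intro continuous_intros contw smooth_on_continuous U smooth_on_partial
        continuous_on_compose2[OF continuous_on_circ[of UNIV]]) auto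
  have intP: "(\<lambda>t. P \<rho> t) integrable_on cbox 0 (2 * pi)" if "0 < \<rho>" "\<rho> \<le> R" for \<rho>
    unfolding P_def
    by (intro integrable_continuous continuous_intros continuous_on_circ
         continuous_on_compose2[OF smooth_on_continuous[OF U(2)]])
       (use sub that in auto)
  have "\<exists>c. \<forall>\<rho>\<in>{0<..R}. integral (cbox 0 (2 * pi)) (\<lambda>t. P \<rho> t) = c"
  proof (rule has_field_derivative_zero_constant)
    fix \<rho> assume \<rho>: "\<rho> \<in> {0<..R}"
    have "((\<lambda>\<rho>. integral (cbox 0 (2 * pi)) (P \<rho>)) has_field_derivative integral (cbox 0 (2 * pi)) (P' \<rho>)) (at \<rho> within {0<..R})"
      by (rule leibniz_rule_field_derivative) (use derP intP contP' \<rho> in auto)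
    moreover have "((\<lambda>t. - P' \<rho> t) has_integral w (\<rho> *\<^sub>R circ (2 * pi)) \<bullet> \<tau> (2 * pi) - w (\<rho> *\<^sub>R circ 0) \<bullet> \<tau> 0) {0..2 * pi}"
      by (rule fundamental_theorem_of_calculus) (use derQ \<rho> in auto)
    from integral_unique[OF has_integral_neg[OF this]]
    have "integral (cbox 0 (2 * pi)) (P' \<rho>) = 0"
      by (simp add: circ_def \<tau>_def)
    ultimately show "((\<lambda>\<rho>. integral (cbox 0 (2 * pi)) (\<lambda>t. P \<rho> t)) has_field_derivative 0) (at \<rho> within {0<..R})"
      by simp
  qed simp
  then show ?thesis using \<rho> by (auto simp: P_def)
qed

lemma step_derivative:
  assumes "a < b"
  shows "\<exists>D. (\<forall>u. (step a b has_real_derivative D u) (at u)) \<and> continuous_on UNIV D \<and>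
    (\<forall>u. u < a \<or> b < u \<longrightarrow> D u = 0)"
proof -
  define F where "F = flat_poly (monom 1 2 * (1 - pderiv 1))"
  have F: "(flat has_real_derivative F t) (at t)" for t
    unfolding flat_def F_def by (rule flat_poly_deriv)
  have contF: "continuous_on S F" for S
    unfolding F_def by (rule DERIV_continuous_on[OF has_field_derivative_at_within[OF flat_poly_deriv]])
  have contf: "continuous_on S flat" for S
    by (rule DERIV_continuous_on[OF has_field_derivative_at_within[OF F]])
  define D where "D u = F (flat 1 - flat ((u - a) / (b - a))) * - (F ((u - a) / (b - a)) * (1 / (b - a))) / flat (flat 1)" for u
  have D: "(step a b has_real_derivative D u) (at u)" for u
  proof -
    have "((\<lambda>u. (u - a) / (b - a)) has_real_derivative 1 / (b - a)) (at u)"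
      using assms by (auto intro!: derivative_eq_intros)
    from DERIV_cdivide[OF DERIV_chain2[OF F DERIV_diff[OF DERIV_const DERIV_chain2[OF F this]]],
        of "flat 1" "flat (flat 1)"]
    show ?thesis by (simp add: step_def[abs_def] D_def)
  qed
  have c: "continuous_on UNIV D"
    unfolding D_def
    using assms flat_pos[of 1] flat_pos[of "flat 1"]
    by (intro continuous_intros continuous_on_compose2[OF contF[of UNIV]] continuous_on_compose2[OF contf[of UNIV]]) auto
  have l: "D u = 0" if "u < a" for u
  proof -
    have "((\<lambda>u. 1) has_real_derivative 0) (at u)" by simp
    then have "(step a b has_real_derivative 0) (at u)"
      by (rule has_field_derivative_transform_within_open[where S = "{..<a}"])
        (use that assms in \<open>auto simp: step_left\<close>)
    then show ?thesis using D DERIV_unique by blast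
  qed
  have r: "D u = 0" if "b < u" for u
  proof -
    have "((\<lambda>u. 0) has_real_derivative 0) (at u)" by simp
    then have "(step a b has_real_derivative 0) (at u)"
      by (rule has_field_derivative_transform_within_open[where S = "{b<..}"])
        (use that assms in \<open>auto simp: step_right\<close>)
    then show ?thesis using D DERIV_unique by blast
  qed
  show ?thesis using D c l r by blast
qed

lemma grad_cutoff:
  assumes D: "\<And>u. (step (r\<^sup>2) (R\<^sup>2) has_real_derivative D u) (at u)"
  shows "grad (\<lambda>x. cutoff 0 r R x *\<^sub>R v) x = (\<chi> i j. 2 * D (x \<bullet> x) * x $ j * v $ i)"
proof -
  have "partial j (\<lambda>y. (cutoff 0 r R y *\<^sub>R v) $ i) x = 2 * D (x \<bullet> x) * x $ j * v $ i" for i j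
  proof -
    have 1: "((\<lambda>y. y \<bullet> y) has_derivative (\<lambda>h. 2 * (x \<bullet> h))) (at x)"
      by (auto intro!: derivative_eq_intros simp: inner_commute)
    have "((\<lambda>y. step (r\<^sup>2) (R\<^sup>2) (y \<bullet> y)) has_derivative (\<lambda>h. D (x \<bullet> x) * (2 * (x \<bullet> h)))) (at x)"
      using has_derivative_compose[OF 1 D[of "x \<bullet> x", unfolded has_field_derivative_def]] .
    from has_derivative_mult_left[OF this, of "v $ i"]
    have "((\<lambda>y. (cutoff 0 r R y *\<^sub>R v) $ i) has_derivative (\<lambda>h. D (x \<bullet> x) * (2 * (x \<bullet> h)) * v $ i)) (at x)"
      by (simp add: cutoff_def)
    from partial_eq[OF this, of j] show ?thesis by (simp add: inner_axis)
  qed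
  then show ?thesis by (simp add: grad_def)
qed

text \<open>The gradient of the cutoff lives on the annulus where the cutoff descends.\<close>

lemma grad_cutoff_test_fun:
  assumes "0 < r" "r < R" "\<And>x. r \<le> norm x \<Longrightarrow> norm x \<le> R \<Longrightarrow> x \<in> U"
  shows "grad (\<lambda>x. cutoff 0 r R x *\<^sub>R v) \<in> test_funs U"
proof -
  have lt: "r\<^sup>2 < R\<^sup>2" using assms by (simp add: power_strict_mono)
  obtain D where D: "\<And>u. (step (r\<^sup>2) (R\<^sup>2) has_real_derivative D u) (at u)" "continuous_on UNIV D"
    "\<And>u. u < r\<^sup>2 \<Longrightarrow> D u = 0" "\<And>u. R\<^sup>2 < u \<Longrightarrow> D u = 0"
    using step_derivative[OF lt] by metis
  have t: "(\<lambda>x. cutoff 0 r R x *\<^sub>R v) \<in> test_funs UNIV"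
    using assms by (intro cutoff_test_fun) auto
  show ?thesis
  proof (rule test_funsI[OF test_funsD(1)[OF grad_test_funs[OF t]]])
    show "compact (cball 0 R - ball (0::plane) r)" by (simp add: compact_diff)
    show "cball 0 R - ball 0 r \<subseteq> U" using assms(3) by auto
    fix x :: plane assume "x \<notin> cball 0 R - ball 0 r"
    then have "norm x > R \<or> norm x < r" by auto
    then have "x \<bullet> x > R\<^sup>2 \<or> x \<bullet> x < r\<^sup>2"
      using assms(1,2) power_strict_mono[of R "norm x" 2] power_strict_mono[of "norm x" r 2]
      unfolding dot_square_norm by fastforce
    then have "D (x \<bullet> x) = 0" using D(3,4)[of "x \<bullet> x"] by blast
    then show "grad (\<lambda>x. cutoff 0 r R x *\<^sub>R v) x = 0"
      by (simp add: grad_cutoff[OF D(1)] vec_eq_iff)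
  qed
qed

text \<open>For \<open>w = v s\<close> the integrand is \<open>2 D(|x|\<^sup>2) w \<bullet> x\<close>, where \<open>D\<close> is the derivative of the step. On the
  circle of radius \<open>\<rho>\<close> the angular integral of \<open>w \<bullet> x\<close> is the flux, a constant \<open>c\<close>, so averaging
  over rotations leaves \<open>c / (2 pi)\<close> times the plane integral of \<open>2 D(|x|\<^sup>2)\<close>. The plane integral of
  \<open>D(|x|\<^sup>2)\<close> is \<open>- pi\<close>, because the step descends from \<open>1\<close> to \<open>0\<close>.\<close>

lemma flux_identity:
  fixes s :: "plane \<Rightarrow> real^2^2"
  assumes U: "open U" "smooth_on U s" and div: "\<And>x. x \<in> U \<Longrightarrow> classical_div s x = 0"
    and sub: "\<And>x. 0 < norm x \<Longrightarrow> norm x \<le> \<epsilon> \<Longrightarrow> x \<in> U"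
    and r: "0 < r" "r < R" "R \<le> \<epsilon>"
  shows "integral UNIV (\<lambda>x. s x \<bullet> grad (\<lambda>x. cutoff 0 r R x *\<^sub>R v) x) =
    - (circle_integral \<epsilon> (\<lambda>x. s x *v outward_normal x) \<bullet> v)"
proof -
  have \<epsilon>: "\<epsilon> > 0" using r by simp
  have lt: "r\<^sup>2 < R\<^sup>2" using r by (simp add: power_strict_mono)
  obtain D where D: "\<And>u. (step (r\<^sup>2) (R\<^sup>2) has_real_derivative D u) (at u)" "continuous_on UNIV D"
    "\<And>u. u < r\<^sup>2 \<Longrightarrow> D u = 0" "\<And>u. R\<^sup>2 < u \<Longrightarrow> D u = 0"
    using step_derivative[OF lt] by metis
  define w where "w x = v v* s x" for x
  have linL: "bounded_linear (\<lambda>A::real^2^2. v v* A)"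
    unfolding linear_conv_bounded_linear[symmetric]
    by (rule linearI) (auto simp: vector_matrix_mult_def vec_eq_iff sum_2 algebra_simps)
  have w: "smooth_on U w"
    unfolding w_def[abs_def] by (rule smooth_on_linear[OF U(1) linL U(2)])
  have divw: "partial 1 w x $ 1 + partial 2 w x $ 2 = 0" if "x \<in> U" for x
  proof -
    have d: "s differentiable at x" using smooth_on_differentiable_at[OF U(2,1) that] .
    have "partial 1 w x $ 1 + partial 2 w x $ 2 = v \<bullet> classical_div s x"
      unfolding w_def[abs_def] classical_div_eq[OF d] partial_linear[OF linL d]
      by (simp add: vector_matrix_mult_def div_col_def inner_vec_def sum_2 algebra_simps)
    then show ?thesis using div[OF that] by simp
  qed
  define c where "c = integral {0..2 * pi} (\<lambda>t. \<epsilon> * (w (\<epsilon> *\<^sub>R circ t) \<bullet> circ t))"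
  have subc: "\<rho> *\<^sub>R circ t \<in> U" if "0 < \<rho>" "\<rho> \<le> \<epsilon>" for \<rho> t
  proof -
    have "norm (\<rho> *\<^sub>R circ t) = \<rho>" using that by simp
    then show ?thesis using sub[of "\<rho> *\<^sub>R circ t"] that by simp
  qed
  have flux: "integral {0..2 * pi} (\<lambda>t. \<rho> * (w (\<rho> *\<^sub>R circ t) \<bullet> circ t)) = c" if "0 < \<rho>" "\<rho> \<le> \<epsilon>" for \<rho>
    unfolding c_def by (rule flux_constant[OF U(1) w divw subc that])
  define \<phi> where "\<phi> x = D (x \<bullet> x) * (w x \<bullet> x)" for x
  have s\<phi>: "s x \<bullet> grad (\<lambda>x. cutoff 0 r R x *\<^sub>R v) x = 2 * \<phi> x" for x
    unfolding grad_cutoff[OF D(1)] \<phi>_def w_def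
    by (simp add: vector_matrix_mult_def inner_vec_def sum_2 algebra_simps)
  have "(\<lambda>x. s x \<bullet> grad (\<lambda>x. cutoff 0 r R x *\<^sub>R v) x) \<in> test_funs U"
  proof (rule test_funs_inner[OF U grad_cutoff_test_fun[OF r(1,2)]])
    fix x :: plane assume "r \<le> norm x" "norm x \<le> R"
    then show "x \<in> U" using r by (intro sub) linarith+
  qed
  then have "(\<lambda>x. (1/2) *\<^sub>R (2 * \<phi> x)) \<in> test_funs U"
    unfolding s\<phi> by (rule test_funs_scale)
  then have \<phi>: "\<phi> \<in> test_funs U" by (simp add: \<phi>_def[abs_def])
  have "2 * pi * integral UNIV \<phi> = integral (cball (0::plane) R) (\<lambda>x. c * D ((norm x)\<^sup>2))"
  proof (rule integral_angular[OF \<phi>, where H = "\<lambda>\<rho>. c * D (\<rho>\<^sup>2)"])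
    fix x :: plane assume "R < norm x"
    then show "\<phi> x = 0"
      using r D(4)[of "x \<bullet> x"] power_strict_mono[of R "norm x" 2] by (simp add: \<phi>_def dot_square_norm)
  next
    fix \<rho> :: real assume "0 \<le> \<rho>"
    show "integral {0..2 * pi} (\<lambda>t. \<phi> (\<rho> *\<^sub>R circ t)) = c * D (\<rho>\<^sup>2)"
    proof (cases "0 < \<rho> \<and> \<rho> \<le> \<epsilon>")
      case True
      have "\<phi> (\<rho> *\<^sub>R circ t) = D (\<rho>\<^sup>2) * (\<rho> * (w (\<rho> *\<^sub>R circ t) \<bullet> circ t))" for t
        by (simp add: \<phi>_def dot_square_norm)
      then show ?thesis using flux True by simp
    next
      case False
      have "D (\<rho>\<^sup>2) = 0"
      proof (cases "\<rho> = 0")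
        case True
        then show ?thesis using D(3)[of 0] r by simp
      next
        case False
        then have "\<rho> > R" using \<open>\<not> (0 < \<rho> \<and> \<rho> \<le> \<epsilon>)\<close> \<open>0 \<le> \<rho>\<close> r by auto
        then show ?thesis using D(4)[of "\<rho>\<^sup>2"] power_strict_mono[of R \<rho> 2] r by simp
      qed
      then show ?thesis by (simp add: \<phi>_def dot_square_norm)
    qed
  qed
  also have "\<dots> = c * integral (cball (0::plane) (sqrt (R\<^sup>2))) (\<lambda>x. D (x \<bullet> x))"
    using r by (simp add: dot_square_norm)
  also have "\<dots> = c * (pi * (step (r\<^sup>2) (R\<^sup>2) (R\<^sup>2) - step (r\<^sup>2) (R\<^sup>2) 0))"
    by (subst integral_cball_radial[OF D(1,2)]) auto
  also have "\<dots> = - (c * pi)"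
    using lt by (simp add: step_left step_right)
  finally have "(2 * integral UNIV \<phi>) * pi = (- c) * pi" by (simp add: mult_ac)
  then have "2 * integral UNIV \<phi> = - c" by (rule mult_right_cancel[THEN iffD1, OF pi_neq_zero])
  then have 1: "integral UNIV (\<lambda>x. s x \<bullet> grad (\<lambda>x. cutoff 0 r R x *\<^sub>R v) x) = - c"
    by (simp add: s\<phi>)
  have "circle_integral \<epsilon> (\<lambda>x. s x *v outward_normal x) \<bullet> v = c"
  proof -
    have n: "outward_normal (\<epsilon> *\<^sub>R circ t) = circ t" for t
      using \<epsilon> by (simp add: outward_normal_def)
    have "vector [\<epsilon> * cos t, \<epsilon> * sin t] = \<epsilon> *\<^sub>R circ t" for t
      by (simp add: vec_eq_iff forall_2)
    then have ci: "circle_integral \<epsilon> (\<lambda>x. s x *v outward_normal x) =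
        integral {0..2 * pi} (\<lambda>t. \<epsilon> *\<^sub>R (s (\<epsilon> *\<^sub>R circ t) *v circ t))"
      by (simp add: circle_integral_def n)
    have cs: "continuous_on {0..2 * pi} (\<lambda>t. s (\<epsilon> *\<^sub>R circ t))"
      by (rule continuous_on_compose2[OF smooth_on_continuous[OF U(2)]])
        (use subc \<epsilon> in \<open>auto intro!: continuous_intros continuous_on_circ\<close>)
    have "(\<lambda>t. \<epsilon> *\<^sub>R (s (\<epsilon> *\<^sub>R circ t) *v circ t)) integrable_on {0..2 * pi}"
      unfolding matrix_vector_mult_def
      by (intro integrable_continuous_real continuous_intros continuous_on_vec_lambda cs continuous_on_circ)
    from integral_linear[OF this bounded_linear_inner_left[of v], symmetric]
    have "circle_integral \<epsilon> (\<lambda>x. s x *v outward_normal x) \<bullet> v =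
        integral {0..2 * pi} (\<lambda>t. \<epsilon> * (v \<bullet> (s (\<epsilon> *\<^sub>R circ t) *v circ t)))"
      unfolding ci by (simp add: o_def inner_commute)
    then show ?thesis
      unfolding c_def w_def dot_lmul_matrix .
  qed
  with 1 show ?thesis by simp
qed

section \<open>Functionals of finite order on rescaled families\<close>

text \<open>Families that behave like \<open>x \<mapsto> \<phi> (x / l)\<close> as \<open>l\<close> tends to zero: every derivative costs at most a
  factor \<open>1 / l\<close>. The derivatives are indexed by lists of directions, because the gradient adds a
  derivative at the innermost place.\<close>

definition tame :: "(real \<Rightarrow> plane \<Rightarrow> 'v::real_normed_vector) \<Rightarrow> bool" where
  "tame F \<longleftrightarrow> (\<forall>l. 0 < l \<and> l < 1 \<longrightarrow> smooth_on UNIV (F l)) \<and>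
    (\<forall>is. \<exists>C. \<forall>l x. 0 < l \<and> l < 1 \<longrightarrow> norm (foldr partial is (F l) x) \<le> C / l ^ length is)"

lemma tameI:
  assumes "\<And>l. 0 < l \<Longrightarrow> l < 1 \<Longrightarrow> smooth_on UNIV (F l)"
    "\<And>is. \<exists>C. \<forall>l x. 0 < l \<and> l < 1 \<longrightarrow> norm (foldr partial is (F l) x) \<le> C / l ^ length is"
  shows "tame F"
  using assms by (auto simp: tame_def)

lemma tame_smooth: "tame F \<Longrightarrow> 0 < l \<Longrightarrow> l < 1 \<Longrightarrow> smooth_on UNIV (F l)"
  by (simp add: tame_def)

lemma tame_bound:
  assumes "tame F"
  obtains C where "\<And>l x. 0 < l \<Longrightarrow> l < 1 \<Longrightarrow> norm (foldr partial is (F l) x) \<le> C / l ^ length is"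
  using assms unfolding tame_def by metis

lemma tame_cong:
  assumes "tame F" "\<And>l x. 0 < l \<Longrightarrow> l < 1 \<Longrightarrow> F l x = G l x"
  shows "tame G"
proof -
  have "F l = G l" if "0 < l" "l < 1" for l using assms(2)[OF that] by blast
  then show ?thesis using assms(1) unfolding tame_def by simp
qed

lemma tame_linear:
  assumes "bounded_linear L" "tame F"
  shows "tame (\<lambda>l x. L (F l x))"
proof (rule tameI)
  show "smooth_on UNIV (\<lambda>x. L (F l x))" if "0 < l" "l < 1" for l
    by (rule smooth_on_linear[OF open_UNIV assms(1) tame_smooth[OF assms(2) that]])
  obtain B where B: "B > 0" "\<And>x. norm (L x) \<le> norm x * B"
    using bounded_linear.pos_bounded[OF assms(1)] by blast
  fix "is"
  obtain C where C: "\<And>l x. 0 < l \<Longrightarrow> l < 1 \<Longrightarrow> norm (foldr partial is (F l) x) \<le> C / l ^ length is"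
    using tame_bound[OF assms(2)] by blast
  have "norm (foldr partial is (\<lambda>x. L (F l x)) x) \<le> (C * B) / l ^ length is" if "0 < l" "l < 1" for l x
  proof -
    have "norm (foldr partial is (\<lambda>x. L (F l x)) x) = norm (L (foldr partial is (F l) x))"
      using foldr_partial_linear[OF open_UNIV assms(1) tame_smooth[OF assms(2) that]] by simp
    also have "\<dots> \<le> norm (foldr partial is (F l) x) * B" by (rule B)
    also have "\<dots> \<le> (C / l ^ length is) * B"
      using C[OF that] B(1) by (intro mult_right_mono) auto
    finally show ?thesis by simp
  qed
  then show "\<exists>C. \<forall>l x. 0 < l \<and> l < 1 \<longrightarrow> norm (foldr partial is (\<lambda>x. L (F l x)) x) \<le> C / l ^ length is"
    by blast
qed

lemma tame_add:
  assumes "tame F" "tame G"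
  shows "tame (\<lambda>l x. F l x + G l x)"
proof (rule tameI)
  show "smooth_on UNIV (\<lambda>x. F l x + G l x)" if "0 < l" "l < 1" for l
    by (rule smooth_on_add[OF open_UNIV tame_smooth[OF assms(1) that] tame_smooth[OF assms(2) that]])
  fix "is"
  obtain C where C: "\<And>l x. 0 < l \<Longrightarrow> l < 1 \<Longrightarrow> norm (foldr partial is (F l) x) \<le> C / l ^ length is"
    using tame_bound[OF assms(1)] by blast
  obtain D where D: "\<And>l x. 0 < l \<Longrightarrow> l < 1 \<Longrightarrow> norm (foldr partial is (G l) x) \<le> D / l ^ length is"
    using tame_bound[OF assms(2)] by blast
  have "norm (foldr partial is (\<lambda>x. F l x + G l x) x) \<le> (C + D) / l ^ length is" if "0 < l" "l < 1" for l x
  proof -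
    have "norm (foldr partial is (\<lambda>x. F l x + G l x) x) = norm (foldr partial is (F l) x + foldr partial is (G l) x)"
      using foldr_partial_add[OF open_UNIV tame_smooth[OF assms(1) that] tame_smooth[OF assms(2) that]] by simp
    also have "\<dots> \<le> C / l ^ length is + D / l ^ length is"
      by (rule norm_triangle_mono[OF C[OF that] D[OF that]])
    finally show ?thesis by (simp add: add_divide_distrib)
  qed
  then show "\<exists>C. \<forall>l x. 0 < l \<and> l < 1 \<longrightarrow> norm (foldr partial is (\<lambda>x. F l x + G l x) x) \<le> C / l ^ length is"
    by blast
qed

lemma tame_partial:
  assumes "tame F"
  shows "tame (\<lambda>l x. l *\<^sub>R partial i (F l) x)"
proof (rule tameI)
  show "smooth_on UNIV (\<lambda>x. l *\<^sub>R partial i (F l) x)" if "0 < l" "l < 1" for l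
    by (rule smooth_on_linear[OF open_UNIV bounded_linear_scaleR_right smooth_on_partial[OF tame_smooth[OF assms that]]])
  fix "is"
  obtain C where C: "\<And>l x. 0 < l \<Longrightarrow> l < 1 \<Longrightarrow> norm (foldr partial (is @ [i]) (F l) x) \<le> C / l ^ length (is @ [i])"
    using tame_bound[OF assms] by blast
  have "norm (foldr partial is (\<lambda>x. l *\<^sub>R partial i (F l) x) x) \<le> C / l ^ length is" if "0 < l" "l < 1" for l x
  proof -
    have "norm (foldr partial is (\<lambda>x. l *\<^sub>R partial i (F l) x) x) = l * norm (foldr partial (is @ [i]) (F l) x)"
      using foldr_partial_linear[OF open_UNIV bounded_linear_scaleR_right smooth_on_partial[OF tame_smooth[OF assms that]]] that
      by simp
    also have "\<dots> \<le> l * (C / l ^ length (is @ [i]))"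
      using C[OF that] that by (intro mult_left_mono) auto
    finally show ?thesis using that by simp
  qed
  then show "\<exists>C. \<forall>l x. 0 < l \<and> l < 1 \<longrightarrow> norm (foldr partial is (\<lambda>x. l *\<^sub>R partial i (F l) x) x) \<le> C / l ^ length is"
    by blast
qed

text \<open>By induction on the number of derivatives: one derivative turns the product into a sum of two
  products in which the differentiated factor, multiplied by \<open>l\<close>, is again tame.\<close>

lemma tame_bilinear:
  fixes F :: "real \<Rightarrow> plane \<Rightarrow> 'a::real_normed_vector" and G :: "real \<Rightarrow> plane \<Rightarrow> 'b::real_normed_vector"
    and bop :: "'a \<Rightarrow> 'b \<Rightarrow> 'c::real_normed_vector"
  assumes bop: "bounded_bilinear bop" and "tame F" "tame G"
  shows "tame (\<lambda>l x. bop (F l x) (G l x))"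
proof (rule tameI)
  interpret bounded_bilinear bop by fact
  have sm: "smooth_on UNIV (\<lambda>x. bop (F l x) (G l x))" if "0 < l" "l < 1" "tame F" "tame G"
    for l and F :: "real \<Rightarrow> plane \<Rightarrow> 'a" and G :: "real \<Rightarrow> plane \<Rightarrow> 'b"
    by (rule smooth_on_bilinear[OF open_UNIV bop tame_smooth[OF that(3,1,2)] tame_smooth[OF that(4,1,2)]])
  show "smooth_on UNIV (\<lambda>x. bop (F l x) (G l x))" if "0 < l" "l < 1" for l
    by (rule sm[OF that assms(2,3)])
  fix "is"
  show "\<exists>C. \<forall>l x. 0 < l \<and> l < 1 \<longrightarrow> norm (foldr partial is (\<lambda>x. bop (F l x) (G l x)) x) \<le> C / l ^ length is"
    using assms(2,3)
  proof (induction "is" arbitrary: F G rule: rev_induct)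
    case Nil
    obtain C where C: "\<And>l x. 0 < l \<Longrightarrow> l < 1 \<Longrightarrow> norm (F l x) \<le> C"
      using tame_bound[OF Nil(1), of "[]"] by auto
    obtain D where D: "\<And>l x. 0 < l \<Longrightarrow> l < 1 \<Longrightarrow> norm (G l x) \<le> D"
      using tame_bound[OF Nil(2), of "[]"] by auto
    obtain K where K: "0 \<le> K" "\<And>a b. norm (bop a b) \<le> norm a * norm b * K"
      using nonneg_bounded by blast
    have "norm (bop (F l x) (G l x)) \<le> C * D * K" if "0 < l" "l < 1" for l x
    proof -
      have C0: "0 \<le> C" by (rule order_trans[OF norm_ge_zero C[OF that, of x]])
      have "norm (F l x) * norm (G l x) \<le> C * D"
        by (rule mult_mono[OF C[OF that] D[OF that] C0 norm_ge_zero])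
      then show ?thesis
        by (rule order_trans[OF K(2) mult_right_mono[OF _ K(1)]])
    qed
    then show ?case by auto
  next
    case (snoc i "is")
    obtain C where C: "\<And>l x. 0 < l \<and> l < 1 \<longrightarrow>
        norm (foldr partial is (\<lambda>x. bop (F l x) (l *\<^sub>R partial i (G l) x)) x) \<le> C / l ^ length is"
      using snoc.IH[OF snoc.prems(1) tame_partial[OF snoc.prems(2)]] by blast
    obtain D where D: "\<And>l x. 0 < l \<and> l < 1 \<longrightarrow>
        norm (foldr partial is (\<lambda>x. bop (l *\<^sub>R partial i (F l) x) (G l x)) x) \<le> D / l ^ length is"
      using snoc.IH[OF tame_partial[OF snoc.prems(1)] snoc.prems(2)] by blast
    have "norm (foldr partial (is @ [i]) (\<lambda>x. bop (F l x) (G l x)) x) \<le> (C + D) / l ^ length (is @ [i])"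
      if l: "0 < l" "l < 1" for l x
    proof -
      let ?A = "\<lambda>x. bop (F l x) (l *\<^sub>R partial i (G l) x)"
      let ?B = "\<lambda>x. bop (l *\<^sub>R partial i (F l) x) (G l x)"
      have sA: "smooth_on UNIV ?A" and sB: "smooth_on UNIV ?B"
        using sm[OF l snoc.prems(1) tame_partial[OF snoc.prems(2)]]
          sm[OF l tame_partial[OF snoc.prems(1)] snoc.prems(2)] by auto
      have dF: "F l differentiable at x" and dG: "G l differentiable at x" for x
        using smooth_on_differentiable_at[OF tame_smooth[OF snoc.prems(1) l]]
          smooth_on_differentiable_at[OF tame_smooth[OF snoc.prems(2) l]] by auto
      have "partial i (\<lambda>x. bop (F l x) (G l x)) = (\<lambda>x. (1 / l) *\<^sub>R (?A x + ?B x))"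
        using partial_bilinear[OF bop dF dG] l
        by (auto simp: fun_eq_iff scaleR_left scaleR_right scaleR_add_right)
      then have "foldr partial (is @ [i]) (\<lambda>x. bop (F l x) (G l x)) x =
          (1 / l) *\<^sub>R (foldr partial is ?A x + foldr partial is ?B x)"
        using foldr_partial_linear[OF open_UNIV bounded_linear_scaleR_right smooth_on_add[OF open_UNIV sA sB]]
          foldr_partial_add[OF open_UNIV sA sB] by simp
      also have "norm \<dots> = (1 / l) * norm (foldr partial is ?A x + foldr partial is ?B x)"
        using l by simp
      also have "\<dots> \<le> (1 / l) * (C / l ^ length is + D / l ^ length is)"
        using l C D by (intro mult_left_mono norm_triangle_mono) auto
      finally show ?thesis using l by (simp add: field_simps)
    qed
    then show ?case by blast
  qed
qed

lemmas tame_scaleR = tame_bilinear[OF bounded_bilinear_scaleR]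

lemma le_divide_power:
  fixes l :: real
  assumes "0 \<le> C" "0 < l" "l < 1"
  shows "C \<le> C / l ^ n"
  using mult_left_mono[of "l ^ n" 1 C] assms by (simp add: field_simps power_le_one)

lemma tame_test_fun:
  fixes \<phi> :: "plane \<Rightarrow> 'v::euclidean_space"
  assumes "\<phi> \<in> test_funs U"
  shows "tame (\<lambda>l. \<phi>)"
proof (rule tameI)
  fix "is"
  obtain C where C: "\<And>x. norm (foldr partial is \<phi> x) \<le> C"
    using test_funs_bounded[OF test_funs_foldr[OF assms]] by blast
  have "0 \<le> C" by (rule order_trans[OF norm_ge_zero C[of 0]])
  then have "norm (foldr partial is \<phi> x) \<le> C / l ^ length is" if "0 < l" "l < 1" for l x
    by (rule order_trans[OF C le_divide_power[OF _ that]])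
  then show "\<exists>C. \<forall>l x. 0 < l \<and> l < 1 \<longrightarrow> norm (foldr partial is \<phi> x) \<le> C / l ^ length is" by blast
qed (rule test_funsD(1)[OF assms])

lemma tame_dilate:
  fixes \<phi> :: "plane \<Rightarrow> 'v::euclidean_space"
  assumes "\<phi> \<in> test_funs U"
  shows "tame (\<lambda>l x. \<phi> (x /\<^sub>R l))"
proof (rule tameI)
  fix "is"
  obtain C where C: "\<And>x. norm (foldr partial is \<phi> x) \<le> C"
    using test_funs_bounded[OF test_funs_foldr[OF assms]] by blast
  have "norm (foldr partial is (\<lambda>x. \<phi> (x /\<^sub>R l)) x) \<le> C / l ^ length is" if "0 < l" "l < 1" for l x
    unfolding foldr_partial_dilate[OF test_funsD(1)[OF assms]]
    using C[of "x /\<^sub>R l"] that by (simp add: field_simps power_inverse)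
  then show "\<exists>C. \<forall>l x. 0 < l \<and> l < 1 \<longrightarrow> norm (foldr partial is (\<lambda>x. \<phi> (x /\<^sub>R l)) x) \<le> C / l ^ length is" by blast
qed (rule smooth_on_dilate[OF test_funsD(1)[OF assms]])

text \<open>The consequence of the seminorm estimates that is used of a distribution: on tame families with
  supports in one compact set its values grow at most like a power of \<open>1 / l\<close>. In this form finite
  order passes to the divergence, at the price of one more power.\<close>

definition moderate :: "plane set \<Rightarrow> 'v::euclidean_space functional \<Rightarrow> bool" where
  "moderate \<Omega> T \<longleftrightarrow>
     (\<forall>\<phi>\<in>test_funs \<Omega>. \<forall>\<psi>\<in>test_funs \<Omega>. T (\<lambda>x. \<phi> x + \<psi> x) = T \<phi> + T \<psi>) \<and>
     (\<forall>c. \<forall>\<phi>\<in>test_funs \<Omega>. T (\<lambda>x. c *\<^sub>R \<phi> x) = c * T \<phi>) \<and>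
     (\<forall>K. compact K \<and> K \<subseteq> \<Omega> \<longrightarrow>
        (\<exists>N. \<forall>F. tame F \<and> (\<forall>l. 0 < l \<and> l < 1 \<longrightarrow> supp (F l) \<subseteq> K) \<longrightarrow>
           (\<exists>C. \<forall>l. 0 < l \<and> l < 1 \<longrightarrow> \<bar>T (F l)\<bar> \<le> C / l ^ N)))"

lemma moderate_add: "moderate \<Omega> T \<Longrightarrow> \<phi> \<in> test_funs \<Omega> \<Longrightarrow> \<psi> \<in> test_funs \<Omega> \<Longrightarrow> T (\<lambda>x. \<phi> x + \<psi> x) = T \<phi> + T \<psi>"
  and moderate_scale: "moderate \<Omega> T \<Longrightarrow> \<phi> \<in> test_funs \<Omega> \<Longrightarrow> T (\<lambda>x. c *\<^sub>R \<phi> x) = c * T \<phi>"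
  by (simp_all add: moderate_def)

lemma moderate_diff:
  assumes "moderate \<Omega> T" "\<phi> \<in> test_funs \<Omega>" "\<psi> \<in> test_funs \<Omega>"
  shows "T (\<lambda>x. \<phi> x - \<psi> x) = T \<phi> - T \<psi>"
  using moderate_add[OF assms(1,2) test_funs_scale[OF assms(3)], of "-1"]
    moderate_scale[OF assms(1,3), of "-1"] by simp

lemma moderate_bound:
  assumes "moderate \<Omega> T" "compact K" "K \<subseteq> \<Omega>"
  shows "\<exists>N. \<forall>F. tame F \<and> (\<forall>l. 0 < l \<and> l < 1 \<longrightarrow> supp (F l) \<subseteq> K) \<longrightarrow>
           (\<exists>C. \<forall>l. 0 < l \<and> l < 1 \<longrightarrow> \<bar>T (F l)\<bar> \<le> C / l ^ N)"
  using assms by (simp add: moderate_def)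

lemma tame_test:
  assumes "tame F" "compact K" "K \<subseteq> \<Omega>" "supp (F l) \<subseteq> K" "0 < l" "l < 1"
  shows "F l \<in> test_funs \<Omega>"
  by (rule test_funsI[OF tame_smooth[OF assms(1,5,6)] assms(2,3)])
    (use assms(4) not_in_supp[of _ "F l"] in blast)

lemma mpartial_eq_foldr:
  "mpartial \<alpha> f = foldr partial (replicate (fst \<alpha>) 1 @ replicate (snd \<alpha>) 2) f"
proof -
  have "foldr partial (replicate n i) f = (partial i ^^ n) f" for n i and f :: "plane \<Rightarrow> 'a"
    by (induction n) auto
  then show ?thesis by (simp add: mpartial_def)
qed

lemma finite_mdeg_le: "finite {\<alpha>. mdeg \<alpha> \<le> N}"
  by (rule finite_subset[of _ "{..N} \<times> {..N}"]) (auto simp: mdeg_def)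

lemma distribution_moderate:
  assumes T: "is_distribution \<Omega> T"
  shows "moderate \<Omega> T"
  unfolding moderate_def
proof (intro conjI allI impI)
  fix K assume K: "compact K \<and> K \<subseteq> \<Omega>"
  then have "\<exists>C N. \<forall>\<phi>\<in>test_funs \<Omega>. supp \<phi> \<subseteq> K \<longrightarrow>
      \<bar>T \<phi>\<bar> \<le> C * (\<Sum>\<alpha> | mdeg \<alpha> \<le> N. SUP x. norm (mpartial \<alpha> \<phi> x))"
    using T by (simp add: is_distribution_def supp_def)
  then obtain C N where CN: "\<forall>\<phi>\<in>test_funs \<Omega>. supp \<phi> \<subseteq> K \<longrightarrow>
      \<bar>T \<phi>\<bar> \<le> C * (\<Sum>\<alpha> | mdeg \<alpha> \<le> N. SUP x. norm (mpartial \<alpha> \<phi> x))"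
    by blast
  show "\<exists>N. \<forall>F. tame F \<and> (\<forall>l. 0 < l \<and> l < 1 \<longrightarrow> supp (F l) \<subseteq> K) \<longrightarrow>
           (\<exists>C. \<forall>l. 0 < l \<and> l < 1 \<longrightarrow> \<bar>T (F l)\<bar> \<le> C / l ^ N)"
  proof (intro exI[of _ N] allI impI)
    fix F :: "real \<Rightarrow> plane \<Rightarrow> 'a"
    assume F: "tame F \<and> (\<forall>l. 0 < l \<and> l < 1 \<longrightarrow> supp (F l) \<subseteq> K)"
    have "\<exists>c. \<forall>l x. 0 < l \<and> l < 1 \<longrightarrow> norm (mpartial \<alpha> (F l) x) \<le> c / l ^ mdeg \<alpha>" for \<alpha>
    proof -
      let ?is = "replicate (fst \<alpha>) (1::2) @ replicate (snd \<alpha>) 2"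
      have "length ?is = mdeg \<alpha>" by (simp add: mdeg_def)
      moreover have "\<exists>c. \<forall>l x. 0 < l \<and> l < 1 \<longrightarrow> norm (foldr partial ?is (F l) x) \<le> c / l ^ length ?is"
        using F unfolding tame_def by blast
      ultimately show ?thesis by (simp only: mpartial_eq_foldr)
    qed
    then obtain c where c: "\<And>\<alpha> l x. 0 < l \<and> l < 1 \<longrightarrow> norm (mpartial \<alpha> (F l) x) \<le> c \<alpha> / l ^ mdeg \<alpha>"
      by metis
    have "\<bar>T (F l)\<bar> \<le> (\<bar>C\<bar> * (\<Sum>\<alpha> | mdeg \<alpha> \<le> N. \<bar>c \<alpha>\<bar>)) / l ^ N" if l: "0 < l" "l < 1" for l
    proof -
      have b: "norm (mpartial \<alpha> (F l) x) \<le> \<bar>c \<alpha>\<bar> / l ^ N" if "mdeg \<alpha> \<le> N" for \<alpha> x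
      proof -
        have "norm (mpartial \<alpha> (F l) x) \<le> c \<alpha> / l ^ mdeg \<alpha>" using c l by blast
        also have "\<dots> \<le> \<bar>c \<alpha>\<bar> / l ^ mdeg \<alpha>" using l by (intro divide_right_mono) auto
        also have "\<dots> \<le> \<bar>c \<alpha>\<bar> / l ^ N"
          using l that by (intro divide_left_mono power_decreasing) auto
        finally show ?thesis .
      qed
      let ?S = "\<lambda>\<alpha>. SUP x. norm (mpartial \<alpha> (F l) x)"
      have S: "0 \<le> ?S \<alpha> \<and> ?S \<alpha> \<le> \<bar>c \<alpha>\<bar> / l ^ N" if "mdeg \<alpha> \<le> N" for \<alpha>
      proof
        show "?S \<alpha> \<le> \<bar>c \<alpha>\<bar> / l ^ N" by (rule cSUP_least) (use b that in auto)
        have "bdd_above (range (\<lambda>x. norm (mpartial \<alpha> (F l) x)))"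
          using b[OF that] by (intro bdd_aboveI2) auto
        then show "0 \<le> ?S \<alpha>" by (rule cSUP_upper2[of _ _ 0]) auto
      qed
      have "\<bar>T (F l)\<bar> \<le> C * (\<Sum>\<alpha> | mdeg \<alpha> \<le> N. ?S \<alpha>)"
        using CN[rule_format, OF tame_test] F K l by blast
      also have "\<dots> \<le> \<bar>C\<bar> * (\<Sum>\<alpha> | mdeg \<alpha> \<le> N. \<bar>c \<alpha>\<bar> / l ^ N)"
        using S by (intro mult_mono sum_mono sum_nonneg) auto
      finally show ?thesis by (simp flip: sum_divide_distrib)
    qed
    then show "\<exists>C. \<forall>l. 0 < l \<and> l < 1 \<longrightarrow> \<bar>T (F l)\<bar> \<le> C / l ^ N" by blast
  qed
qed (use T in \<open>auto simp: is_distribution_def\<close>)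

lemma moderate_sum:
  assumes "moderate \<Omega> T" "moderate \<Omega> S"
  shows "moderate \<Omega> (\<lambda>\<phi>. T \<phi> + S \<phi>)"
  unfolding moderate_def
proof (intro conjI allI impI)
  fix K assume K: "compact K \<and> K \<subseteq> \<Omega>"
  obtain N where N: "\<forall>F. tame F \<and> (\<forall>l. 0 < l \<and> l < 1 \<longrightarrow> supp (F l) \<subseteq> K) \<longrightarrow>
           (\<exists>C. \<forall>l. 0 < l \<and> l < 1 \<longrightarrow> \<bar>T (F l)\<bar> \<le> C / l ^ N)"
    using moderate_bound[OF assms(1)] K by blast
  obtain M where M: "\<forall>F. tame F \<and> (\<forall>l. 0 < l \<and> l < 1 \<longrightarrow> supp (F l) \<subseteq> K) \<longrightarrow>
           (\<exists>C. \<forall>l. 0 < l \<and> l < 1 \<longrightarrow> \<bar>S (F l)\<bar> \<le> C / l ^ M)"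
    using moderate_bound[OF assms(2)] K by blast
  show "\<exists>N. \<forall>F. tame F \<and> (\<forall>l. 0 < l \<and> l < 1 \<longrightarrow> supp (F l) \<subseteq> K) \<longrightarrow>
           (\<exists>C. \<forall>l. 0 < l \<and> l < 1 \<longrightarrow> \<bar>T (F l) + S (F l)\<bar> \<le> C / l ^ N)"
  proof (intro exI[of _ "max N M"] allI impI)
    fix F :: "real \<Rightarrow> plane \<Rightarrow> 'a"
    assume F: "tame F \<and> (\<forall>l. 0 < l \<and> l < 1 \<longrightarrow> supp (F l) \<subseteq> K)"
    obtain C where C: "\<forall>l. 0 < l \<and> l < 1 \<longrightarrow> \<bar>T (F l)\<bar> \<le> C / l ^ N" using N F by blast
    obtain D where D: "\<forall>l. 0 < l \<and> l < 1 \<longrightarrow> \<bar>S (F l)\<bar> \<le> D / l ^ M" using M F by blast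
    have up: "x / l ^ n \<le> \<bar>x\<bar> / l ^ m" if "n \<le> m" "0 < l" "l < 1" for x l :: real and n m
    proof -
      have "x / l ^ n \<le> \<bar>x\<bar> / l ^ n" using that by (intro divide_right_mono) auto
      also have "\<dots> \<le> \<bar>x\<bar> / l ^ m"
        using that by (intro divide_left_mono power_decreasing) auto
      finally show ?thesis .
    qed
    have "\<bar>T (F l) + S (F l)\<bar> \<le> (\<bar>C\<bar> + \<bar>D\<bar>) / l ^ max N M" if l: "0 < l" "l < 1" for l
    proof -
      have "\<bar>T (F l)\<bar> \<le> \<bar>C\<bar> / l ^ max N M"
        by (rule order_trans[OF C[rule_format, OF conjI[OF l]] up[OF max.cobounded1 l]])
      moreover have "\<bar>S (F l)\<bar> \<le> \<bar>D\<bar> / l ^ max N M"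
        by (rule order_trans[OF D[rule_format, OF conjI[OF l]] up[OF max.cobounded2 l]])
      ultimately show ?thesis
        using abs_triangle_ineq[of "T (F l)" "S (F l)"] unfolding add_divide_distrib by linarith
    qed
    then show "\<exists>C. \<forall>l. 0 < l \<and> l < 1 \<longrightarrow> \<bar>T (F l) + S (F l)\<bar> \<le> C / l ^ max N M" by blast
  qed
qed (use assms in \<open>auto simp: moderate_def algebra_simps\<close>)

lemma moderate_Div:
  assumes "moderate \<Omega> \<sigma>"
  shows "moderate \<Omega> (Div \<sigma>)"
  unfolding moderate_def
proof (intro conjI allI impI ballI)
  have g: "grad \<psi> = (\<lambda>x. grad_col 1 (partial 1 \<psi> x) + grad_col 2 (partial 2 \<psi> x))"
    if "smooth_on UNIV \<psi>" for \<psi>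
    using grad_eq[OF smooth_on_differentiable_at[OF that]] by auto
  note lin = linear_simps[OF bounded_linear_grad_col]
  {
    fix \<phi> \<psi> :: "plane \<Rightarrow> real^2" assume t: "\<phi> \<in> test_funs \<Omega>" "\<psi> \<in> test_funs \<Omega>"
    have "grad (\<lambda>x. \<phi> x + \<psi> x) = (\<lambda>x. grad \<phi> x + grad \<psi> x)"
      unfolding g[OF test_funsD(1)[OF test_funs_add[OF t]]] g[OF test_funsD(1)[OF t(1)]] g[OF test_funsD(1)[OF t(2)]]
      using partial_add[OF smooth_on_differentiable_at[OF test_funsD(1)[OF t(1)]] smooth_on_differentiable_at[OF test_funsD(1)[OF t(2)]]]
      by (auto simp: fun_eq_iff lin)
    then show "Div \<sigma> (\<lambda>x. \<phi> x + \<psi> x) = Div \<sigma> \<phi> + Div \<sigma> \<psi>"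
      using moderate_add[OF assms grad_test_funs[OF t(1)] grad_test_funs[OF t(2)]] by (simp add: Div_def)
  next
    fix c and \<phi> :: "plane \<Rightarrow> real^2" assume t: "\<phi> \<in> test_funs \<Omega>"
    have "grad (\<lambda>x. c *\<^sub>R \<phi> x) = (\<lambda>x. c *\<^sub>R grad \<phi> x)"
      unfolding g[OF test_funsD(1)[OF test_funs_scale[OF t]]] g[OF test_funsD(1)[OF t]]
      using partial_linear[OF bounded_linear_scaleR_right smooth_on_differentiable_at[OF test_funsD(1)[OF t]]]
      by (auto simp: fun_eq_iff lin scaleR_add_right)
    then show "Div \<sigma> (\<lambda>x. c *\<^sub>R \<phi> x) = c * Div \<sigma> \<phi>"
      using moderate_scale[OF assms grad_test_funs[OF t]] by (simp add: Div_def)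
  next
    fix K assume K: "compact K \<and> K \<subseteq> \<Omega>"
    obtain N where N: "\<forall>F. tame F \<and> (\<forall>l. 0 < l \<and> l < 1 \<longrightarrow> supp (F l) \<subseteq> K) \<longrightarrow>
           (\<exists>C. \<forall>l. 0 < l \<and> l < 1 \<longrightarrow> \<bar>\<sigma> (F l)\<bar> \<le> C / l ^ N)"
      using moderate_bound[OF assms] K by blast
    show "\<exists>N. \<forall>F. tame F \<and> (\<forall>l. 0 < l \<and> l < 1 \<longrightarrow> supp (F l) \<subseteq> K) \<longrightarrow>
           (\<exists>C. \<forall>l. 0 < l \<and> l < 1 \<longrightarrow> \<bar>Div \<sigma> (F l)\<bar> \<le> C / l ^ N)"
    proof (intro exI[of _ "Suc N"] allI impI)
      fix F :: "real \<Rightarrow> plane \<Rightarrow> real^2"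
      assume F: "tame F \<and> (\<forall>l. 0 < l \<and> l < 1 \<longrightarrow> supp (F l) \<subseteq> K)"
      define G where "G l x = l *\<^sub>R grad (F l) x" for l x
      have "tame (\<lambda>l x. grad_col 1 (l *\<^sub>R partial 1 (F l) x) + grad_col 2 (l *\<^sub>R partial 2 (F l) x))"
        using F by (intro tame_add tame_linear[OF bounded_linear_grad_col] tame_partial) auto
      then have "tame G"
        by (rule tame_cong) (simp add: G_def g[OF tame_smooth[OF conjunct1[OF F]]] lin scaleR_add_right)
      moreover have tF: "F l \<in> test_funs \<Omega>" if "0 < l" "l < 1" for l
        using tame_test[of F K \<Omega> l] F K that by blast
      have "supp (G l) \<subseteq> K" if "0 < l" "l < 1" for l
      proof (rule supp_subsetI[OF compact_imp_closed])
        show "compact K" using K by blast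
        fix x assume "x \<notin> K"
        then have "x \<notin> supp (F l)" using F that by blast
        then have "F l \<in> test_funs (- {x})"
          using test_funsD[OF tF[OF that]] by (auto simp: test_funs_iff)
        then show "G l x = 0"
          using test_funs_zero_outside[OF grad_test_funs, of "F l" "- {x}" x] by (simp add: G_def)
      qed
      ultimately obtain C where C: "\<forall>l. 0 < l \<and> l < 1 \<longrightarrow> \<bar>\<sigma> (G l)\<bar> \<le> C / l ^ N"
        using N by blast
      have "\<bar>Div \<sigma> (F l)\<bar> \<le> C / l ^ Suc N" if l: "0 < l" "l < 1" for l
      proof -
        have "\<sigma> (G l) = l * \<sigma> (grad (F l))"
          unfolding G_def[abs_def] by (rule moderate_scale[OF assms grad_test_funs[OF tF[OF l]]])
        then have "l * \<bar>Div \<sigma> (F l)\<bar> \<le> C / l ^ N"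
          using C l by (auto simp: Div_def abs_mult)
        then show ?thesis using l by (simp add: field_simps)
      qed
      then show "\<exists>C. \<forall>l. 0 < l \<and> l < 1 \<longrightarrow> \<bar>Div \<sigma> (F l)\<bar> \<le> C / l ^ Suc N" by blast
    qed
  }
qed

section \<open>Hadamard's lemma\<close>

text \<open>The weight \<open>t ^ n\<close> is what \<open>n\<close> differentiations of \<open>x \<mapsto> f (t x)\<close> produce, so the family is closed under
  partial derivatives.\<close>

definition ray_mean :: "nat \<Rightarrow> (plane \<Rightarrow> 'v::euclidean_space) \<Rightarrow> plane \<Rightarrow> 'v" where
  "ray_mean n f x = integral (cbox 0 1) (\<lambda>t. t ^ n *\<^sub>R f (t *\<^sub>R x))"

lemma ray_mean_deriv:
  fixes f :: "plane \<Rightarrow> 'v::euclidean_space"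
  assumes f: "smooth_on UNIV f"
  shows "ray_mean n f differentiable at x" "partial i (ray_mean n f) x = ray_mean (Suc n) (partial i f) x"
proof -
  define d where "d x t h = t ^ n *\<^sub>R (\<Sum>i\<in>UNIV. (t * h $ i) *\<^sub>R partial i f (t *\<^sub>R x))" for x :: plane and t :: real and h :: plane
  have cf: "continuous_on UNIV f" by (rule smooth_on_continuous[OF f])
  have cp: "continuous_on UNIV (partial i f)" for i by (rule smooth_on_continuous[OF smooth_on_partial[OF f]])
  have d: "((\<lambda>x. t ^ n *\<^sub>R f (t *\<^sub>R x)) has_derivative d x t) (at x)" for x t
  proof -
    have "((\<lambda>x. t *\<^sub>R x) has_derivative (\<lambda>h. t *\<^sub>R h)) (at x)"
      by (auto intro!: derivative_eq_intros)
    from has_derivative_compose[OF this has_derivative_partials[OF smooth_on_differentiable_at[OF f]]]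
    have "((\<lambda>x. f (t *\<^sub>R x)) has_derivative (\<lambda>h. \<Sum>i\<in>UNIV. (t * h $ i) *\<^sub>R partial i f (t *\<^sub>R x))) (at x)"
      by simp
    then show ?thesis
      unfolding d_def by (rule has_derivative_scaleR_right)
  qed
  define D where "D x t = Blinfun (d x t)" for x t
  have D: "blinfun_apply (D x t) = d x t" for x t
    unfolding D_def by (rule bounded_linear_Blinfun_apply[OF has_derivative_bounded_linear[OF d]])
  have contD: "continuous_on (UNIV \<times> cbox 0 1) (\<lambda>(x, t). D x t)"
  proof (rule continuous_on_blinfun_componentwise)
    fix h :: plane
    show "continuous_on (UNIV \<times> cbox 0 1) (\<lambda>p. blinfun_apply (case p of (x, t) \<Rightarrow> D x t) h)"
      unfolding case_prod_unfold D d_def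
      by (intro continuous_intros continuous_on_compose2[OF cp]) auto
  qed
  have L: "(ray_mean n f has_derivative integral (cbox 0 1) (D x)) (at x)" for x
    unfolding ray_mean_def[abs_def]
  proof (rule leibniz_rule)
    show "((\<lambda>x. t ^ n *\<^sub>R f (t *\<^sub>R x)) has_derivative blinfun_apply (D x t)) (at x)" for x t
      unfolding D by (rule d)
    show "(\<lambda>t. t ^ n *\<^sub>R f (t *\<^sub>R x)) integrable_on cbox 0 1" for x
      by (intro integrable_continuous continuous_intros continuous_on_compose2[OF cf]) auto
  qed (use contD in auto)
  show "ray_mean n f differentiable at x" using L differentiable_def by blast
  have "continuous_on (cbox 0 1) (\<lambda>t. case (x, t) of (x, t) \<Rightarrow> D x t)"
    by (rule continuous_on_compose2[OF contD, of _ "\<lambda>t. (x, t)"]) (auto intro!: continuous_intros)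
  then have "continuous_on (cbox 0 1) (D x)" by simp
  then have "D x integrable_on cbox 0 1" by (rule integrable_continuous)
  then have "blinfun_apply (integral (cbox 0 1) (D x)) (axis i 1) = integral (cbox 0 1) (\<lambda>t. d x t (axis i 1))"
    by (simp add: blinfun_apply_integral D)
  moreover have "d x t (axis i 1) = t ^ Suc n *\<^sub>R partial i f (t *\<^sub>R x)" for t
  proof -
    have "(\<Sum>j\<in>UNIV. (t * axis i 1 $ j) *\<^sub>R partial j f (t *\<^sub>R x)) =
        (\<Sum>j\<in>UNIV. if j = i then t *\<^sub>R partial j f (t *\<^sub>R x) else 0)"
      by (rule sum.cong) (auto simp: axis_def)
    then show ?thesis by (simp add: d_def mult.commute)
  qed
  ultimately show "partial i (ray_mean n f) x = ray_mean (Suc n) (partial i f) x"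
    using partial_eq[OF L] by (simp add: ray_mean_def)
qed

lemma smooth_on_ray_mean:
  fixes f :: "plane \<Rightarrow> 'v::euclidean_space"
  assumes "smooth_on UNIV f"
  shows "smooth_on UNIV (ray_mean n f)"
proof -
  have d: "ray_mean n f differentiable_on UNIV" if "smooth_on UNIV f" for n and f :: "plane \<Rightarrow> 'v"
    using ray_mean_deriv(1)[OF that] by (simp add: differentiable_on_def)
  have "smooth_upto k UNIV (ray_mean n f)" if "smooth_on UNIV f" for k n and f :: "plane \<Rightarrow> 'v"
    using that
  proof (induction k arbitrary: n f)
    case 0
    then show ?case using d by (simp add: smooth_upto_0)
  next
    case (Suc k)
    have "partial i (ray_mean n f) = ray_mean (Suc n) (partial i f)" for i
      using ray_mean_deriv(2)[OF Suc.prems] by blast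
    then show ?case
      using d[OF Suc.prems] Suc.IH[OF smooth_on_partial[OF Suc.prems]] by (simp add: smooth_upto_Suc)
  qed
  then show ?thesis using assms by (simp add: smooth_on_iff_upto)
qed

text \<open>Integrate the derivative of \<open>g\<close> along the ray from the origin to \<open>x\<close>. The coefficients of the
  coordinates are smooth by \<open>smooth_on_ray_mean\<close>, so the formula can be iterated.\<close>

lemma hadamard_lemma:
  fixes g :: "plane \<Rightarrow> 'v::euclidean_space"
  assumes g: "smooth_on UNIV g"
  shows "g x = g 0 + x $ 1 *\<^sub>R ray_mean 0 (partial 1 g) x + x $ 2 *\<^sub>R ray_mean 0 (partial 2 g) x"
proof -
  have cp: "continuous_on UNIV (partial i g)" for i by (rule smooth_on_continuous[OF smooth_on_partial[OF g]])
  have int: "((\<lambda>t. partial i g (t *\<^sub>R x)) has_integral ray_mean 0 (partial i g) x) {0..1}" for i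
  proof -
    have "(\<lambda>t. partial i g (t *\<^sub>R x)) integrable_on {0..1}"
      by (intro integrable_continuous_real continuous_on_compose2[OF cp] continuous_intros) auto
    then show ?thesis by (simp add: ray_mean_def has_integral_integral)
  qed
  have 1: "((\<lambda>t. x $ 1 *\<^sub>R partial 1 g (t *\<^sub>R x) + x $ 2 *\<^sub>R partial 2 g (t *\<^sub>R x)) has_integral
      (x $ 1 *\<^sub>R ray_mean 0 (partial 1 g) x + x $ 2 *\<^sub>R ray_mean 0 (partial 2 g) x)) {0..1}"
    by (intro has_integral_add has_integral_cmul int)
  have "((\<lambda>t. x $ 1 *\<^sub>R partial 1 g (t *\<^sub>R x) + x $ 2 *\<^sub>R partial 2 g (t *\<^sub>R x)) has_integral
      g (1 *\<^sub>R x) - g (0 *\<^sub>R x)) {0..1}"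
  proof (rule fundamental_theorem_of_calculus)
    fix t :: real
    have "((\<lambda>t. t *\<^sub>R x) has_derivative (\<lambda>h. h *\<^sub>R x)) (at t within {0..1})"
      by (auto intro!: derivative_eq_intros)
    from has_derivative_compose[OF this has_derivative_partials[OF smooth_on_differentiable_at[OF g]]]
    show "((\<lambda>t. g (t *\<^sub>R x)) has_vector_derivative x $ 1 *\<^sub>R partial 1 g (t *\<^sub>R x) + x $ 2 *\<^sub>R partial 2 g (t *\<^sub>R x)) (at t within {0..1})"
      by (simp add: has_vector_derivative_def sum_2 scaleR_add_right)
  qed simp
  from has_integral_unique[OF 1 this] show ?thesis by (simp add: algebra_simps)
qed

section \<open>Functionals supported at the origin\<close>

lemma test_fun_vanishing_near_0:
  assumes "\<phi> \<in> test_funs \<Omega>" "\<delta> > 0" "\<And>x. norm x < \<delta> \<Longrightarrow> \<phi> x = 0"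
  shows "\<phi> \<in> test_funs (\<Omega> - {0})"
proof (rule test_funsI)
  show "compact (supp \<phi> - ball 0 \<delta>)"
    using test_funsD(2)[OF assms(1)] by (simp add: compact_diff)
  show "supp \<phi> - ball 0 \<delta> \<subseteq> \<Omega> - {0}"
    using test_funsD(3)[OF assms(1)] assms(2) by auto
  show "\<phi> x = 0" if "x \<notin> supp \<phi> - ball 0 \<delta>" for x
    using that not_in_supp[of x \<phi>] assms(3)[of x] by auto
qed (rule test_funsD(1)[OF assms(1)])

definition homogeneous :: "nat \<Rightarrow> (plane \<Rightarrow> real) \<Rightarrow> bool" where
  "homogeneous m p \<longleftrightarrow> smooth_on UNIV p \<and> (\<forall>l x. l > 0 \<longrightarrow> p (l *\<^sub>R x) = l ^ m * p x)"

lemma homogeneous_times_coordinate: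
  assumes "homogeneous m p"
  shows "homogeneous (Suc m) (\<lambda>x. p x * x $ i)"
  using assms smooth_on_mult[OF open_UNIV _ smooth_on_bounded_linear[OF bounded_linear_vec_nth], of p]
  by (auto simp: homogeneous_def)

lemma homogeneous_coordinate: "homogeneous 1 (\<lambda>x. x $ i)"
  using smooth_on_bounded_linear[OF bounded_linear_vec_nth] by (auto simp: homogeneous_def)

lemma homogeneous_dilate:
  assumes "homogeneous m p" "l > 0"
  shows "p (x /\<^sub>R l) = p x / l ^ m"
  using assms by (simp add: homogeneous_def power_inverse field_simps)

text \<open>The scaling condition with exponent below \<open>3\<close> says that the degree of \<open>D\<close> is below \<open>1\<close>, so no
  derivative of \<open>\<delta>\<close> can occur in \<open>D\<close>, and \<open>const\<close> rules out \<open>\<delta>\<close> itself. The proof shows that \<open>D\<close> kills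
  \<open>\<eta> p g\<close> for every homogeneous \<open>p\<close> of degree \<open>m \<ge> 1\<close> and every smooth \<open>g\<close>, by downward induction on
  \<open>m\<close>, starting above the order \<open>N\<close> of \<open>D\<close>.\<close>

lemma point_supported_vanishes:
  fixes D :: "'v::euclidean_space functional"
  assumes D: "moderate \<Omega> D" and off: "\<And>\<phi>. \<phi> \<in> test_funs (\<Omega> - {0}) \<Longrightarrow> D \<phi> = 0"
    and R: "0 < R" "R < r" "ball 0 r \<subseteq> \<Omega>"
    and scal: "k < 3" "\<And>\<phi>. \<phi> \<in> test_funs (ball 0 r) \<Longrightarrow> ((\<lambda>l. l powr k * D (scaled l \<phi>)) \<longlongrightarrow> 0) (at_right 0)"
    and const: "\<And>v. D (\<lambda>x. cutoff 0 (R / 2) R x *\<^sub>R v) = 0"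
    and \<psi>: "\<psi> \<in> test_funs \<Omega>"
  shows "D \<psi> = 0"
proof -
  define \<eta> where "\<eta> = cutoff 0 (R / 2) R"
  have \<eta>1: "\<eta> x = 1" if "norm x \<le> R / 2" for x
    using R that by (auto simp: \<eta>_def intro: cutoff_inside)
  have \<eta>0: "\<eta> x = 0" if "R \<le> norm x" for x
    using R that by (auto simp: \<eta>_def intro: cutoff_outside)
  have sub: "cball 0 R \<subseteq> ball (0::plane) r" "cball 0 R \<subseteq> \<Omega>" using R by auto
  have \<eta>t: "(\<lambda>x. \<eta> x *\<^sub>R g x) \<in> test_funs (ball 0 r)" if "smooth_on UNIV g" for g :: "plane \<Rightarrow> 'v"
    by (rule test_funsI[OF _ compact_cball sub(1)])
      (use \<eta>0 smooth_on_scaleR[OF open_UNIV smooth_on_cutoff that] in \<open>auto simp: \<eta>_def\<close>)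
  have \<eta>_test: "\<eta> \<in> test_funs UNIV"
    by (rule test_funsI[OF _ compact_cball[of 0 R]]) (use \<eta>0 smooth_on_cutoff in \<open>auto simp: \<eta>_def\<close>)
  \<comment> \<open>Only the germ of a test function at the origin matters.\<close>
  have germ: "D \<phi> = D \<psi>" if "\<phi> \<in> test_funs \<Omega>" "\<psi> \<in> test_funs \<Omega>" "\<delta> > 0" "\<And>x. norm x < \<delta> \<Longrightarrow> \<phi> x = \<psi> x" for \<phi> \<psi> \<delta>
  proof -
    have "(\<lambda>x. \<phi> x - \<psi> x) \<in> test_funs (\<Omega> - {0})"
      by (rule test_fun_vanishing_near_0[OF test_funs_diff[OF that(1,2)] that(3)]) (simp add: that(4))
    from off[OF this] show ?thesis using moderate_diff[OF D that(1,2)] by simp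
  qed
  have mono: "\<phi> \<in> test_funs \<Omega>" if "\<phi> \<in> test_funs (ball 0 r)" for \<phi> :: "plane \<Rightarrow> 'v"
    by (rule test_funs_mono[OF that R(3)])
  \<comment> \<open>Near the origin the rescaling of \<open>\<eta> p v\<close> is \<open>l ^ (- 2 - m)\<close> times
    \<open>\<eta> p v\<close>; if \<open>D\<close> were not zero on it, \<open>l powr k\<close> would have to
    compensate this factor, but \<open>k < 2 + m\<close>.\<close>
  have hom: "D (\<lambda>x. \<eta> x *\<^sub>R p x *\<^sub>R v) = 0" if p: "homogeneous m p" "1 \<le> m" for m p v
  proof -
    define \<phi> where "\<phi> x = \<eta> x *\<^sub>R p x *\<^sub>R v" for x
    have sp: "smooth_on UNIV (\<lambda>x. p x *\<^sub>R v)"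
      using p(1) by (intro smooth_on_linear[OF open_UNIV bounded_linear_scaleR_left]) (auto simp: homogeneous_def)
    have \<phi>: "\<phi> \<in> test_funs (ball 0 r)" unfolding \<phi>_def[abs_def] by (rule \<eta>t[OF sp])
    have Ds: "D (scaled l \<phi>) = l powr (- 2 - real m) * D \<phi>" if l: "0 < l" "l < 1" for l
    proof -
      have st: "scaled l \<phi> \<in> test_funs \<Omega>"
      proof (rule test_funsI[OF _ compact_cball sub(2)])
        show "smooth_on UNIV (scaled l \<phi>)"
          unfolding scaled_def[abs_def]
          by (rule smooth_on_linear[OF open_UNIV bounded_linear_scaleR_right smooth_on_dilate[OF test_funsD(1)[OF \<phi>]]])
        fix x :: plane assume "x \<notin> cball 0 R"
        then have "R \<le> norm (x /\<^sub>R l)" using l R mult_mono[of l 1 R "norm x"] by (simp add: field_simps)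
        then show "scaled l \<phi> x = 0" by (simp add: scaled_def \<phi>_def \<eta>0)
      qed
      have "D (scaled l \<phi>) = D (\<lambda>x. (1 / l ^ (2 + m)) *\<^sub>R \<phi> x)"
      proof (rule germ[OF st test_funs_scale[OF mono[OF \<phi>]]])
        show "l * R / 2 > 0" using l R by simp
        fix x :: plane assume x: "norm x < l * R / 2"
        then have "\<eta> (x /\<^sub>R l) = 1" using l by (intro \<eta>1) (simp add: field_simps)
        moreover have "l * R \<le> R" using l R by simp
        then have "\<eta> x = 1" using x by (intro \<eta>1) linarith
        ultimately show "scaled l \<phi> x = (1 / l ^ (2 + m)) *\<^sub>R \<phi> x"
          using homogeneous_dilate[OF p(1) l(1)] l by (simp add: scaled_def \<phi>_def power_add power2_eq_square)
      qed
      also have "\<dots> = (1 / l ^ (2 + m)) * D \<phi>" by (rule moderate_scale[OF D mono[OF \<phi>]])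
      also have "1 / l ^ (2 + m) = l powr (- 2 - real m)"
      proof -
        have "- 2 - real m = - real (2 + m)" by simp
        then show ?thesis by (simp only: powr_minus powr_realpow[OF l(1)] inverse_eq_divide)
      qed
      finally show ?thesis .
    qed
    have "\<bar>D \<phi>\<bar> \<le> 0"
    proof (rule tendsto_lowerbound)
      show "((\<lambda>l. \<bar>l powr k * D (scaled l \<phi>)\<bar>) \<longlongrightarrow> 0) (at_right 0)"
        using tendsto_rabs_zero[OF scal(2)[OF \<phi>]] .
      have "\<bar>D \<phi>\<bar> \<le> \<bar>l powr k * D (scaled l \<phi>)\<bar>" if l: "0 < l" "l < 1" for l
      proof -
        have "l powr 0 \<le> l powr (k - 2 - real m)"
          using l p(2) scal(1) by (intro powr_mono') auto
        then have "1 \<le> l powr k * l powr (- 2 - real m)"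
          using l by (simp flip: powr_add) (simp add: algebra_simps)
        then have "1 * \<bar>D \<phi>\<bar> \<le> (l powr k * l powr (- 2 - real m)) * \<bar>D \<phi>\<bar>"
          by (rule mult_right_mono) simp
        then show ?thesis by (simp add: Ds[OF l] abs_mult mult.assoc)
      qed
      then show "\<forall>\<^sub>F l in at_right 0. \<bar>D \<phi>\<bar> \<le> \<bar>l powr k * D (scaled l \<phi>)\<bar>"
        by (auto simp: eventually_at_right_field intro!: exI[of _ 1])
    qed simp
    then show ?thesis by (simp add: \<phi>_def[abs_def])
  qed
  obtain N where N: "\<forall>F. tame F \<and> (\<forall>l. 0 < l \<and> l < 1 \<longrightarrow> supp (F l) \<subseteq> cball 0 R) \<longrightarrow>
           (\<exists>C. \<forall>l. 0 < l \<and> l < 1 \<longrightarrow> \<bar>D (F l)\<bar> \<le> C / l ^ N)"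
    using moderate_bound[OF D compact_cball sub(2)] by blast
  have pg_smooth: "smooth_on UNIV (\<lambda>x. p x *\<^sub>R g x)" if "homogeneous m p" "smooth_on UNIV g" for m p and g :: "plane \<Rightarrow> 'v"
    using that by (intro smooth_on_scaleR[OF open_UNIV]) (auto simp: homogeneous_def)
  \<comment> \<open>The germ is unchanged if a cutoff to radius \<open>l R\<close> is inserted. Then the factor
    \<open>p\<close> contributes \<open>l ^ m\<close>, which beats the growth \<open>1 / l ^ N\<close> of
    \<open>D\<close> on the resulting tame family.\<close>
  have high: "D (\<lambda>x. \<eta> x *\<^sub>R p x *\<^sub>R g x) = 0"
    if p: "homogeneous m p" "N < m" and g: "smooth_on UNIV g" for m p g
  proof -
    define \<phi> where "\<phi> x = \<eta> x *\<^sub>R p x *\<^sub>R g x" for x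
    have \<phi>: "\<phi> \<in> test_funs (ball 0 r)" unfolding \<phi>_def[abs_def] by (rule \<eta>t[OF pg_smooth[OF p(1) g]])
    define F where "F l x = (\<eta> (x /\<^sub>R l) * p (x /\<^sub>R l)) *\<^sub>R (\<eta> x *\<^sub>R g x)" for l x
    have "(\<lambda>x. p x *\<^sub>R \<eta> x) \<in> test_funs UNIV"
      using p(1) by (intro test_funs_scaleR[OF open_UNIV _ \<eta>_test]) (auto simp: homogeneous_def)
    from tame_dilate[OF this] have t1: "tame (\<lambda>l x. \<eta> (x /\<^sub>R l) * p (x /\<^sub>R l))"
      by (simp add: mult.commute)
    have tF: "tame F"
      unfolding F_def[abs_def] by (rule tame_scaleR[OF t1 tame_test_fun[OF \<eta>t[OF g]]])
    have sF: "supp (F l) \<subseteq> cball 0 R" for l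
      by (rule supp_subsetI) (auto simp: F_def \<eta>0)
    obtain C where C: "\<forall>l. 0 < l \<and> l < 1 \<longrightarrow> \<bar>D (F l)\<bar> \<le> C / l ^ N"
      using N tF sF by blast
    have bound: "\<bar>D \<phi>\<bar> \<le> \<bar>C\<bar> * l" if l: "0 < l" "l < 1" for l
    proof -
      have "D (F l) = D (\<lambda>x. (1 / l ^ m) *\<^sub>R \<phi> x)"
      proof (rule germ[OF tame_test[OF tF compact_cball sub(2) sF l] test_funs_scale[OF mono[OF \<phi>]]])
        show "l * R / 2 > 0" using l R by simp
        fix x :: plane assume x: "norm x < l * R / 2"
        then have "\<eta> (x /\<^sub>R l) = 1" using l by (intro \<eta>1) (simp add: field_simps)
        then show "F l x = (1 / l ^ m) *\<^sub>R \<phi> x"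
          using homogeneous_dilate[OF p(1) l(1)] l by (simp add: F_def \<phi>_def mult.commute)
      qed
      also have "\<dots> = (1 / l ^ m) * D \<phi>" by (rule moderate_scale[OF D mono[OF \<phi>]])
      finally have "\<bar>D \<phi>\<bar> / l ^ m \<le> C / l ^ N" using C l by (auto simp: abs_mult)
      then have "\<bar>D \<phi>\<bar> \<le> C / l ^ N * l ^ m" using l by (simp add: field_simps)
      also have "\<dots> = C * l ^ (m - N)" using l p(2) by (simp add: power_diff)
      also have "\<dots> \<le> \<bar>C\<bar> * l ^ 1"
        using l p(2) by (intro mult_mono power_decreasing) auto
      finally show ?thesis by simp
    qed
    have "\<bar>D \<phi>\<bar> \<le> 0"
    proof (rule tendsto_lowerbound)
      show "((\<lambda>l. \<bar>C\<bar> * l) \<longlongrightarrow> 0) (at_right 0)" by (auto intro!: tendsto_eq_intros)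
      show "\<forall>\<^sub>F l in at_right 0. \<bar>D \<phi>\<bar> \<le> \<bar>C\<bar> * l"
        using bound by (auto simp: eventually_at_right_field intro!: exI[of _ 1])
    qed simp
    then show ?thesis by (simp add: \<phi>_def[abs_def])
  qed
  \<comment> \<open>Hadamard's lemma trades a smooth factor for its value at the origin and terms of higher
    degree.\<close>
  have split: "D (\<lambda>x. \<eta> x *\<^sub>R p x *\<^sub>R g x) = D (\<lambda>x. \<eta> x *\<^sub>R p x *\<^sub>R g 0) +
      D (\<lambda>x. \<eta> x *\<^sub>R (p x * x $ 1) *\<^sub>R ray_mean 0 (partial 1 g) x) +
      D (\<lambda>x. \<eta> x *\<^sub>R (p x * x $ 2) *\<^sub>R ray_mean 0 (partial 2 g) x)"
    if p: "homogeneous m p" and g: "smooth_on UNIV g" for m p g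
  proof -
    have t0: "(\<lambda>x. \<eta> x *\<^sub>R p x *\<^sub>R g 0) \<in> test_funs \<Omega>"
      by (rule mono[OF \<eta>t[OF pg_smooth[OF p smooth_on_const]]])
    have ti: "(\<lambda>x. \<eta> x *\<^sub>R (p x * x $ i) *\<^sub>R ray_mean 0 (partial i g) x) \<in> test_funs \<Omega>" for i
      by (rule mono[OF \<eta>t[OF pg_smooth[OF homogeneous_times_coordinate[OF p] smooth_on_ray_mean[OF smooth_on_partial[OF g]]]]])
    have "(\<lambda>x. \<eta> x *\<^sub>R p x *\<^sub>R g x) = (\<lambda>x. \<eta> x *\<^sub>R p x *\<^sub>R g 0 +
      \<eta> x *\<^sub>R (p x * x $ 1) *\<^sub>R ray_mean 0 (partial 1 g) x +
      \<eta> x *\<^sub>R (p x * x $ 2) *\<^sub>R ray_mean 0 (partial 2 g) x)"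
      by (rule ext, subst hadamard_lemma[OF g]) (simp add: scaleR_add_right)
    then show ?thesis
      using moderate_add[OF D test_funs_add[OF t0 ti] ti] moderate_add[OF D t0 ti] by simp
  qed
  have all: "\<forall>m p g. homogeneous m p \<and> 1 \<le> m \<and> N < m + j \<and> smooth_on UNIV g \<longrightarrow>
      D (\<lambda>x. \<eta> x *\<^sub>R p x *\<^sub>R g x) = 0" for j
  proof (induction j)
    case 0
    show ?case
      by (intro allI impI, elim conjE) (rule high, assumption, simp, assumption)
  next
    case (Suc j)
    show ?case
    proof (intro allI impI, elim conjE)
      fix m p and g :: "plane \<Rightarrow> 'v"
      assume a: "homogeneous m p" "1 \<le> m" "N < m + Suc j" "smooth_on UNIV g"
      have "D (\<lambda>x. \<eta> x *\<^sub>R (p x * x $ i) *\<^sub>R ray_mean 0 (partial i g) x) = 0" for i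
        using Suc.IH[rule_format, of "Suc m" "\<lambda>x. p x * x $ i" "ray_mean 0 (partial i g)"]
          homogeneous_times_coordinate[OF a(1)] smooth_on_ray_mean[OF smooth_on_partial[OF a(4)]] a(3)
        by simp
      then show "D (\<lambda>x. \<eta> x *\<^sub>R p x *\<^sub>R g x) = 0"
        using split[OF a(1,4)] hom[OF a(1,2)] by simp
    qed
  qed
  have one: "homogeneous 0 (\<lambda>x. 1)" by (simp add: homogeneous_def smooth_on_const)
  have g: "smooth_on UNIV \<psi>" by (rule test_funsD(1)[OF \<psi>])
  have "D \<psi> = D (\<lambda>x. \<eta> x *\<^sub>R (1::real) *\<^sub>R \<psi> x)"
    using R \<eta>1 by (intro germ[OF \<psi> mono[OF \<eta>t[OF pg_smooth[OF one g]]], of "R / 2"]) auto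
  also have "\<dots> = 0"
  proof -
    have "D (\<lambda>x. \<eta> x *\<^sub>R (1 * x $ i) *\<^sub>R ray_mean 0 (partial i \<psi>) x) = 0" for i
      using all[of N, rule_format, of 1 "\<lambda>x. x $ i" "ray_mean 0 (partial i \<psi>)"]
        homogeneous_coordinate smooth_on_ray_mean[OF smooth_on_partial[OF g]] by simp
    then show ?thesis
      using split[OF one g] const[folded \<eta>_def] by simp
  qed
  finally show ?thesis .
qed

section \<open>The scaling degree\<close>

text \<open>The support is compact, so it stays away from the boundary of the open ball. A closed ball that
  contains it also contains the supports of the functions rescaled by \<open>l < 1\<close>.\<close>

lemma test_funs_ball_radius:
  fixes \<phi> :: "plane \<Rightarrow> 'v::euclidean_space"
  assumes "\<phi> \<in> test_funs (ball 0 r)" "0 < r"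
  obtains \<rho> where "0 \<le> \<rho>" "\<rho> < r" "\<And>x. \<rho> < norm x \<Longrightarrow> \<phi> x = 0"
proof (cases "supp \<phi> = {}")
  case True
  then have "\<phi> x = 0" for x using not_in_supp[of x \<phi>] by blast
  then show ?thesis using that[of 0] assms(2) by simp
next
  case False
  have "continuous_on (supp \<phi>) norm" by (intro continuous_intros)
  then obtain y where y: "y \<in> supp \<phi>" "\<And>x. x \<in> supp \<phi> \<Longrightarrow> norm x \<le> norm y"
    using continuous_attains_sup[OF test_funsD(2)[OF assms(1)] False] by blast
  have "norm y < r" using y(1) test_funsD(3)[OF assms(1)] by auto
  moreover have "\<phi> x = 0" if "norm y < norm x" for x
    using y(2)[of x] that not_in_supp[of x \<phi>] by fastforce
  ultimately show ?thesis using that[of "norm y"] by simp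
qed

lemma scaled_test_fun:
  fixes \<phi> :: "plane \<Rightarrow> 'v::euclidean_space"
  assumes \<phi>: "\<phi> \<in> test_funs (ball 0 r)" and l: "0 < l" "l < 1" and r: "0 < r"
  shows "scaled l \<phi> \<in> test_funs (ball 0 r)"
proof -
  obtain \<rho> where \<rho>: "0 \<le> \<rho>" "\<rho> < r" "\<And>x. \<rho> < norm x \<Longrightarrow> \<phi> x = 0"
    using test_funs_ball_radius[OF \<phi> r] by blast
  show ?thesis
  proof (rule test_funsI[OF _ compact_cball[of 0 \<rho>]])
    show "smooth_on UNIV (scaled l \<phi>)"
      unfolding scaled_def[abs_def]
      by (rule smooth_on_linear[OF open_UNIV bounded_linear_scaleR_right smooth_on_dilate[OF test_funsD(1)[OF \<phi>]]])
    show "cball 0 \<rho> \<subseteq> ball 0 r" using \<rho> by auto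
    fix x :: plane assume "x \<notin> cball 0 \<rho>"
    moreover have "l * \<rho> \<le> \<rho>" using l \<rho> by (simp add: mult_left_le_one_le)
    ultimately have "\<rho> < norm (x /\<^sub>R l)" using l by (simp add: field_simps)
    then show "scaled l \<phi> x = 0" by (simp add: scaled_def \<rho>(3))
  qed
qed

lemma grad_scaled:
  assumes \<phi>: "\<phi> \<in> test_funs U" and l: "0 < l"
  shows "grad (scaled l \<phi>) = (\<lambda>x. (1 / l) *\<^sub>R scaled l (grad \<phi>) x)"
proof
  fix x :: plane
  have sm: "smooth_on UNIV \<phi>" by (rule test_funsD(1)[OF \<phi>])
  have sd: "smooth_on UNIV (\<lambda>x. \<phi> (x /\<^sub>R l))" by (rule smooth_on_dilate[OF sm])
  have d: "(\<lambda>x. \<phi> (x /\<^sub>R l)) differentiable at x" "\<phi> differentiable at (x /\<^sub>R l)"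
    using smooth_on_differentiable_at[OF sd] smooth_on_differentiable_at[OF sm] by auto
  have ds: "scaled l \<phi> differentiable at x"
    unfolding scaled_def[abs_def]
    using smooth_on_differentiable_at[OF smooth_on_linear[OF open_UNIV bounded_linear_scaleR_right sd]] by auto
  have "partial i (scaled l \<phi>) x = (1 / l\<^sup>2) *\<^sub>R (1 / l) *\<^sub>R partial i \<phi> (x /\<^sub>R l)" for i
    using partial_linear[OF bounded_linear_scaleR_right d(1)] foldr_partial_dilate[OF sm, of "[i]" "inverse l"]
    by (simp add: scaled_def[abs_def] inverse_eq_divide)
  then show "grad (scaled l \<phi>) x = (1 / l) *\<^sub>R scaled l (grad \<phi>) x"
    unfolding grad_eq[OF ds] scaled_def grad_eq[OF d(2)]
    by (simp add: linear_simps[OF bounded_linear_grad_col] scaleR_add_right mult.commute)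
qed

definition admissible :: "real \<Rightarrow> 'v::euclidean_space functional \<Rightarrow> real \<Rightarrow> bool" where
  "admissible r T k \<longleftrightarrow>
     (\<forall>\<phi>\<in>test_funs (ball 0 r). ((\<lambda>l. l powr k * T (scaled l \<phi>)) \<longlongrightarrow> 0) (at_right 0))"

lemma scaling_degree_admissible: "scaling_degree r T = Inf {ereal k | k. admissible r T k}"
  by (simp add: scaling_degree_def admissible_def)

lemma eventually_at_right_0_lt_1: "(\<And>l. 0 < l \<Longrightarrow> l < 1 \<Longrightarrow> P l) \<Longrightarrow> eventually P (at_right (0::real))"
  by (auto simp: eventually_at_right_field intro!: exI[of _ 1])

lemma admissible_cong:
  fixes T S :: "'v::euclidean_space functional"
  assumes "admissible r T k" "0 < r" "\<And>\<phi>. \<phi> \<in> test_funs (ball 0 r) \<Longrightarrow> T \<phi> = S \<phi>"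
  shows "admissible r S k"
  unfolding admissible_def
proof
  fix \<phi> :: "plane \<Rightarrow> 'v" assume \<phi>: "\<phi> \<in> test_funs (ball 0 r)"
  have "((\<lambda>l. l powr k * T (scaled l \<phi>)) \<longlongrightarrow> 0) (at_right 0)"
    using assms(1) \<phi> by (simp add: admissible_def)
  then show "((\<lambda>l. l powr k * S (scaled l \<phi>)) \<longlongrightarrow> 0) (at_right 0)"
    by (rule Lim_transform_eventually)
      (auto intro!: eventually_at_right_0_lt_1 assms(3) scaled_test_fun \<phi> assms(2))
qed

lemma admissible_mono:
  fixes T :: "'v::euclidean_space functional"
  assumes "admissible r T k" "k \<le> k'"
  shows "admissible r T k'"
  unfolding admissible_def
proof
  fix \<phi> :: "plane \<Rightarrow> 'v" assume "\<phi> \<in> test_funs (ball 0 r)"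
  then have lim: "((\<lambda>l. l powr k * T (scaled l \<phi>)) \<longlongrightarrow> 0) (at_right 0)"
    using assms(1) by (simp add: admissible_def)
  show "((\<lambda>l. l powr k' * T (scaled l \<phi>)) \<longlongrightarrow> 0) (at_right 0)"
  proof (rule Lim_null_comparison[OF eventually_at_right_0_lt_1 tendsto_rabs_zero[OF lim]])
    fix l :: real assume l: "0 < l" "l < 1"
    have "l powr k' \<le> l powr k" using l assms(2) by (intro powr_mono') auto
    then show "norm (l powr k' * T (scaled l \<phi>)) \<le> \<bar>l powr k * T (scaled l \<phi>)\<bar>"
      by (simp add: abs_mult mult_right_mono)
  qed
qed

lemma admissible_add:
  fixes T S :: "'v::euclidean_space functional"
  assumes "admissible r T k" "admissible r S k"
  shows "admissible r (\<lambda>\<phi>. T \<phi> + S \<phi>) k"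
  unfolding admissible_def
proof
  fix \<phi> :: "plane \<Rightarrow> 'v" assume "\<phi> \<in> test_funs (ball 0 r)"
  then have "((\<lambda>l. l powr k * T (scaled l \<phi>) + l powr k * S (scaled l \<phi>)) \<longlongrightarrow> 0 + 0) (at_right 0)"
    using assms by (intro tendsto_add) (auto simp: admissible_def)
  then show "((\<lambda>l. l powr k * (T (scaled l \<phi>) + S (scaled l \<phi>))) \<longlongrightarrow> 0) (at_right 0)"
    by (simp add: distrib_left)
qed

lemma admissible_uminus: "admissible r T k \<Longrightarrow> admissible r (\<lambda>\<phi>. - T \<phi>) k"
  by (auto simp: admissible_def intro: tendsto_minus[where a = "0::real", simplified])

lemma admissible_Div:
  assumes \<sigma>: "moderate \<Omega> \<sigma>" and r: "0 < r" "ball 0 r \<subseteq> \<Omega>" and adm: "admissible r \<sigma> k"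
  shows "admissible r (Div \<sigma>) (k + 1)"
  unfolding admissible_def
proof
  fix \<phi> :: "plane \<Rightarrow> real^2" assume \<phi>: "\<phi> \<in> test_funs (ball 0 r)"
  have g: "grad \<phi> \<in> test_funs (ball 0 r)" by (rule grad_test_funs[OF \<phi>])
  have "((\<lambda>l. - (l powr k * \<sigma> (scaled l (grad \<phi>)))) \<longlongrightarrow> - 0) (at_right 0)"
    using adm g by (intro tendsto_minus) (auto simp: admissible_def)
  then show "((\<lambda>l. l powr (k + 1) * Div \<sigma> (scaled l \<phi>)) \<longlongrightarrow> 0) (at_right 0)"
  proof (rule Lim_transform_eventually[OF _ eventually_at_right_0_lt_1, THEN tendsto_eq_rhs])
    fix l :: real assume l: "0 < l" "l < 1"
    have "\<sigma> (grad (scaled l \<phi>)) = (1 / l) * \<sigma> (scaled l (grad \<phi>))"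
      unfolding grad_scaled[OF \<phi> l(1)]
      by (rule moderate_scale[OF \<sigma> test_funs_mono[OF scaled_test_fun[OF g l r(1)] r(2)]])
    then show "- (l powr k * \<sigma> (scaled l (grad \<phi>))) = l powr (k + 1) * Div \<sigma> (scaled l \<phi>)"
      using l by (simp add: Div_def powr_add)
  qed simp
qed

text \<open>The supports of the test functions may come arbitrarily close to the boundary of the ball, where the
  order of \<open>T\<close> need not be bounded. The additional cutoff \<open>\<eta>\<close> keeps the whole rescaled family in one
  compact set, and it changes nothing once \<open>l < 1 / 4\<close>.\<close>

lemma moderate_has_admissible_exponent:
  fixes T :: "'v::euclidean_space functional"
  assumes T: "moderate \<Omega> T" and r: "0 < r" "ball 0 r \<subseteq> \<Omega>"
  shows "\<exists>k. admissible r T k"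
proof -
  have K: "cball 0 (r / 2) \<subseteq> \<Omega>"
  proof -
    have "cball (0::plane) (r / 2) \<subseteq> ball 0 r" using r(1) by auto
    then show ?thesis using r(2) by blast
  qed
  obtain N where N: "\<forall>F. tame F \<and> (\<forall>l. 0 < l \<and> l < 1 \<longrightarrow> supp (F l) \<subseteq> cball 0 (r / 2)) \<longrightarrow>
           (\<exists>C. \<forall>l. 0 < l \<and> l < 1 \<longrightarrow> \<bar>T (F l)\<bar> \<le> C / l ^ N)"
    using moderate_bound[OF T compact_cball K] by blast
  define \<eta> where "\<eta> = cutoff 0 (r / 4) (r / 2)"
  have \<eta>: "\<eta> \<in> test_funs UNIV"
    by (rule test_funsI[OF _ compact_cball[of 0 "r / 2"]])
      (use cutoff_outside[of "r / 4" "r / 2" 0] r smooth_on_cutoff in \<open>auto simp: \<eta>_def\<close>)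
  \<comment> \<open>Of the exponent \<open>N + 3\<close>, \<open>N\<close> absorbs the growth of \<open>T\<close>,
    \<open>2\<close> the factor \<open>1 / l\<^sup>2\<close> in \<open>scaled\<close>, and the last power of
    \<open>l\<close> gives the limit \<open>0\<close>.\<close>
  have "admissible r T (real (N + 3))"
    unfolding admissible_def
  proof
    fix \<phi> :: "plane \<Rightarrow> 'v" assume \<phi>: "\<phi> \<in> test_funs (ball 0 r)"
    define F where "F l x = \<eta> x *\<^sub>R \<phi> (x /\<^sub>R l)" for l x
    have tF: "tame F"
      unfolding F_def[abs_def] by (rule tame_scaleR[OF tame_test_fun[OF \<eta>] tame_dilate[OF \<phi>]])
    have sF: "supp (F l) \<subseteq> cball 0 (r / 2)" for l
      by (rule supp_subsetI)
        (use cutoff_outside[of "r / 4" "r / 2" 0] r in \<open>auto simp: F_def \<eta>_def\<close>)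
    obtain C where C: "\<forall>l. 0 < l \<and> l < 1 \<longrightarrow> \<bar>T (F l)\<bar> \<le> C / l ^ N"
      using N tF sF by blast
    have bound: "\<bar>l powr real (N + 3) * T (scaled l \<phi>)\<bar> \<le> C * l" if l: "0 < l" "l < 1 / 4" for l
    proof -
      have eq: "F l x = \<phi> (x /\<^sub>R l)" for x
      proof (cases "norm x \<le> r / 4")
        case True
        then show ?thesis using cutoff_inside[of "r / 4" "r / 2" 0 x] r by (simp add: F_def \<eta>_def)
      next
        case False
        have "l * r \<le> r / 4" using mult_right_mono[of l "1 / 4" r] l r by simp
        then have "l * r \<le> norm x" using False by linarith
        then have "x /\<^sub>R l \<notin> ball 0 r" using l by (simp add: field_simps)
        then show ?thesis using test_funs_zero_outside[OF \<phi>] by (simp add: F_def)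
      qed
      then have "scaled l \<phi> = (\<lambda>x. (1 / l\<^sup>2) *\<^sub>R F l x)"
        by (simp add: scaled_def fun_eq_iff)
      moreover have "F l \<in> test_funs \<Omega>"
        by (rule tame_test[OF tF compact_cball K sF]) (use l in auto)
      ultimately have "T (scaled l \<phi>) = (1 / l\<^sup>2) * T (F l)"
        using moderate_scale[OF T] by simp
      moreover have "l powr real (N + 3) = l ^ N * l\<^sup>2 * l"
        using l by (simp only: powr_realpow) (simp add: power_add power3_eq_cube power2_eq_square)
      ultimately have "\<bar>l powr real (N + 3) * T (scaled l \<phi>)\<bar> = \<bar>T (F l)\<bar> * l ^ N * l"
        using l by (simp add: abs_mult)
      also have "\<dots> \<le> (C / l ^ N) * l ^ N * l"
        using C l by (intro mult_right_mono) auto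
      finally show ?thesis using l by simp
    qed
    show "((\<lambda>l. l powr real (N + 3) * T (scaled l \<phi>)) \<longlongrightarrow> 0) (at_right 0)"
    proof (rule Lim_null_comparison)
      show "\<forall>\<^sub>F l in at_right 0. norm (l powr real (N + 3) * T (scaled l \<phi>)) \<le> C * l"
        using bound by (auto simp: eventually_at_right_field intro!: exI[of _ "1/4"])
      show "((\<lambda>l. C * l) \<longlongrightarrow> 0) (at_right 0)" by (auto intro!: tendsto_eq_intros)
    qed
  qed
  then show ?thesis by blast
qed

text \<open>Stated through all admissible exponents, because the infimum need not be attained and may be
  \<open>- \<infinity>\<close>.\<close>

lemma scaling_degree_le_add_1:
  assumes "\<And>k. admissible r S k \<Longrightarrow> admissible r T (k + 1)"
  shows "scaling_degree r T \<le> scaling_degree r S + 1"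
proof -
  have "scaling_degree r T - 1 \<le> scaling_degree r S"
    unfolding scaling_degree_admissible[of r S]
  proof (rule Inf_greatest)
    fix x assume "x \<in> {ereal k |k. admissible r S k}"
    then obtain k where k: "x = ereal k" "admissible r S k" by blast
    have "scaling_degree r T \<le> ereal (k + 1)"
      unfolding scaling_degree_admissible using assms[OF k(2)] by (intro Inf_lower) blast
    then show "scaling_degree r T - 1 \<le> x"
      unfolding k(1) by (cases "scaling_degree r T") (auto simp: one_ereal_def)
  qed
  then show ?thesis
    by (cases "scaling_degree r T"; cases "scaling_degree r S") (auto simp: one_ereal_def)
qed

section \<open>Locally constant test functions\<close>

lemma foldr_partial_const: "is \<noteq> [] \<Longrightarrow> foldr partial is (\<lambda>x. c) = (\<lambda>x. 0)"
proof (induction "is")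
  case (Cons i "is")
  then show ?case by (cases "is = []") (auto simp: partial_const)
qed simp

lemma mpartial_locally_const:
  assumes "0 < \<delta>" "\<And>x. norm x < \<delta> \<Longrightarrow> f x = c"
  shows "mpartial \<alpha> f 0 = (if \<alpha> = (0, 0) then c else 0)"
proof -
  have "mpartial \<alpha> f 0 = mpartial \<alpha> (\<lambda>x. c) 0"
    unfolding mpartial_eq_foldr
    by (rule foldr_partial_cong_open[of "ball 0 \<delta>"]) (use assms in auto)
  also have "\<dots> = (if \<alpha> = (0, 0) then c else 0)"
  proof (cases "\<alpha> = (0, 0)")
    case True
    then show ?thesis by (simp add: mpartial_eq_foldr)
  next
    case False
    then have "replicate (fst \<alpha>) (1::2) @ replicate (snd \<alpha>) 2 \<noteq> []" by (cases \<alpha>) auto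
    from foldr_partial_const[OF this, of c] show ?thesis
      using False by (simp add: mpartial_eq_foldr del: foldr_append)
  qed
  finally show ?thesis .
qed

text \<open>All derivatives of \<open>\<phi>\<close> of positive order vanish at the origin, so only the term of \<open>(0, 0)\<close> survives; if it is absent from
  the sum, then \<open>b (0, 0) = 0\<close> by convention. The degree has to be finite, since a sum over infinitely many
  indices is \<open>0\<close> by definition and would not determine \<open>b (0, 0)\<close>.\<close>

lemma dirac_repr_locally_const:
  assumes repr: "dirac_repr \<Omega> r B b" and fin: "degree_div r B < \<infinity>"
    and \<phi>: "\<phi> \<in> test_funs \<Omega>" "0 < \<delta>" "\<And>x. norm x < \<delta> \<Longrightarrow> \<phi> x = v"
  shows "B \<phi> = b (0, 0) \<bullet> v"
proof -
  let ?S = "{\<alpha>. ereal (real (mdeg \<alpha>)) \<le> degree_div r B}"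
  obtain M :: nat where M: "degree_div r B \<le> ereal (real M)"
  proof (cases "degree_div r B")
    case (real x)
    then show ?thesis using that[of "nat \<lceil>x\<rceil>"] by (simp add: real_nat_ceiling_ge)
  qed (use fin that[of 0] in auto)
  have "?S \<subseteq> {\<alpha>. mdeg \<alpha> \<le> M}"
  proof
    fix \<alpha> assume "\<alpha> \<in> ?S"
    then have "ereal (real (mdeg \<alpha>)) \<le> ereal (real M)" using order_trans[OF _ M] by blast
    then show "\<alpha> \<in> {\<alpha>. mdeg \<alpha> \<le> M}" by simp
  qed
  then have finS: "finite ?S" using finite_mdeg_le finite_subset by blast
  have "mpartial \<alpha> (\<lambda>x. b \<alpha> \<bullet> \<phi> x) 0 = (if \<alpha> = (0, 0) then b \<alpha> \<bullet> v else 0)" for \<alpha>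
    by (rule mpartial_locally_const[OF \<phi>(2)]) (simp add: \<phi>(3))
  then have "vec_dist (b \<alpha>) (dist_mpartial \<alpha> dirac) \<phi> = (if \<alpha> = (0, 0) then b (0, 0) \<bullet> v else 0)" for \<alpha>
    by (simp add: vec_dist_def dist_mpartial_def dirac_def mdeg_def)
  then have "B \<phi> = (\<Sum>\<alpha>\<in>?S. if \<alpha> = (0, 0) then b (0, 0) \<bullet> v else 0)"
    using repr \<phi>(1) unfolding dirac_repr_def by simp
  also have "\<dots> = (if (0, 0) \<in> ?S then b (0, 0) \<bullet> v else 0)"
    using finS by simp
  also have "\<dots> = b (0, 0) \<bullet> v"
    using repr unfolding dirac_repr_def by auto
  finally show ?thesis .
qed

section \<open>Equilibrium of a singular stress field\<close>

theorem lemma3p2: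
  fixes \<Omega> :: "plane set"
    and \<sigma> :: "(real^2^2) functional"
    and B :: "(real^2) functional"
    and b :: "nat \<times> nat \<Rightarrow> real^2"
    and r \<epsilon> :: real
  assumes "bounded \<Omega>" "open \<Omega>" "connected \<Omega>" "0 \<in> \<Omega>"
    and "r > 0" "ball 0 r \<subseteq> \<Omega>"
    and "\<sigma> \<in> \<A> \<Omega> Sym"
    and "B \<in> \<E> \<Omega> UNIV" "dirac_repr \<Omega> r B b"
    and "\<epsilon> > 0" "closure (ball 0 \<epsilon>) \<subseteq> \<Omega>"
  defines "s \<equiv> restr_fun (\<Omega> - {0}) \<sigma>"
  shows "(equilibrium \<Omega> \<sigma> B \<longrightarrow>
            (\<forall>x\<in>\<Omega> - {0}. classical_div s x = 0) \<and>
            circle_integral \<epsilon> (\<lambda>x. s x *v outward_normal x) = - b (0, 0) \<and>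
            degree_div r B \<le> degree_div r \<sigma> + 1) \<and>
         (degree_div r \<sigma> < 0 \<longrightarrow>
            (equilibrium \<Omega> \<sigma> B \<longleftrightarrow>
              (\<forall>x\<in>\<Omega> - {0}. classical_div s x = 0) \<and>
              circle_integral \<epsilon> (\<lambda>x. s x *v outward_normal x) = - b (0, 0) \<and>
              degree_div r B \<le> degree_div r \<sigma> + 1))"
proof -
  let ?U = "\<Omega> - {0}"
  define flux where "flux = circle_integral \<epsilon> (\<lambda>x. s x *v outward_normal x)"
  have U: "open ?U" using assms(2) by auto
  have s: "given_by ?U \<sigma> s"
    unfolding s_def by (rule singular_at_0_given_by[OF assms(2,7)])
  then have sm: "smooth_on ?U s" by (simp add: given_by_def)
  have \<sigma>: "moderate \<Omega> \<sigma>"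
    using assms(7) by (intro distribution_moderate) (simp add: \<A>_def distributions_def)
  have B: "moderate \<Omega> B"
    using assms(8) by (intro distribution_moderate) (simp add: \<E>_def distributions_def)
  have Bfin: "degree_div r B < \<infinity>"
  proof -
    obtain k where "admissible r B k" using moderate_has_admissible_exponent[OF B assms(5,6)] by blast
    then have "scaling_degree r B \<le> ereal k"
      unfolding scaling_degree_admissible by (intro Inf_lower) blast
    then show ?thesis unfolding degree_div_def by (cases "scaling_degree r B") auto
  qed
  have B_const: "B \<phi> = b (0, 0) \<bullet> v"
    if "\<phi> \<in> test_funs \<Omega>" "0 < \<delta>" "\<And>x. norm x < \<delta> \<Longrightarrow> \<phi> x = v" for \<phi> \<delta> v
    by (rule dirac_repr_locally_const[OF assms(9) Bfin that])
  have off: "Div \<sigma> \<psi> = integral UNIV (\<lambda>x. classical_div s x \<bullet> \<psi> x)" "B \<psi> = 0"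
    if \<psi>: "\<psi> \<in> test_funs ?U" for \<psi>
  proof -
    show "Div \<sigma> \<psi> = integral UNIV (\<lambda>x. classical_div s x \<bullet> \<psi> x)"
      using given_by_eval[OF s grad_test_funs[OF \<psi>]] integration_by_parts[OF U sm \<psi>] by (simp add: Div_def)
    have "open (- supp \<psi>)" "0 \<in> - supp \<psi>" using test_funsD(3)[OF \<psi>] by (auto simp: open_Compl)
    then obtain \<delta> where "\<delta> > 0" "ball 0 \<delta> \<subseteq> - supp \<psi>" using open_contains_ball by blast
    then have "\<psi> x = 0" if "norm x < \<delta>" for x using not_in_supp[of x \<psi>] that by auto
    then show "B \<psi> = 0" using B_const[OF test_funs_mono[OF \<psi>] \<open>\<delta> > 0\<close>, of 0] by simp
  qed
  \<comment> \<open>The disc of radius \<open>R\<close> has to lie inside the ball of the scaling degree and inside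
    the circle of the flux.\<close>
  define R where "R = min (r / 2) \<epsilon>"
  have R: "0 < R" "R < r" "R \<le> \<epsilon>" using assms(5,10) by (auto simp: R_def)
  have eps: "cball 0 \<epsilon> \<subseteq> \<Omega>" using assms(10,11) by simp
  have cut: "(\<lambda>x. cutoff 0 (R / 2) R x *\<^sub>R v) \<in> test_funs \<Omega>" for v :: "real^2"
    using R assms(6) by (intro cutoff_test_fun) auto
  have Dcut: "Div \<sigma> (\<lambda>x. cutoff 0 (R / 2) R x *\<^sub>R v) + B (\<lambda>x. cutoff 0 (R / 2) R x *\<^sub>R v) = (flux + b (0, 0)) \<bullet> v"
    if div: "\<forall>x\<in>?U. classical_div s x = 0" for v
  proof -
    have in_U: "x \<in> ?U" if "0 < norm x" "norm x \<le> \<epsilon>" for x using that eps by auto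
    have g: "grad (\<lambda>x. cutoff 0 (R / 2) R x *\<^sub>R v) \<in> test_funs ?U"
    proof (rule grad_cutoff_test_fun)
      fix x :: plane assume "R / 2 \<le> norm x" "norm x \<le> R"
      then show "x \<in> ?U" using R by (intro in_U) linarith+
    qed (use R in simp_all)
    have "\<sigma> (grad (\<lambda>x. cutoff 0 (R / 2) R x *\<^sub>R v)) = - (flux \<bullet> v)"
      unfolding given_by_eval[OF s g] flux_def
      by (rule flux_identity[OF U sm]) (use R div in_U in auto)
    moreover have "B (\<lambda>x. cutoff 0 (R / 2) R x *\<^sub>R v) = b (0, 0) \<bullet> v"
      by (rule B_const[OF cut, of "R / 2"]) (use R cutoff_inside[of "R / 2" R 0] in auto)
    ultimately show ?thesis by (simp add: Div_def inner_add_left)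
  qed
  have necessary: "(\<forall>x\<in>?U. classical_div s x = 0) \<and> flux = - b (0, 0) \<and> degree_div r B \<le> degree_div r \<sigma> + 1"
    if eq: "equilibrium \<Omega> \<sigma> B"
  proof -
    have eqD: "Div \<sigma> \<psi> + B \<psi> = 0" if "\<psi> \<in> test_funs \<Omega>" for \<psi>
      using eq that by (simp add: equilibrium_def)
    have div: "\<forall>x\<in>?U. classical_div s x = 0"
    proof
      fix x assume "x \<in> ?U"
      then show "classical_div s x = 0"
      proof (rule fundamental_lemma[OF U smooth_on_classical_div[OF U sm]])
        fix \<psi> :: "plane \<Rightarrow> real^2" assume \<psi>: "\<psi> \<in> test_funs ?U"
        show "integral UNIV (\<lambda>x. classical_div s x \<bullet> \<psi> x) = 0"
          using eqD[OF test_funs_mono[OF \<psi>]] off[OF \<psi>] by auto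
      qed
    qed
    \<comment> \<open>The constant vector \<open>v\<close> is chosen as the defect itself.\<close>
    have "(flux + b (0, 0)) \<bullet> (flux + b (0, 0)) = 0"
      using Dcut[OF div, of "flux + b (0, 0)"] eqD[OF cut, of "flux + b (0, 0)"] by simp
    then have fl: "flux = - b (0, 0)" by (simp add: eq_neg_iff_add_eq_0)
    have "scaling_degree r B \<le> scaling_degree r \<sigma> + 1"
    proof (rule scaling_degree_le_add_1)
      fix k assume "admissible r \<sigma> k"
      from admissible_uminus[OF admissible_Div[OF \<sigma> assms(5,6) this]]
      show "admissible r B (k + 1)"
      proof (rule admissible_cong[OF _ assms(5)])
        fix \<phi> :: "plane \<Rightarrow> real^2" assume "\<phi> \<in> test_funs (ball 0 r)"
        from eqD[OF test_funs_mono[OF this assms(6)]] show "- Div \<sigma> \<phi> = B \<phi>" by simp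
      qed
    qed
    then have "degree_div r B \<le> degree_div r \<sigma> + 1"
      unfolding degree_div_def
      by (cases "scaling_degree r B"; cases "scaling_degree r \<sigma>") (auto simp: one_ereal_def)
    with div fl show ?thesis by blast
  qed
  have sufficient: "equilibrium \<Omega> \<sigma> B"
    if deg: "degree_div r \<sigma> < 0" "degree_div r B \<le> degree_div r \<sigma> + 1"
      and div: "\<forall>x\<in>?U. classical_div s x = 0" and fl: "flux = - b (0, 0)"
  proof -
    have "scaling_degree r \<sigma> < 2" "scaling_degree r B < 3"
      using deg unfolding degree_div_def
      by (cases "scaling_degree r B"; cases "scaling_degree r \<sigma>"; auto simp: one_ereal_def zero_ereal_def)+
    then obtain k k' where k: "admissible r \<sigma> k" "k < 2" "admissible r B k'" "k' < 3"
      unfolding scaling_degree_admissible Inf_less_iff by auto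
    have adm: "admissible r (\<lambda>\<psi>. Div \<sigma> \<psi> + B \<psi>) (max (k + 1) k')"
      by (intro admissible_add admissible_mono[OF admissible_Div[OF \<sigma> assms(5,6) k(1)]]
          admissible_mono[OF k(3)]) auto
    show ?thesis
      unfolding equilibrium_def
    proof
      fix \<psi> :: "plane \<Rightarrow> real^2" assume \<psi>: "\<psi> \<in> test_funs \<Omega>"
      show "Div \<sigma> \<psi> + B \<psi> = 0"
      proof (rule point_supported_vanishes[OF moderate_sum[OF moderate_Div[OF \<sigma>] B] _ R(1,2) assms(6) _ _ _ \<psi>])
        show "max (k + 1) k' < 3" using k by simp
        show "((\<lambda>l. l powr max (k + 1) k' * (Div \<sigma> (scaled l \<phi>) + B (scaled l \<phi>))) \<longlongrightarrow> 0) (at_right 0)"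
          if "\<phi> \<in> test_funs (ball 0 r)" for \<phi>
          using adm that by (simp add: admissible_def)
        show "Div \<sigma> (\<lambda>x. cutoff 0 (R / 2) R x *\<^sub>R v) + B (\<lambda>x. cutoff 0 (R / 2) R x *\<^sub>R v) = 0" for v
          using Dcut[OF div, of v] fl by simp
        fix \<phi> :: "plane \<Rightarrow> real^2" assume \<phi>: "\<phi> \<in> test_funs ?U"
        have "classical_div s x \<bullet> \<phi> x = 0" for x
          using div test_funs_zero_outside[OF \<phi>, of x] by (cases "x \<in> ?U") auto
        then show "Div \<sigma> \<phi> + B \<phi> = 0" by (simp add: off[OF \<phi>])
      qed
    qed
  qed
  show ?thesis
    using necessary sufficient unfolding flux_def by blast
qed

end
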